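(* Let $(W,P)$ be a minuscule pair of one of the types $A_n,B_n,C_n,D_n,E_6,E_7$, and let $\mathcal{F}$ be the associated set of tropical strong exchange equations (listed in the context). Then $\mathcal{F}$ is affinely invariant. Consequently, every height function $\mu\colon V(\Delta(W/P))\to\mathbb{T}$ satisfying all equations in $\mathcal{F}$ induces a strong matroidal subdivision, i.e. every cell of the regular subdivision of $\mathrm{conv}(\supp\mu)$ induced by $\mu$ is of the form $\Delta(\mathcal{M})$ for a strong Coxeter matroid $\mathcal{M}\subseteq W/P$.
   Context: Tropical conventions: $\mathbb{T}=\mathbb{R}\cup\{\infty\}$ with $\oplus=\min$, $\odot=+$; $\nu\in V^{\mathrm{trop}}(f)$ means the minimum of the monomials of $f$ evaluated at $\nu$ is $\infty$ or attained at least twice. A set $\mathcal{F}$ of tropical polynomials with trivial coefficients in variables indexed by a finite set $E\subset\mathbb{R}^m$ is affinely invariant if for all $\mu\colon E\to\mathbb{T}$ and all affine linear $\varphi\colon\mathbb{R}^m\to\mathbb{R}$: $\mu\in V^{\mathrm{trop}}(\mathcal{F})\iff\mu+\varphi|_E\in V^{\mathrm{trop}}(\mathcal{F})$. Regular subdivision induced by $\mu$: project the lower faces of $\mathrm{conv}\{(e,\mu(e)):\mu(e)<\infty\}$. Coxeter matroids: $W$ is a finite Weyl group with root system $\Phi\subset\mathbb{R}^m$, $P$ a parabolic subgroup, $v\in\mathbb{R}^m$ with $\mathrm{stab}_W(v)=P$; cosets $\sigma P$ are identified with points $\sigma v$, and for $\mathcal{M}\subseteq W/P$, $\Delta(\mathcal{M})=\mathrm{conv}\{\sigma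 v:\sigma P\in\mathcal{M}\}$. $\mathcal{M}$ has the strong exchange property (is a strong Coxeter matroid) if for all $A,B\in\mathcal{M}$ there is a reflection $s$ of $W$ (in a root of $\Phi$) whose mirror separates $A$ and $B$ and with $sA,sB\in\mathcal{M}$. $P$ is minuscule if the Bruhat order on $W/P$ is a lattice. The minuscule pairs and their equations (with $V(\Delta(W/P))$ the vertex set): - $(A_n,P_r)$: vertices $e_A$, $A\in\binom{[n+1]}{r}$; equations are the tropical Grassmann–Plücker relations $\bigoplus_{j\in T\setminus S}x_{S\cup j}\odot x_{T\setminus j}$ for $S\in\binom{[n+1]}{r-1}$, $T\in\binom{[n+1]}{r+1}$. - $(B_n,P_n)$: vertices $e_A-(\tfrac12,\dots,\tfrac12)$, $A\subseteq[n]$; equations, for $I,J\subseteq[n]$ with $|I\triangle J|\ge3$: $f^B_{I,J}=\bigoplus_{i\in I\triangle J}x_{I\triangle i}\odot x_{J\triangle i}$ if $|I\triangle J|$ is even, and $x_I\odot x_J\oplus\bigoplus_{i\in I\triangle J}x_{I\triangle i}\odot x_{J\triangle i}$ if odd (here $I\triangle i=I\triangle\{i\}$). - $(C_n,P_1)$: vertices $\pm e_i$ (the cross polytope $\Diamond_n$); no equations. - $(D_n,P_1)$: vertices $\pm e_i$; single equation $\bigoplus_{i=1}^n x_i\odot x_{-i}$. - $(D_n,P_n)$: vertices $e_A-(\tfrac12,\dots,\tfrac12)$ for even $A\subseteq[n]$; equations $\bigoplus_{i\in I\triangle J}x_{I\triangle i}\odot x_{J\triangle i}$ for $I,J\subseteq[n]$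 of odd cardinality with $|I\triangle J|\ge4$; $(D_n,P_{n-1})$ is the same with the roles of even and odd subsets exchanged. - $(E_6,P_1)$ (and isomorphically $(E_6,P_6)$): $\Delta(W/P)$ is the 27-vertex polytope $2_{21}$; each pair $A,B$ of vertices at edge-distance $2$ spans a 5-dimensional cross-polytope face with antipodal pairs $(A,B),(C_1,C_1'),\dots,(C_4,C_4')$, giving the equation $x_A\odot x_B\oplus\bigoplus_{i=1}^4x_{C_i}\odot x_{C_i'}$. - $(E_7,P_7)$: $\Delta(W/P)$ is the 56-vertex polytope $3_{21}$; each distance-2 pair $(A,B)$ spans a 6-dimensional cross-polytope face with antipodal pairs $(A,B),(C_1,C_1'),\dots,(C_5,C_5')$, giving $x_A\odot x_B\oplus\bigoplus_{i=1}^5x_{C_i}\odot x_{C_i'}$; additionally $\bigoplus_{A}x_A\odot x_{-A}$, where $-A$ is the unique vertex at edge-distance $3$ from $A$. *)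

theory Defs
  imports "HOL-Analysis.Analysis" "HOL-Library.Multiset"
begin

section \<open>Tropical polynomials with trivial coefficients\<close>

text \<open>
  The tropical numbers are the extended reals other than \<open>-\<infinity>\<close>. A monomial is the multiset of
  its variables, and a tropical polynomial with trivial coefficients is a finite formal tropical sum
  of monomials, i.e. a multiset of monomials. Formal sums rather than sets of monomials are needed
  for the Grassmann--Pluecker relations: if \<open>T - S = {j, k}\<close>, the terms for \<open>j\<close> and \<open>k\<close>
  are the same monomial, and the minimum counts as attained twice.
\<close>

type_synonym 'a trop_poly = "'a multiset multiset"

definition heights :: "'a set \<Rightarrow> ('a \<Rightarrow> ereal) set" where
  "heights E = {\<mu>. \<forall>e\<in>E. \<mu> e \<noteq> -\<infinity>}"

definition monomial_val :: "('a \<Rightarrow> ereal) \<Rightarrow> 'a multiset \<Rightarrow> ereal" where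
  "monomial_val \<mu> m = (\<Sum>e\<in>#m. \<mu> e)"

definition trop_val :: "('a \<Rightarrow> ereal) \<Rightarrow> 'a trop_poly \<Rightarrow> ereal" where
  "trop_val \<mu> f = (INF m\<in>set_mset f. monomial_val \<mu> m)"

definition trop_vanishes :: "('a \<Rightarrow> ereal) \<Rightarrow> 'a trop_poly \<Rightarrow> bool" where
  "trop_vanishes \<mu> f \<longleftrightarrow>
     trop_val \<mu> f = \<infinity> \<or> size (filter_mset (\<lambda>m. monomial_val \<mu> m = trop_val \<mu> f) f) \<ge> 2"

definition trop_variety :: "'a set \<Rightarrow> 'a trop_poly set \<Rightarrow> ('a \<Rightarrow> ereal) set" where
  "trop_variety E \<F> = {\<mu> \<in> heights E. \<forall>f\<in>\<F>. trop_vanishes \<mu> f}"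

definition affinely_invariant :: "'a::euclidean_space set \<Rightarrow> 'a trop_poly set \<Rightarrow> bool" where
  "affinely_invariant E \<F> \<longleftrightarrow>
     (\<forall>\<mu>\<in>heights E. \<forall>g c. linear g \<longrightarrow>
        (\<mu> \<in> trop_variety E \<F> \<longleftrightarrow> (\<lambda>e. \<mu> e + ereal (g e + c)) \<in> trop_variety E \<F>))"


section \<open>Regular subdivisions\<close>

definition supp :: "'a set \<Rightarrow> ('a \<Rightarrow> ereal) \<Rightarrow> 'a set" where
  "supp E \<mu> = {e\<in>E. \<mu> e < \<infinity>}"

definition lifted_polytope ::
  "'a::euclidean_space set \<Rightarrow> ('a \<Rightarrow> ereal) \<Rightarrow> ('a \<times> real) set" where
  "lifted_polytope E \<mu> = convex hull ((\<lambda>e. (e, real_of_ereal (\<mu> e))) ` supp E \<mu>)"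

text \<open>Lower faces are those with an inner normal whose last coordinate is positive, here scaled to 1.\<close>

definition lower_faces :: "('a::euclidean_space \<times> real) set \<Rightarrow> ('a \<times> real) set set" where
  "lower_faces Q = {G. G \<noteq> {} \<and>
     (\<exists>a b. (\<forall>z\<in>Q. b \<le> (a, 1) \<bullet> z) \<and> G = {z\<in>Q. (a, 1) \<bullet> z = b})}"

definition regular_subdivision :: "'a::euclidean_space set \<Rightarrow> ('a \<Rightarrow> ereal) \<Rightarrow> 'a set set" where
  "regular_subdivision E \<mu> = (`) fst ` lower_faces (lifted_polytope E \<mu>)"


section \<open>Strong Coxeter matroids\<close>

definition reflection :: "'a::euclidean_space \<Rightarrow> 'a \<Rightarrow> 'a" where
  "reflection \<alpha> x = x - (2 * (\<alpha> \<bullet> x) / (\<alpha> \<bullet> \<alpha>)) *\<^sub>R \<alpha>"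

inductive_set weyl_group :: "'a::euclidean_space set \<Rightarrow> ('a \<Rightarrow> 'a) set" for \<Phi> where
  id: "id \<in> weyl_group \<Phi>"
| step: "w \<in> weyl_group \<Phi> \<Longrightarrow> \<alpha> \<in> \<Phi> \<Longrightarrow> reflection \<alpha> \<circ> w \<in> weyl_group \<Phi>"

text \<open>
  The parabolic subgroup \<open>P\<close> is given by a point \<open>v\<close> with stabilizer \<open>P\<close>. A coset \<open>wP\<close> is
  identified with the point \<open>w v\<close>, so that the orbit of \<open>v\<close> stands both for \<open>W/P\<close> and for the
  vertex set of \<open>\<Delta>(W/P)\<close>.
\<close>

definition weyl_orbit :: "'a::euclidean_space set \<Rightarrow> 'a \<Rightarrow> 'a set" where
  "weyl_orbit \<Phi> v = (\<lambda>w. w v) ` weyl_group \<Phi>"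

text \<open>The exchange condition concerns distinct elements: no mirror separates an element from itself.\<close>

definition strong_coxeter_matroid :: "'a::euclidean_space set \<Rightarrow> 'a \<Rightarrow> 'a set \<Rightarrow> bool" where
  "strong_coxeter_matroid \<Phi> v M \<longleftrightarrow> M \<subseteq> weyl_orbit \<Phi> v \<and>
     (\<forall>A\<in>M. \<forall>B\<in>M. A \<noteq> B \<longrightarrow>
        (\<exists>\<alpha>\<in>\<Phi>. (\<alpha> \<bullet> A) * (\<alpha> \<bullet> B) < 0 \<and> reflection \<alpha> A \<in> M \<and> reflection \<alpha> B \<in> M))"

definition strong_matroidal_subdivision ::
  "'a::euclidean_space set \<Rightarrow> 'a \<Rightarrow> ('a \<Rightarrow> ereal) \<Rightarrow> bool" where
  "strong_matroidal_subdivision \<Phi> v \<mu> \<longleftrightarrow>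
     (\<forall>C \<in> regular_subdivision (weyl_orbit \<Phi> v) \<mu>.
        \<exists>M. strong_coxeter_matroid \<Phi> v M \<and> C = convex hull M)"


section \<open>Root systems\<close>

abbreviation unit_vec :: "'n::finite \<Rightarrow> real^'n" where
  "unit_vec i \<equiv> axis i 1"

definition roots_A :: "(real^'n) set" where
  "roots_A = {unit_vec i - unit_vec j | i j. i \<noteq> j}"

definition roots_D :: "(real^'n) set" where
  "roots_D = {s *\<^sub>R unit_vec i + t *\<^sub>R unit_vec j | i j s t. i \<noteq> j \<and> s \<in> {1, -1} \<and> t \<in> {1, -1}}"

definition roots_B :: "(real^'n) set" where
  "roots_B = roots_D \<union> {s *\<^sub>R unit_vec i | i s. s \<in> {1, -1}}"

definition roots_C :: "(real^'n) set" where
  "roots_C = roots_D \<union> {s *\<^sub>R unit_vec i | i s. s \<in> {2, -2}}"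

text \<open>
  \<open>E\<^sub>8\<close> in an eight-dimensional space, and \<open>E\<^sub>7\<close>, \<open>E\<^sub>6\<close> inside it, in Bourbaki's coordinates;
  the indices \<open>p\<close>, \<open>q\<close>, \<open>r\<close> play the roles of 6, 7, 8.
\<close>

definition roots_E8 :: "(real^'n) set" where
  "roots_E8 = roots_D \<union>
     {x. (\<forall>i. x $ i \<in> {1/2, -1/2}) \<and> even (card {i. x $ i < 0})}"

definition roots_E7 :: "'n \<Rightarrow> 'n \<Rightarrow> (real^'n) set" where
  "roots_E7 q r = {x \<in> roots_E8. x $ q = - x $ r}"

definition roots_E6 :: "'n \<Rightarrow> 'n \<Rightarrow> 'n \<Rightarrow> (real^'n) set" where
  "roots_E6 p q r = {x \<in> roots_E8. x $ p = x $ q \<and> x $ q = - x $ r}"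


section \<open>The strong exchange equations\<close>

definition e_vec :: "'n::finite set \<Rightarrow> real^'n" where
  "e_vec A = (\<Sum>i\<in>A. unit_vec i)"

definition spin_vec :: "'n::finite set \<Rightarrow> real^'n" where
  "spin_vec A = e_vec A - (\<chi> i. 1/2)"

definition eqs_A :: "nat \<Rightarrow> (real^'n) trop_poly set" where
  "eqs_A k =
     {image_mset (\<lambda>j. {#e_vec (insert j S), e_vec (T - {j})#}) (mset_set (T - S)) | S T.
        card S + 1 = k \<and> card T = k + 1}"

definition spin_exchange :: "'n set \<Rightarrow> 'n set \<Rightarrow> (real^'n) trop_poly" where
  "spin_exchange I J =
     image_mset (\<lambda>i. {#spin_vec (sym_diff I {i}), spin_vec (sym_diff J {i})#})
       (mset_set (sym_diff I J))"

definition eqs_B_spin :: "(real^'n) trop_poly set" where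
  "eqs_B_spin =
     {(if even (card (sym_diff I J)) then spin_exchange I J
       else add_mset {#spin_vec I, spin_vec J#} (spin_exchange I J)) | I J.
        card (sym_diff I J) \<ge> 3}"

definition eqs_D_vector :: "(real^'n) trop_poly set" where
  "eqs_D_vector = {image_mset (\<lambda>i. {#unit_vec i, - unit_vec i#}) (mset_set UNIV)}"

text \<open>For the vertices \<open>spin_vec A\<close> with \<open>card A\<close> even, the sets \<open>I\<close>, \<open>J\<close> are odd.\<close>

definition eqs_D_spin_even :: "(real^'n) trop_poly set" where
  "eqs_D_spin_even =
     {spin_exchange I J | I J. odd (card I) \<and> odd (card J) \<and> card (sym_diff I J) \<ge> 4}"

definition eqs_D_spin_odd :: "(real^'n) trop_poly set" where
  "eqs_D_spin_odd =
     {spin_exchange I J | I J. even (card I) \<and> even (card J) \<and> card (sym_diff I J) \<ge> 4}"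

definition edge_dist :: "'a::euclidean_space set \<Rightarrow> 'a \<Rightarrow> 'a \<Rightarrow> nat" where
  "edge_dist V A B =
     (LEAST k. (A, B) \<in> {(x, y). closed_segment x y edge_of convex hull V} ^^ k)"

text \<open>
  The \<open>d\<close>-dimensional cross-polytope with center \<open>c\<close> and antipodal pairs \<open>c + u\<close>, \<open>c - u\<close> for
  \<open>u \<in> U\<close>; one equation for each such face in which some antipodal pair has edge-distance 2.
\<close>

definition eqs_cross_polytope :: "nat \<Rightarrow> 'a::euclidean_space set \<Rightarrow> 'a trop_poly set" where
  "eqs_cross_polytope d V =
     {mset_set ((\<lambda>u. {#c + u, c - u#}) ` U) | c U.
        independent U \<and> card U = d \<and>
        (\<lambda>u. c + u) ` U \<union> (\<lambda>u. c - u) ` U \<subseteq> V \<and>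
        convex hull ((\<lambda>u. c + u) ` U \<union> (\<lambda>u. c - u) ` U) face_of convex hull V \<and>
        (\<exists>u\<in>U. edge_dist V (c + u) (c - u) = 2)}"

text \<open>
  The sum of the monomials \<open>x\<^sub>A x\<^sub>-\<^sub>A\<close> has one term for each antipodal pair \<open>{A, -A}\<close>, that is, for
  each pair at edge-distance 3. Were \<open>A\<close> to run over all vertices of the sum, every term would occur
  twice and the equation would be void.
\<close>

definition eq_antipodal :: "'a::euclidean_space set \<Rightarrow> 'a trop_poly" where
  "eq_antipodal V = mset_set {{#A, B#} | A B. A \<in> V \<and> B \<in> V \<and> edge_dist V A B = 3}"


section \<open>The minuscule pairs\<close>

text \<open>
  \<open>minuscule_pair \<Phi> v \<F>\<close>: \<open>\<Phi>\<close> is the root system of \<open>W\<close>, the stabilizer of \<open>v\<close> is \<open>P\<close>, and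
  \<open>\<F>\<close> is the set of strong exchange equations of \<open>(W, P)\<close>. The index set \<open>{1..n}\<close> is the
  finite type \<open>'n\<close> (\<open>{1..n+1}\<close> in type \<open>A\<^sub>n\<close>), and \<open>v\<close> may be any vertex of the
  classical polytopes. For \<open>D\<^sub>n\<close> the bound \<open>n \<ge> 2\<close> is all that is needed for the listed points
  to form a single orbit. In types \<open>E\<^sub>6\<close>, \<open>E\<^sub>7\<close> the vectors \<open>v\<close> are Bourbaki's fundamental weights
  \<open>\<omega>\<^sub>1\<close>, \<open>\<omega>\<^sub>6\<close> and \<open>\<omega>\<^sub>7\<close>.
\<close>

inductive minuscule_pair :: "(real^'n) set \<Rightarrow> real^'n \<Rightarrow> (real^'n) trop_poly set \<Rightarrow> bool" where
  A: "1 \<le> card K \<Longrightarrow> card K < CARD('n) \<Longrightarrow>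
      minuscule_pair roots_A (e_vec (K :: 'n set)) (eqs_A (card K))"
| B_spin: "minuscule_pair roots_B (spin_vec K) eqs_B_spin"
| C_vector: "minuscule_pair roots_C (unit_vec i) {}"
| D_vector: "CARD('n) \<ge> 2 \<Longrightarrow> minuscule_pair roots_D (unit_vec (i :: 'n)) eqs_D_vector"
| D_spin_even: "CARD('n) \<ge> 2 \<Longrightarrow> even (card K) \<Longrightarrow>
      minuscule_pair roots_D (spin_vec (K :: 'n set)) eqs_D_spin_even"
| D_spin_odd: "CARD('n) \<ge> 2 \<Longrightarrow> odd (card K) \<Longrightarrow>
      minuscule_pair roots_D (spin_vec (K :: 'n set)) eqs_D_spin_odd"
| E6_1: "CARD('n) = 8 \<Longrightarrow> distinct [p, q, r :: 'n] \<Longrightarrow>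
      v = (2/3) *\<^sub>R (unit_vec r - unit_vec q - unit_vec p) \<Longrightarrow>
      minuscule_pair (roots_E6 p q r) v
        (eqs_cross_polytope 5 (weyl_orbit (roots_E6 p q r) v))"
| E6_6: "CARD('n) = 8 \<Longrightarrow> distinct [i, p, q, r :: 'n] \<Longrightarrow>
      v = (1/3) *\<^sub>R (unit_vec r - unit_vec q - unit_vec p) + unit_vec i \<Longrightarrow>
      minuscule_pair (roots_E6 p q r) v
        (eqs_cross_polytope 5 (weyl_orbit (roots_E6 p q r) v))"
| E7_7: "CARD('n) = 8 \<Longrightarrow> distinct [p, q, r :: 'n] \<Longrightarrow>
      v = unit_vec p + (1/2) *\<^sub>R (unit_vec r - unit_vec q) \<Longrightarrow>
      minuscule_pair (roots_E7 q r) v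
        (insert (eq_antipodal (weyl_orbit (roots_E7 q r) v))
          (eqs_cross_polytope 6 (weyl_orbit (roots_E7 q r) v)))"

end

theory Submission
  imports Defs
begin

text \<open>
  All monomials of an equation are products of two variables whose indices have the same sum, so
  adding an affine function to \<open>\<mu>\<close> shifts the values of all monomials by the same constant. A cell of
  the subdivision is the convex hull of the zero set \<open>M\<close> of a shift of \<open>\<mu>\<close> that is nonnegative on all
  vertices. Given distinct \<open>A, B \<in> M\<close> that are not exchanged by a reflection, the monomial of \<open>A\<close>
  and \<open>B\<close> occurs in some equation, where it has the minimal value 0; a second monomial with value 0
  yields two further elements of \<open>M\<close>, and in every type these are the images of \<open>A\<close> and \<open>B\<close> under
  a reflection whose mirror separates them.

  In types \<open>E\<^sub>6\<close> and \<open>E\<^sub>7\<close> the orbit is controlled by inner products, which lie in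
  \<open>{N, N - 1, N - 2, N - 3}\<close> with \<open>N = v \<bullet> v\<close>: since the differences of vertices lie in the \<open>E\<^sub>8\<close>
  lattice, whose vectors of norm 2 are the roots, vertices with inner product \<open>N - 1\<close> differ by a root.
  The sums of two vertices with inner product \<open>N - 2\<close> form a single orbit of \<open>W\<close>, and for one
  representative the face on which it is maximal is visibly a cross-polytope.
\<close>

section \<open>Shifting heights by affine functions\<close>

text \<open>Once a height function is shifted to be nonnegative, the claim about its cells becomes a
  condition on single pairs of vertices in which neither \<open>\<mu>\<close> nor \<open>M\<close>
  occurs (\<open>exchangeable\<close>).

  The obstacle in types E is that the equations are phrased through faces and edge-distances of
  polytopes with 27 or 56 vertices. No vertex list is formed. All these notions are recovered from
  inner products: \<open>N - 1\<close> characterises edges, a pair with product \<open>N - 2\<close>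
  has edge-distance 2 and is a diagonal of the face on which \<open>x + y\<close> is maximal, and
  product \<open>N - 3\<close>, which only occurs in type E7, means opposite vertices at
  edge-distance 3.

  The sums of pairs with product \<open>N - 2\<close> are conjugate for different reasons. In type
  E6 such a sum is the negative of a third vertex, and the Weyl group is transitive on vertices; in
  type E7 it is a root, and transitivity on roots has to be shown. The base points lie outside the
  E8 lattice, so lattice arguments apply to differences of vertices.\<close>

lemma monomial_val_pair: "monomial_val \<mu> {#A, B#} = \<mu> A + \<mu> B"
  by (simp add: monomial_val_def)

lemma monomial_val_shift:
  fixes g :: "'a::euclidean_space \<Rightarrow> real"
  assumes "linear g"
  shows "monomial_val (\<lambda>e. \<mu> e + ereal (g e + c)) {#A, B#} =
    monomial_val \<mu> {#A, B#} + ereal (g (A + B) + 2 * c)"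
proof -
  have "ereal (g (A + B) + 2 * c) = ereal (g A + c) + ereal (g B + c)"
    using assms by (simp add: linear_add)
  then show ?thesis
    by (simp only: monomial_val_pair) (simp only: ac_simps)
qed

text \<open>Adding a finite \<open>k\<close> is an order automorphism of the extended reals that
  fixes \<open>\<infinity>\<close>, so it commutes with the infimum and preserves the set of
  monomials attaining it.\<close>

lemma trop_vanishes_shift:
  assumes shift: "\<And>m. m \<in># f \<Longrightarrow> monomial_val \<mu>' m = monomial_val \<mu> m + ereal k"
  shows "trop_vanishes \<mu>' f \<longleftrightarrow> trop_vanishes \<mu> f"
proof (cases "f = {#}")
  case True
  then show ?thesis by (simp add: trop_vanishes_def trop_val_def)
next
  case False
  have "trop_val \<mu>' f = (INF m\<in>set_mset f. monomial_val \<mu> m + ereal k)"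
    unfolding trop_val_def using shift by (intro INF_cong) auto
  also have "\<dots> = trop_val \<mu> f + ereal k"
  proof (rule antisym)
    show "(INF m\<in>set_mset f. monomial_val \<mu> m + ereal k) \<le> trop_val \<mu> f + ereal k"
    proof -
      \<comment> \<open>With \<open>k\<close> moved to the left, the right side is a bare infimum
        and \<open>INF_greatest\<close> applies.\<close>
      have "(INF m\<in>set_mset f. monomial_val \<mu> m + ereal k) - ereal k \<le> trop_val \<mu> f"
        unfolding trop_val_def
      proof (rule INF_greatest)
        fix m assume "m \<in> set_mset f"
        then have "(INF m\<in>set_mset f. monomial_val \<mu> m + ereal k) \<le> monomial_val \<mu> m + ereal k"
          by (rule INF_lower)
        then show "(INF m\<in>set_mset f. monomial_val \<mu> m + ereal k) - ereal k \<le> monomial_val \<mu> m"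
          by (simp add: ereal_minus_le)
      qed
      then show ?thesis by (simp add: ereal_minus_le)
    qed
    show "trop_val \<mu> f + ereal k \<le> (INF m\<in>set_mset f. monomial_val \<mu> m + ereal k)"
      unfolding trop_val_def by (intro INF_greatest add_right_mono INF_lower)
  qed
  finally have tv: "trop_val \<mu>' f = trop_val \<mu> f + ereal k" .
  have inj: "a + ereal k = b + ereal k \<longleftrightarrow> a = b" for a b
    by (cases a; cases b) auto
  have "filter_mset (\<lambda>m. monomial_val \<mu>' m = trop_val \<mu>' f) f =
    filter_mset (\<lambda>m. monomial_val \<mu> m = trop_val \<mu> f) f"
    by (rule filter_mset_cong) (auto simp: shift tv inj)
  moreover have "trop_val \<mu>' f = \<infinity> \<longleftrightarrow> trop_val \<mu> f = \<infinity>"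
    unfolding tv by (cases "trop_val \<mu> f") auto
  ultimately show ?thesis by (simp add: trop_vanishes_def)
qed

text \<open>Degree two makes the constant part of an affine function contribute \<open>2 * c\<close>
  to every monomial, and the common sum makes the linear part contribute \<open>g s\<close>.
  Geometrically, the segments joining the two indices of a monomial share the midpoint
  \<open>s / 2\<close>.\<close>

definition balanced :: "'a::euclidean_space trop_poly \<Rightarrow> bool" where
  "balanced f \<longleftrightarrow> (\<exists>s. \<forall>m\<in>#f. \<exists>A B. m = {#A, B#} \<and> A + B = s)"

lemma affinely_invariant_if_balanced:
  assumes "\<And>f. f \<in> \<F> \<Longrightarrow> balanced f"
  shows "affinely_invariant E \<F>"
  unfolding affinely_invariant_def
proof (intro ballI allI impI)
  fix \<mu> :: "'a \<Rightarrow> ereal" and g :: "'a \<Rightarrow> real" and c :: real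
  assume \<mu>: "\<mu> \<in> heights E" and g: "linear g"
  let ?\<mu>' = "\<lambda>e. \<mu> e + ereal (g e + c)"
  have "?\<mu>' \<in> heights E"
    using \<mu> by (auto simp: heights_def)
  moreover have "trop_vanishes ?\<mu>' f \<longleftrightarrow> trop_vanishes \<mu> f" if "f \<in> \<F>" for f
  proof -
    from assms[OF that] obtain s where s: "\<forall>m\<in>#f. \<exists>A B. m = {#A, B#} \<and> A + B = s"
      unfolding balanced_def by blast
    show ?thesis
    proof (rule trop_vanishes_shift)
      fix m assume "m \<in># f"
      with s obtain A B where "m = {#A, B#}" "A + B = s" by blast
      then show "monomial_val ?\<mu>' m = monomial_val \<mu> m + ereal (g s + 2 * c)"
        by (simp only: monomial_val_shift[OF g])
    qed
  qed
  ultimately show "\<mu> \<in> trop_variety E \<F> \<longleftrightarrow> ?\<mu>' \<in> trop_variety E \<F>"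
    using \<mu> by (auto simp: trop_variety_def)
qed

section \<open>Cells of regular subdivisions\<close>

text \<open>A convex combination giving positive weight to a point strictly above the hyperplane,
  with the other point not below it, is itself strictly above. Hence the open half-space together
  with the hull \<open>F\<close> of the contact points is convex, and it contains
  \<open>S\<close>.\<close>

lemma convex_hull_supporting_hyperplane:
  fixes S :: "'a::real_inner set"
  assumes "\<And>x. x \<in> S \<Longrightarrow> b \<le> a \<bullet> x"
  shows "{x \<in> convex hull S. a \<bullet> x = b} = convex hull {x \<in> S. a \<bullet> x = b}"
proof
  define F where "F = convex hull {x \<in> S. a \<bullet> x = b}"
  have "F \<subseteq> {x. a \<bullet> x = b}"
    unfolding F_def by (rule hull_minimal) (auto simp: convex_hyperplane)
  then have F_eq: "a \<bullet> x = b" if "x \<in> F" for x using that by auto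
  have "convex F" unfolding F_def by (rule convex_convex_hull)
  have mixed: "u *\<^sub>R x + w *\<^sub>R y \<in> {x. b < a \<bullet> x} \<union> F"
    if "b < a \<bullet> x" "b \<le> a \<bullet> y" "y \<in> {x. b < a \<bullet> x} \<union> F" "0 \<le> u" "0 \<le> w" "u + w = 1"
    for x y u w
  proof (cases "u = 0")
    case True
    then show ?thesis using that by simp
  next
    case False
    have "u * b < u * (a \<bullet> x)" "w * b \<le> w * (a \<bullet> y)"
      using that False by (simp_all add: mult_left_mono)
    then have "(u + w) * b < a \<bullet> (u *\<^sub>R x + w *\<^sub>R y)"
      by (simp add: inner_add_right distrib_right)
    then show ?thesis using that by simp
  qed
  have "convex ({x. b < a \<bullet> x} \<union> F)"
  proof (rule convexI)
    fix x y :: 'a and u w :: real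
    assume x: "x \<in> {x. b < a \<bullet> x} \<union> F" and y: "y \<in> {x. b < a \<bullet> x} \<union> F"
      and u: "0 \<le> u" "0 \<le> w" "u + w = 1"
    consider "b < a \<bullet> x" | "b < a \<bullet> y" | "x \<in> F" "y \<in> F" using x y by auto
    then show "u *\<^sub>R x + w *\<^sub>R y \<in> {x. b < a \<bullet> x} \<union> F"
    proof cases
      case 1
      then show ?thesis using mixed[of x y u w] y u F_eq by fastforce
    next
      case 2
      then show ?thesis using mixed[of y x w u] x u F_eq by (fastforce simp: add.commute)
    next
      case 3
      then show ?thesis using \<open>convex F\<close> u by (auto simp: convex_def)
    qed
  qed
  moreover have "S \<subseteq> {x. b < a \<bullet> x} \<union> F"
    using assms hull_inc[of _ "{x \<in> S. a \<bullet> x = b}" convex] unfolding F_def by force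
  ultimately have "convex hull S \<subseteq> {x. b < a \<bullet> x} \<union> F"
    by (simp add: hull_minimal)
  then show "{x \<in> convex hull S. a \<bullet> x = b} \<subseteq> convex hull {x \<in> S. a \<bullet> x = b}"
    unfolding F_def by auto
  show "convex hull {x \<in> S. a \<bullet> x = b} \<subseteq> {x \<in> convex hull S. a \<bullet> x = b}"
    using F_eq hull_mono[of "{x \<in> S. a \<bullet> x = b}" S convex] unfolding F_def by auto
qed

lemma convex_hull_face_of:
  fixes S :: "'a::euclidean_space set"
  assumes "\<And>x. x \<in> S \<Longrightarrow> a \<bullet> x \<le> b"
  shows "convex hull {x \<in> S. a \<bullet> x = b} face_of convex hull S"
proof -
  have "convex hull S \<subseteq> {x. a \<bullet> x \<le> b}"
    by (rule hull_minimal) (auto simp: assms convex_halfspace_le)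
  then have "convex hull S \<inter> {x. a \<bullet> x = b} face_of convex hull S"
    by (intro face_of_Int_supporting_hyperplane_le) auto
  moreover have "convex hull S \<inter> {x. a \<bullet> x = b} = convex hull {x \<in> S. a \<bullet> x = b}"
    using convex_hull_supporting_hyperplane[of S "-b" "-a"] assms by auto
  ultimately show ?thesis by simp
qed

text \<open>The inner normal \<open>(a, 1)\<close> of a lower face is the affine function sought:
  its product with \<open>(e, \<mu> e)\<close> is \<open>\<mu> e + a \<bullet> e\<close>. Outside
  the support the shifted value is \<open>\<infinity>\<close>, hence nonnegative and nonzero, so the
  conditions may range over all of \<open>E\<close>.\<close>

lemma regular_subdivision_cell:
  assumes \<mu>: "\<mu> \<in> heights E" and C: "C \<in> regular_subdivision E \<mu>"
  obtains a b where "\<And>e. e \<in> E \<Longrightarrow> 0 \<le> \<mu> e + ereal (a \<bullet> e + b)"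
    and "C = convex hull {e \<in> E. \<mu> e + ereal (a \<bullet> e + b) = 0}"
proof -
  define h where "h e = (e, real_of_ereal (\<mu> e))" for e
  define Q where "Q = convex hull (h ` supp E \<mu>)"
  have finite_val: "\<exists>x. \<mu> e = ereal x" if "e \<in> supp E \<mu>" for e
    using that \<mu> by (cases "\<mu> e") (auto simp: supp_def heights_def)
  obtain G where "G \<in> lower_faces Q" and CG: "C = fst ` G"
    using C unfolding regular_subdivision_def lifted_polytope_def Q_def h_def by blast
  then obtain a b where le: "\<And>z. z \<in> Q \<Longrightarrow> b \<le> (a, 1) \<bullet> z" and G: "G = {z\<in>Q. (a, 1) \<bullet> z = b}"
    unfolding lower_faces_def by blast
  have le_h: "b \<le> (a, 1) \<bullet> h e" if "e \<in> supp E \<mu>" for e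
    using le that hull_inc[of "h e" "h ` supp E \<mu>" convex] unfolding Q_def by blast
  have val: "\<mu> e + ereal (a \<bullet> e + - b) = ereal ((a, 1) \<bullet> h e - b)" if "e \<in> supp E \<mu>" for e
    using finite_val[OF that] by (auto simp: h_def inner_Pair)
  have off: "\<mu> e + ereal (a \<bullet> e + - b) = \<infinity>" if "e \<in> E" "e \<notin> supp E \<mu>" for e
    using that by (auto simp: supp_def)
  show thesis
  proof
    show "0 \<le> \<mu> e + ereal (a \<bullet> e + - b)" if "e \<in> E" for e
      using val[of e] off[OF that] le_h[of e] by (cases "e \<in> supp E \<mu>") auto
    have "G = convex hull {z \<in> h ` supp E \<mu>. (a, 1) \<bullet> z = b}"
      unfolding G Q_def by (rule convex_hull_supporting_hyperplane) (use le_h in auto)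
    then have "C = convex hull (fst ` {z \<in> h ` supp E \<mu>. (a, 1) \<bullet> z = b})"
      unfolding CG by (simp add: convex_hull_linear_image linear_fst)
    also have "fst ` {z \<in> h ` supp E \<mu>. (a, 1) \<bullet> z = b} = {e \<in> supp E \<mu>. (a, 1) \<bullet> h e = b}"
      by (force simp: h_def)
    also have "\<dots> = {e \<in> E. \<mu> e + ereal (a \<bullet> e + - b) = 0}"
    proof (rule set_eqI)
      fix e
      show "e \<in> {e \<in> supp E \<mu>. (a, 1) \<bullet> h e = b} \<longleftrightarrow>
        e \<in> {e \<in> E. \<mu> e + ereal (a \<bullet> e + - b) = 0}"
      proof (cases "e \<in> supp E \<mu>")
        case True
        then have "e \<in> E" by (simp add: supp_def)
        then show ?thesis using True val[OF True] by (simp add: zero_ereal_def)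
      next
        case False
        then show ?thesis using off[of e] by auto
      qed
    qed
    finally show "C = convex hull {e \<in> E. \<mu> e + ereal (a \<bullet> e + - b) = 0}" .
  qed
qed

section \<open>Weyl groups\<close>

lemma linear_reflection: "linear (reflection \<alpha>)"
  unfolding reflection_def
  by (rule linearI) (simp_all add: algebra_simps inner_add_right add_divide_distrib)

lemma reflection_inner: "reflection \<alpha> x \<bullet> reflection \<alpha> y = x \<bullet> y"
proof (cases "\<alpha> = 0")
  case False
  then show ?thesis
    by (simp add: reflection_def inner_diff_left inner_diff_right inner_commute field_simps)
qed (simp add: reflection_def)

lemma reflection_involution: "reflection \<alpha> (reflection \<alpha> x) = x"
proof (cases "\<alpha> = 0")
  case False
  then have "\<alpha> \<bullet> reflection \<alpha> x = - (\<alpha> \<bullet> x)"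
    by (simp add: reflection_def inner_diff_right)
  then show ?thesis by (simp add: reflection_def[of \<alpha> "reflection \<alpha> x"])
     (simp add: reflection_def)
qed (simp add: reflection_def)

lemma reflection_norm2:
  "\<alpha> \<bullet> \<alpha> = 2 \<Longrightarrow> reflection \<alpha> x = x - (\<alpha> \<bullet> x) *\<^sub>R \<alpha>"
  by (simp add: reflection_def)

lemma orthogonal_transformation_weyl:
  "w \<in> weyl_group \<Phi> \<Longrightarrow> orthogonal_transformation w"
proof (induction rule: weyl_group.induct)
  case id
  then show ?case by (simp add: id_def)
next
  case (step w \<alpha>)
  have "orthogonal_transformation (reflection \<alpha>)"
    by (simp add: orthogonal_transformation_def linear_reflection reflection_inner)
  with step show ?case by (intro orthogonal_transformation_compose)
qed

lemma reflection_in_weyl: "\<alpha> \<in> \<Phi> \<Longrightarrow> reflection \<alpha> \<in> weyl_group \<Phi>"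
  using weyl_group.step[OF weyl_group.id] by simp

lemma weyl_group_comp:
  "w \<in> weyl_group \<Phi> \<Longrightarrow> w' \<in> weyl_group \<Phi> \<Longrightarrow> w \<circ> w' \<in> weyl_group \<Phi>"
  by (induction rule: weyl_group.induct) (auto simp: comp_assoc intro: weyl_group.step)

text \<open>The inductive definition only multiplies generators; inverses exist because reflections
  are involutions.\<close>

lemma weyl_group_inv:
  "w \<in> weyl_group \<Phi> \<Longrightarrow> \<exists>w'\<in>weyl_group \<Phi>. (\<forall>x. w' (w x) = x) \<and> (\<forall>x. w (w' x) = x)"
proof (induction rule: weyl_group.induct)
  case id
  then show ?case by (intro bexI[OF _ weyl_group.id]) simp
next
  case (step w \<alpha>)
  then obtain w' where w': "w' \<in> weyl_group \<Phi>" "\<forall>x. w' (w x) = x" "\<forall>x. w (w' x) = x"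
    by blast
  have "w' \<circ> reflection \<alpha> \<in> weyl_group \<Phi>"
    using w' step reflection_in_weyl weyl_group_comp by blast
  with w' show ?case
    by (intro bexI[of _ "w' \<circ> reflection \<alpha>"]) (simp_all add: reflection_involution)
qed

lemma weyl_orbit_self: "v \<in> weyl_orbit \<Phi> v"
  unfolding weyl_orbit_def by (rule image_eqI[OF _ weyl_group.id]) simp

lemma weyl_orbit_closed:
  assumes "x \<in> weyl_orbit \<Phi> v" and w: "w \<in> weyl_group \<Phi>"
  shows "w x \<in> weyl_orbit \<Phi> v"
proof -
  obtain w' where "w' \<in> weyl_group \<Phi>" "x = w' v" using assms by (auto simp: weyl_orbit_def)
  then show ?thesis
    unfolding weyl_orbit_def using weyl_group_comp[OF w] by (intro image_eqI[of _ _ "w \<circ> w'"]) auto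
qed

lemma weyl_orbit_reflection:
  "x \<in> weyl_orbit \<Phi> v \<Longrightarrow> \<alpha> \<in> \<Phi> \<Longrightarrow> reflection \<alpha> x \<in> weyl_orbit \<Phi> v"
  by (simp add: weyl_orbit_closed reflection_in_weyl)

lemma weyl_orbit_transitive:
  assumes "x \<in> weyl_orbit \<Phi> v"
  obtains w where "w \<in> weyl_group \<Phi>" "w x = v"
proof -
  obtain w where w: "w \<in> weyl_group \<Phi>" "x = w v" using assms by (auto simp: weyl_orbit_def)
  obtain w' where "w' \<in> weyl_group \<Phi>" "\<forall>x. w' (w x) = x"
    using weyl_group_inv[OF w(1)] by blast
  then show thesis using that w(2) by simp
qed

lemma weyl_orbit_norm: "x \<in> weyl_orbit \<Phi> v \<Longrightarrow> x \<bullet> x = v \<bullet> v"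
  using orthogonal_transformation_weyl
  by (metis orthogonal_transformation_def weyl_orbit_transitive)

lemma weyl_orbit_subset: "x \<in> weyl_orbit \<Phi> v \<Longrightarrow> weyl_orbit \<Phi> x \<subseteq> weyl_orbit \<Phi> v"
  unfolding weyl_orbit_def[of \<Phi> x] by (rule image_subsetI) (rule weyl_orbit_closed)

lemma weyl_orbit_eq:
  assumes "x \<in> weyl_orbit \<Phi> v"
  shows "weyl_orbit \<Phi> x = weyl_orbit \<Phi> v"
proof
  show "weyl_orbit \<Phi> x \<subseteq> weyl_orbit \<Phi> v" using assms by (rule weyl_orbit_subset)
  obtain w where "w \<in> weyl_group \<Phi>" "w x = v" using weyl_orbit_transitive[OF assms] .
  then have "v \<in> weyl_orbit \<Phi> x" unfolding weyl_orbit_def by (metis imageI)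
  then show "weyl_orbit \<Phi> v \<subseteq> weyl_orbit \<Phi> x" by (rule weyl_orbit_subset)
qed

text \<open>Induction along words in the reflections. It yields the explicit vertices of the
  classical types and the lattice coset of the types E.\<close>

lemma weyl_orbit_induct [consumes 1, case_names base step]:
  assumes "x \<in> weyl_orbit \<Phi> v" and "P v"
    and "\<And>x \<alpha>. P x \<Longrightarrow> \<alpha> \<in> \<Phi> \<Longrightarrow> P (reflection \<alpha> x)"
  shows "P x"
proof -
  have "P (w v)" if "w \<in> weyl_group \<Phi>" for w
    using that by (induction rule: weyl_group.induct) (auto intro: assms)
  then show ?thesis using assms(1) by (auto simp: weyl_orbit_def)
qed

section \<open>Reduction to pairs of vertices\<close>

text \<open>The multiset difference removes a single copy of the pair: a second copy of the same
  monomial counts as another term and must itself come from a separating reflection.\<close>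

definition exchangeable ::
  "'a::euclidean_space set \<Rightarrow> 'a trop_poly set \<Rightarrow> 'a \<Rightarrow> 'a \<Rightarrow> bool" where
  "exchangeable \<Phi> \<F> A B \<longleftrightarrow>
     (\<exists>\<alpha>\<in>\<Phi>. reflection \<alpha> A = B) \<or>
     (\<exists>f\<in>\<F>. {#A, B#} \<in># f \<and> (\<forall>m\<in>#f - {#{#A, B#}#}.
        \<exists>\<alpha>\<in>\<Phi>. (\<alpha> \<bullet> A) * (\<alpha> \<bullet> B) < 0 \<and> m = {#reflection \<alpha> A, reflection \<alpha> B#}))"

lemma reflection_separates:
  assumes "reflection \<alpha> A = B" "A \<noteq> B"
  shows "(\<alpha> \<bullet> A) * (\<alpha> \<bullet> B) < 0"
proof -
  have "\<alpha> \<noteq> 0" "\<alpha> \<bullet> A \<noteq> 0" using assms by (auto simp: reflection_def)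
  moreover have "\<alpha> \<bullet> B = - (\<alpha> \<bullet> A)"
    using \<open>\<alpha> \<noteq> 0\<close> by (simp add: assms(1)[symmetric] reflection_def inner_diff_right)
  ultimately show ?thesis by (simp add: power2_eq_square[symmetric])
qed

lemma strong_coxeter_matroid_zero_set:
  fixes v :: "'a::euclidean_space"
  assumes ex: "\<And>A B. A \<in> weyl_orbit \<Phi> v \<Longrightarrow> B \<in> weyl_orbit \<Phi> v \<Longrightarrow> A \<noteq> B \<Longrightarrow>
      exchangeable \<Phi> \<F> A B"
    and \<mu>: "\<mu> \<in> trop_variety (weyl_orbit \<Phi> v) \<F>"
    and nonneg: "\<And>e. e \<in> weyl_orbit \<Phi> v \<Longrightarrow> 0 \<le> \<mu> e"
  shows "strong_coxeter_matroid \<Phi> v {e \<in> weyl_orbit \<Phi> v. \<mu> e = 0}"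
proof -
  let ?O = "weyl_orbit \<Phi> v"
  let ?M = "{e \<in> ?O. \<mu> e = 0}"
  have "\<exists>\<alpha>\<in>\<Phi>. (\<alpha> \<bullet> A) * (\<alpha> \<bullet> B) < 0 \<and> reflection \<alpha> A \<in> ?M \<and> reflection \<alpha> B \<in> ?M"
    if A: "A \<in> ?M" and B: "B \<in> ?M" and "A \<noteq> B" for A B
  proof -
    consider (swap) \<alpha> where "\<alpha> \<in> \<Phi>" "reflection \<alpha> A = B"
      | (eq) f where "f \<in> \<F>" "{#A, B#} \<in># f" "\<And>m. m \<in># f - {#{#A, B#}#} \<Longrightarrow>
          \<exists>\<alpha>\<in>\<Phi>. (\<alpha> \<bullet> A) * (\<alpha> \<bullet> B) < 0 \<and> m = {#reflection \<alpha> A, reflection \<alpha> B#}"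
    proof (cases "\<exists>\<alpha>\<in>\<Phi>. reflection \<alpha> A = B")
      case True
      then show ?thesis using swap by blast
    next
      case False
      have "exchangeable \<Phi> \<F> A B" using ex A B \<open>A \<noteq> B\<close> by simp
      with False show ?thesis using eq unfolding exchangeable_def by meson
    qed
    then show ?thesis
    proof cases
      case swap
      then have "reflection \<alpha> B = A" using reflection_involution[of \<alpha> A] by simp
      with swap show ?thesis
        using A B reflection_separates[OF swap(2) \<open>A \<noteq> B\<close>] by (intro bexI[of _ \<alpha>] conjI) simp_all
    next
      case eq
      have val_AB: "monomial_val \<mu> {#A, B#} = 0"
        using A B by (simp add: monomial_val_pair)
      have f_split: "f = add_mset {#A, B#} (f - {#{#A, B#}#})" using eq(2) by simp
      \<comment> \<open>\<open>\<mu>\<close> is known to be nonnegative on the orbit only. The other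
        monomials have their indices there because these are reflection images of \<open>A\<close>
        and \<open>B\<close>.\<close>
      have "0 \<le> monomial_val \<mu> m" if m: "m \<in># f" for m
      proof (cases "m = {#A, B#}")
        case False
        then have "m \<in># f - {#{#A, B#}#}" using m by (simp add: in_diff_count)
        then obtain \<alpha> where "\<alpha> \<in> \<Phi>" "m = {#reflection \<alpha> A, reflection \<alpha> B#}"
          using eq(3) by blast
        then show ?thesis
          using A B by (simp add: monomial_val_pair nonneg weyl_orbit_reflection)
      qed (simp add: val_AB)
      then have val_f: "trop_val \<mu> f = 0"
        unfolding trop_val_def using val_AB eq(2)
        by (intro antisym INF_greatest) (metis INF_lower, blast)
      have "trop_vanishes \<mu> f" using \<mu> eq(1) by (auto simp: trop_variety_def)
      then have "size (filter_mset (\<lambda>m. monomial_val \<mu> m = 0) f) \<ge> 2"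
        by (simp add: trop_vanishes_def val_f)
      \<comment> \<open>Only one occurrence is split off, since the second minimal term may be the
        same monomial.\<close>
      moreover have "filter_mset (\<lambda>m. monomial_val \<mu> m = 0) f =
        add_mset {#A, B#} (filter_mset (\<lambda>m. monomial_val \<mu> m = 0) (f - {#{#A, B#}#}))"
        by (subst f_split) (simp add: val_AB)
      ultimately have "filter_mset (\<lambda>m. monomial_val \<mu> m = 0) (f - {#{#A, B#}#}) \<noteq> {#}"
        by (metis One_nat_def Suc_1 not_less_eq_eq order_refl size_add_mset size_empty)
      then obtain m where m: "m \<in># f - {#{#A, B#}#}" "monomial_val \<mu> m = 0"
        by (metis (mono_tags, lifting) multiset_nonemptyE mem_Collect_eq set_mset_filter)
      from eq(3)[OF m(1)] obtain \<alpha> where \<alpha>: "\<alpha> \<in> \<Phi>" "(\<alpha> \<bullet> A) * (\<alpha> \<bullet> B) < 0"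
        "m = {#reflection \<alpha> A, reflection \<alpha> B#}" by blast
      have O: "reflection \<alpha> A \<in> ?O" "reflection \<alpha> B \<in> ?O"
        using A B \<alpha>(1) weyl_orbit_reflection by auto
      have "\<mu> (reflection \<alpha> A) + \<mu> (reflection \<alpha> B) = 0"
        using m(2) by (simp add: \<alpha>(3) monomial_val_pair)
      then have "\<mu> (reflection \<alpha> A) = 0 \<and> \<mu> (reflection \<alpha> B) = 0"
        using nonneg[OF O(1)] nonneg[OF O(2)]
        by (cases "\<mu> (reflection \<alpha> A)"; cases "\<mu> (reflection \<alpha> B)") (auto simp: zero_ereal_def)
      then show ?thesis using \<alpha> O by blast
    qed
  qed
  then show ?thesis unfolding strong_coxeter_matroid_def by blast
qed

text \<open>Affine invariance is both the first claim and a tool for the second: it keeps the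
  shifted height function of a cell inside the variety.\<close>

theorem strong_exchange_criterion:
  fixes v :: "'a::euclidean_space"
  assumes bal: "\<And>f. f \<in> \<F> \<Longrightarrow> balanced f"
    and ex: "\<And>A B. A \<in> weyl_orbit \<Phi> v \<Longrightarrow> B \<in> weyl_orbit \<Phi> v \<Longrightarrow> A \<noteq> B \<Longrightarrow>
      exchangeable \<Phi> \<F> A B"
  shows "affinely_invariant (weyl_orbit \<Phi> v) \<F> \<and>
    (\<forall>\<mu> \<in> trop_variety (weyl_orbit \<Phi> v) \<F>. strong_matroidal_subdivision \<Phi> v \<mu>)"
proof -
  let ?O = "weyl_orbit \<Phi> v"
  have inv: "affinely_invariant ?O \<F>" using bal by (rule affinely_invariant_if_balanced)
  have "\<exists>M. strong_coxeter_matroid \<Phi> v M \<and> C = convex hull M"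
    if \<mu>: "\<mu> \<in> trop_variety ?O \<F>" and C: "C \<in> regular_subdivision ?O \<mu>" for \<mu> C
  proof -
    have h: "\<mu> \<in> heights ?O" using \<mu> by (simp add: trop_variety_def)
    obtain a b where ab: "\<And>e. e \<in> ?O \<Longrightarrow> 0 \<le> \<mu> e + ereal (a \<bullet> e + b)"
      "C = convex hull {e \<in> ?O. \<mu> e + ereal (a \<bullet> e + b) = 0}"
      using regular_subdivision_cell[OF h C] by blast
    have "linear ((\<bullet>) a)" by (simp add: bounded_linear.linear bounded_linear_inner_right)
    then have "(\<lambda>e. \<mu> e + ereal (a \<bullet> e + b)) \<in> trop_variety ?O \<F>"
      using inv h \<mu> unfolding affinely_invariant_def by blast
    from strong_coxeter_matroid_zero_set[OF ex this ab(1)] ab(2) show ?thesis by blast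
  qed
  with inv show ?thesis by (auto simp: strong_matroidal_subdivision_def)
qed

section \<open>Classical types\<close>

lemma e_vec_nth: "e_vec A $ k = (if k \<in> A then 1 else 0)"
  by (simp add: e_vec_def axis_def if_distrib[where f = "\<lambda>x. x $ k"] sum.delta')

lemma spin_vec_nth: "spin_vec A $ k = (if k \<in> A then 1/2 else - 1/2)"
  by (simp add: spin_vec_def e_vec_nth)

lemma unit_vec_nth: "unit_vec i $ k = (if k = i then 1 else 0)"
  by (simp add: axis_def)

lemma inner_unit_vec: "unit_vec i \<bullet> x = x $ i" "x \<bullet> unit_vec i = x $ i"
  by (simp_all add: inner_axis inner_commute)

lemma inner_unit_vec_sum:
  "(s *\<^sub>R unit_vec i + t *\<^sub>R unit_vec j) \<bullet> x = s * x $ i + t * x $ j"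
  by (simp add: inner_add_left inner_unit_vec)

lemma unit_vec_sum_norm2:
  assumes "i \<noteq> j" "s \<in> {1, -1}" "t \<in> {1, -1}"
  shows "(s *\<^sub>R unit_vec i + t *\<^sub>R unit_vec j) \<bullet> (s *\<^sub>R unit_vec i + t *\<^sub>R unit_vec j) = 2"
  using assms unfolding inner_unit_vec_sum by (auto simp: unit_vec_nth)

lemma roots_D_I:
  "i \<noteq> j \<Longrightarrow> s \<in> {1, -1} \<Longrightarrow> t \<in> {1, -1} \<Longrightarrow> s *\<^sub>R unit_vec i + t *\<^sub>R unit_vec j \<in> roots_D"
  unfolding roots_D_def by blast

lemma roots_D_E:
  assumes "\<alpha> \<in> roots_D"
  obtains i j s t where "i \<noteq> j" "s \<in> {1, -1}" "t \<in> {1, -1}"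
    "\<alpha> = s *\<^sub>R unit_vec i + t *\<^sub>R unit_vec j"
  using assms unfolding roots_D_def by blast

lemma reflection_roots_D:
  assumes "i \<noteq> j" "s \<in> {1, -1}" "t \<in> {1, -1}"
  shows "reflection (s *\<^sub>R unit_vec i + t *\<^sub>R unit_vec j) x =
    x - (s * x $ i + t * x $ j) *\<^sub>R (s *\<^sub>R unit_vec i + t *\<^sub>R unit_vec j)"
  by (simp only: reflection_norm2[OF unit_vec_sum_norm2[OF assms]] inner_unit_vec_sum)

lemma reflection_unit_vec:
  assumes "c \<noteq> 0"
  shows "reflection (c *\<^sub>R unit_vec i) x = x - (2 * x $ i) *\<^sub>R unit_vec i"
  using assms by (simp add: reflection_def inner_unit_vec)

subsection \<open>Type A\<close>

lemma reflection_unit_vec_diff: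
  "i \<noteq> j \<Longrightarrow> reflection (unit_vec i - unit_vec j) x =
    x - (x $ i - x $ j) *\<^sub>R (unit_vec i - unit_vec j)"
  using reflection_roots_D[of i j 1 "-1" x] by simp

text \<open>Opposite roots define the same reflection. Both signs are stated because, in an
  exchange, the root that moves an element out of one set moves it into the other.\<close>

lemma reflection_e_vec:
  assumes "i \<in> A" "j \<notin> A"
  shows "reflection (unit_vec i - unit_vec j) (e_vec A) = e_vec (insert j (A - {i}))"
    and "reflection (unit_vec j - unit_vec i) (e_vec A) = e_vec (insert j (A - {i}))"
proof -
  have "i \<noteq> j" "j \<noteq> i" using assms by auto
  then show "reflection (unit_vec i - unit_vec j) (e_vec A) = e_vec (insert j (A - {i}))"
    and "reflection (unit_vec j - unit_vec i) (e_vec A) = e_vec (insert j (A - {i}))"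
    unfolding reflection_unit_vec_diff[OF \<open>i \<noteq> j\<close>] reflection_unit_vec_diff[OF \<open>j \<noteq> i\<close>]
    using assms by (auto simp: vec_eq_iff e_vec_nth unit_vec_nth)
qed

lemma reflection_e_vec_fixed:
  assumes "i \<noteq> j" "i \<in> A \<longleftrightarrow> j \<in> A"
  shows "reflection (unit_vec i - unit_vec j) (e_vec A) = e_vec A"
  unfolding reflection_unit_vec_diff[OF assms(1)] using assms(2) by (simp add: e_vec_nth)

lemma orbit_A:
  assumes "x \<in> weyl_orbit roots_A (e_vec (K :: 'n::finite set))"
  obtains A where "x = e_vec A" "card A = card K"
proof -
  have "\<exists>A. x = e_vec A \<and> card A = card K"
    using assms
  proof (induction rule: weyl_orbit_induct)
    case base
    then show ?case by blast
  next
    case (step x \<alpha>)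
    then obtain A where A: "x = e_vec A" "card A = card K" by blast
    obtain i j where ij: "i \<noteq> j" "\<alpha> = unit_vec i - unit_vec j"
      using step.hyps step.prems by (auto simp: roots_A_def)
    have exch: "card (insert b (A - {a})) = card K" if "a \<in> A" "b \<notin> A" for a b
      using that A(2) card_Suc_Diff1[of A a] by simp
    consider "i \<in> A" "j \<notin> A" | "j \<in> A" "i \<notin> A" | "i \<in> A \<longleftrightarrow> j \<in> A" by blast
    then show ?case
    proof cases
      case 1
      then show ?thesis using exch[OF 1] reflection_e_vec(1)[OF 1] A(1) ij(2) by blast
    next
      case 2
      then show ?thesis using exch[OF 2] reflection_e_vec(2)[OF 2] A(1) ij(2) by blast
    next
      case 3
      then show ?thesis using A reflection_e_vec_fixed[OF ij(1) 3] ij(2) by auto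
    qed
  qed
  then show thesis using that by blast
qed

lemma balanced_eqs_A:
  assumes "f \<in> eqs_A k"
  shows "balanced f"
proof -
  obtain S T where f: "f = image_mset (\<lambda>j. {#e_vec (insert j S), e_vec (T - {j})#}) (mset_set (T - S))"
    using assms unfolding eqs_A_def by blast
  show ?thesis
    unfolding balanced_def
  proof (rule exI[of _ "e_vec S + e_vec T"], rule ballI)
    fix m assume "m \<in># f"
    with f obtain j where j: "j \<in> T" "j \<notin> S" "m = {#e_vec (insert j S), e_vec (T - {j})#}"
      by auto
    have "e_vec (insert j S) + e_vec (T - {j}) = e_vec S + e_vec T"
      using j by (auto simp: vec_eq_iff e_vec_nth)
    with j(3) show "\<exists>A B. m = {#A, B#} \<and> A + B = e_vec S + e_vec T" by blast
  qed
qed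

text \<open>The relation is the one with \<open>S = K - {j}\<close> and
  \<open>T = insert j L\<close> for some \<open>j\<close> in \<open>K - L\<close>: its
  \<open>j\<close>-term is the pair itself, and its \<open>i\<close>-term arises from the pair by
  the reflection exchanging \<open>i\<close> and \<open>j\<close>. If \<open>K\<close> and
  \<open>L\<close> differ by a single exchange, both terms are the same monomial, which the
  reflection still produces.\<close>

lemma exchangeable_A:
  fixes K L :: "'n::finite set"
  assumes "card K = card L" "K \<noteq> L"
  shows "exchangeable roots_A (eqs_A (card K)) (e_vec K) (e_vec L)"
proof -
  have "\<not> K \<subseteq> L" using assms by (metis card_subset_eq finite)
  then obtain j where j: "j \<in> K" "j \<notin> L" by blast
  define t where "t = (\<lambda>i. {#e_vec (insert i (K - {j})), e_vec (insert j L - {i})#})"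
  define f where "f = image_mset t (mset_set (insert j L - (K - {j})))"
  have "card (K - {j}) + 1 = card K" using j card_Suc_Diff1[of K j] by simp
  moreover have "card (insert j L) = card K + 1" using j assms by simp
  ultimately have "f \<in> eqs_A (card K)"
    unfolding f_def t_def eqs_A_def by blast
  moreover have "insert j L - (K - {j}) = insert j (L - K)" using j by blast
  then have f: "f = add_mset (t j) (image_mset t (mset_set (L - K)))"
    unfolding f_def using j by simp
  have tj: "t j = {#e_vec K, e_vec L#}"
    unfolding t_def using j by (simp add: insert_absorb)
  have "\<exists>\<alpha>\<in>roots_A. (\<alpha> \<bullet> e_vec K) * (\<alpha> \<bullet> e_vec L) < 0 \<and>
      m = {#reflection \<alpha> (e_vec K), reflection \<alpha> (e_vec L)#}"
    if m: "m \<in># f - {#{#e_vec K, e_vec L#}#}" for m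
  proof -
    obtain i where i: "i \<in> L" "i \<notin> K" "m = t i" using m by (auto simp: f tj)
    have "unit_vec j - unit_vec i \<in> roots_A" using i j by (auto simp: roots_A_def)
    moreover have "(unit_vec j - unit_vec i) \<bullet> e_vec K * ((unit_vec j - unit_vec i) \<bullet> e_vec L) < 0"
      using i j by (simp add: inner_diff_left inner_unit_vec e_vec_nth)
    moreover have "insert j L - {i} = insert j (L - {i})" using i j by blast
    then have "m = {#reflection (unit_vec j - unit_vec i) (e_vec K),
        reflection (unit_vec j - unit_vec i) (e_vec L)#}"
      unfolding i(3) t_def
      by (simp only: reflection_e_vec(1)[OF j(1) i(2)] reflection_e_vec(2)[OF i(1) j(2)])
    ultimately show ?thesis by blast
  qed
  moreover have "{#e_vec K, e_vec L#} \<in># f" by (simp add: f tj)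
  ultimately show ?thesis unfolding exchangeable_def by blast
qed

subsection \<open>Spin representations\<close>

lemma even_card_sym_diff:
  fixes A B :: "'n::finite set"
  shows "even (card (sym_diff A B)) \<longleftrightarrow> (even (card A) \<longleftrightarrow> even (card B))"
proof -
  have "card A = card (A - B) + card (A \<inter> B)" "card B = card (B - A) + card (A \<inter> B)"
    using card_Int_Diff[of A B] card_Int_Diff[of B A] by (simp_all add: Int_commute)
  moreover have "card (sym_diff A B) = card (A - B) + card (B - A)"
    by (intro card_Un_disjoint) auto
  ultimately show ?thesis by auto
qed

lemma reflection_unit_vec_spin_vec:
  "reflection (unit_vec i) (spin_vec A) = spin_vec (sym_diff A {i})"
  using reflection_unit_vec[of 1 i "spin_vec A", unfolded scaleR_one]
  by (auto simp: vec_eq_iff spin_vec_nth unit_vec_nth)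

text \<open>All coordinates are 1/2 or - 1/2, so the root has product 1, - 1 or 0 with a spin
  vector. In the nonzero case subtracting that multiple of the root flips both signs.\<close>

lemma reflection_roots_D_spin_vec:
  assumes "i \<noteq> j" "s \<in> {1, -1}" "t \<in> {1, -1}"
  shows "reflection (s *\<^sub>R unit_vec i + t *\<^sub>R unit_vec j) (spin_vec A) =
    spin_vec (if s * spin_vec A $ i = t * spin_vec A $ j then sym_diff A {i, j} else A)"
  unfolding reflection_roots_D[OF assms] using assms
  by (auto simp: vec_eq_iff spin_vec_nth unit_vec_nth)

lemma orbit_B_spin:
  assumes "x \<in> weyl_orbit roots_B (spin_vec K)"
  obtains A where "x = spin_vec A"
proof -
  have "\<exists>A. x = spin_vec A"
    using assms
  proof (induction rule: weyl_orbit_induct)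
    case base
    then show ?case by blast
  next
    case (step x \<alpha>)
    then obtain A where A: "x = spin_vec A" by blast
    consider "\<alpha> \<in> roots_D" | i s where "\<alpha> = s *\<^sub>R unit_vec i" "s \<in> {1, -1}"
      using step.hyps step.prems unfolding roots_B_def by blast
    then show ?case
    proof cases
      case 1
      then show ?thesis unfolding A by (elim roots_D_E) (use reflection_roots_D_spin_vec in blast)
    next
      case 2
      then have "reflection \<alpha> x = reflection (unit_vec i) x"
        using reflection_unit_vec[of s i x] reflection_unit_vec[of 1 i x] by auto
      then show ?thesis unfolding A reflection_unit_vec_spin_vec by blast
    qed
  qed
  then show thesis using that by blast
qed

lemma orbit_D_spin:
  assumes "x \<in> weyl_orbit roots_D (spin_vec (K :: 'n::finite set))"
  obtains A where "x = spin_vec A" "even (card A) \<longleftrightarrow> even (card K)"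
proof -
  have "\<exists>A. x = spin_vec A \<and> (even (card A) \<longleftrightarrow> even (card K))"
    using assms
  proof (induction rule: weyl_orbit_induct)
    case base
    then show ?case by blast
  next
    case (step x \<alpha>)
    then obtain A where A: "x = spin_vec A" "even (card A) \<longleftrightarrow> even (card K)" by blast
    obtain i j s t where \<alpha>: "i \<noteq> j" "s \<in> {1, -1}" "t \<in> {1, -1}"
      "\<alpha> = s *\<^sub>R unit_vec i + t *\<^sub>R unit_vec j"
      using step by (elim roots_D_E)
    have "even (card (sym_diff A {i, j})) \<longleftrightarrow> even (card K)"
      unfolding even_card_sym_diff A(2) using \<alpha>(1) by simp
    then show ?case
      unfolding \<alpha>(4) A(1) reflection_roots_D_spin_vec[OF \<alpha>(1-3)] using A(2) by auto
  qed
  then show thesis using that by blast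
qed

lemma spin_exchange_sum:
  assumes "m \<in># spin_exchange I J"
  shows "\<exists>A B. m = {#A, B#} \<and> A + B = spin_vec I + spin_vec J"
proof -
  from assms obtain i where i: "i \<in> sym_diff I J"
    "m = {#spin_vec (sym_diff I {i}), spin_vec (sym_diff J {i})#}"
    by (auto simp: spin_exchange_def)
  have "spin_vec (sym_diff I {i}) + spin_vec (sym_diff J {i}) = spin_vec I + spin_vec J"
    using i(1) by (auto simp: vec_eq_iff spin_vec_nth)
  with i(2) show ?thesis by blast
qed

lemma balanced_spin_exchange:
  "balanced (spin_exchange I J)" "balanced (add_mset {#spin_vec I, spin_vec J#} (spin_exchange I J))"
proof -
  let ?P = "\<lambda>m. \<exists>A B. m = {#A, B#} \<and> A + B = spin_vec I + spin_vec J"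
  have "\<forall>m\<in>#spin_exchange I J. ?P m" using spin_exchange_sum by blast
  moreover have "?P {#spin_vec I, spin_vec J#}" by blast
  ultimately have "\<forall>m\<in>#spin_exchange I J. ?P m"
    "\<forall>m\<in>#add_mset {#spin_vec I, spin_vec J#} (spin_exchange I J). ?P m" by auto
  then show "balanced (spin_exchange I J)"
    "balanced (add_mset {#spin_vec I, spin_vec J#} (spin_exchange I J))"
    unfolding balanced_def by blast+
qed

lemma spin_separating_root:
  fixes K L :: "'n::finite set"
  assumes "i \<noteq> j" "i \<in> sym_diff K L" "j \<in> sym_diff K L"
  shows "\<exists>\<alpha>\<in>roots_D. (\<alpha> \<bullet> spin_vec K) * (\<alpha> \<bullet> spin_vec L) < 0 \<and>
    reflection \<alpha> (spin_vec K) = spin_vec (sym_diff K {i, j}) \<and>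
    reflection \<alpha> (spin_vec L) = spin_vec (sym_diff L {i, j})"
proof -
  \<comment> \<open>Twice a coordinate is its sign. The root copies the signs of \<open>K\<close> at
    \<open>i\<close> and \<open>j\<close>; \<open>L\<close> has the opposite signs there.\<close>
  let ?s = "2 * spin_vec K $ i" and ?t = "2 * spin_vec K $ j"
  let ?\<alpha> = "?s *\<^sub>R unit_vec i + ?t *\<^sub>R unit_vec j"
  have st: "?s \<in> {1, -1}" "?t \<in> {1, -1}" by (auto simp: spin_vec_nth)
  have L: "spin_vec L $ i = - spin_vec K $ i" "spin_vec L $ j = - spin_vec K $ j"
    using assms by (auto simp: spin_vec_nth)
  have "?\<alpha> \<bullet> spin_vec K = 1" "?\<alpha> \<bullet> spin_vec L = - 1"
    unfolding inner_unit_vec_sum L by (auto simp: spin_vec_nth)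
  moreover have "?s * spin_vec K $ i = ?t * spin_vec K $ j" "?s * spin_vec L $ i = ?t * spin_vec L $ j"
    unfolding L by (auto simp: spin_vec_nth)
  then have "reflection ?\<alpha> (spin_vec K) = spin_vec (sym_diff K {i, j})"
    "reflection ?\<alpha> (spin_vec L) = spin_vec (sym_diff L {i, j})"
    unfolding reflection_roots_D_spin_vec[OF assms(1) st] by simp_all
  ultimately show ?thesis using roots_D_I[OF assms(1) st] by (intro bexI[of _ ?\<alpha>]) simp_all
qed

lemma exchangeable_spin_adjacent:
  fixes K L :: "'n::finite set"
  assumes "roots_D \<subseteq> \<Phi>" "card (sym_diff K L) = 2"
  shows "exchangeable \<Phi> \<F> (spin_vec K) (spin_vec L)"
proof -
  obtain i j where ij: "sym_diff K L = {i, j}" "i \<noteq> j" using assms(2) by (auto simp: card_2_iff)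
  then have "sym_diff K {i, j} = L" by blast
  then show ?thesis
    using spin_separating_root[of i j K L] ij assms(1) unfolding exchangeable_def by auto
qed

text \<open>Toggling \<open>j\<close> in both sets keeps their symmetric difference. In the exchange
  polynomial of the toggled sets, the \<open>j\<close>-term toggles back to the given pair, and the
  \<open>i\<close>-term differs from it by toggling \<open>i\<close> and \<open>j\<close>, which is
  a reflection in a root of type D.\<close>

lemma exchangeable_spin_even:
  fixes K L :: "'n::finite set"
  assumes "roots_D \<subseteq> \<Phi>" "j \<in> sym_diff K L"
    and "spin_exchange (sym_diff K {j}) (sym_diff L {j}) \<in> \<F>"
  shows "exchangeable \<Phi> \<F> (spin_vec K) (spin_vec L)"
proof -
  let ?I = "sym_diff K {j}" and ?J = "sym_diff L {j}" and ?D = "sym_diff K L"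
  define t where "t = (\<lambda>i. {#spin_vec (sym_diff ?I {i}), spin_vec (sym_diff ?J {i})#})"
  have "sym_diff ?I ?J = ?D" by blast
  then have f: "spin_exchange ?I ?J = add_mset (t j) (image_mset t (mset_set (?D - {j})))"
    unfolding spin_exchange_def t_def using mset_set.remove[of ?D j] assms(2) by simp
  have "sym_diff ?I {j} = K" "sym_diff ?J {j} = L" by blast+
  then have tj: "t j = {#spin_vec K, spin_vec L#}" by (simp add: t_def)
  have "\<exists>\<alpha>\<in>\<Phi>. (\<alpha> \<bullet> spin_vec K) * (\<alpha> \<bullet> spin_vec L) < 0 \<and>
      m = {#reflection \<alpha> (spin_vec K), reflection \<alpha> (spin_vec L)#}"
    if m: "m \<in># spin_exchange ?I ?J - {#{#spin_vec K, spin_vec L#}#}" for m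
  proof -
    obtain i where i: "i \<in> ?D" "i \<noteq> j" "m = t i" using m unfolding f tj by auto
    have "sym_diff ?I {i} = sym_diff K {i, j}" "sym_diff ?J {i} = sym_diff L {i, j}"
      using i(2) by blast+
    then have "m = {#spin_vec (sym_diff K {i, j}), spin_vec (sym_diff L {i, j})#}"
      by (simp only: i(3) t_def)
    then show ?thesis
      using spin_separating_root[OF i(2,1) assms(2)] assms(1) by (metis subsetD)
  qed
  moreover have "{#spin_vec K, spin_vec L#} \<in># spin_exchange ?I ?J" by (simp add: f tj)
  ultimately show ?thesis using assms(3) unfolding exchangeable_def by blast
qed

lemma exchangeable_B_spin:
  fixes K L :: "'n::finite set"
  assumes "K \<noteq> L"
  shows "exchangeable roots_B eqs_B_spin (spin_vec K) (spin_vec L)"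
proof -
  let ?D = "sym_diff K L"
  have D: "roots_D \<subseteq> roots_B" by (simp add: roots_B_def)
  have "?D \<noteq> {}" using assms by blast
  then have "card ?D \<noteq> 0" by simp
  then consider "card ?D = 1" | "card ?D = 2" | "card ?D \<ge> 3" "even (card ?D)"
    | "card ?D \<ge> 3" "odd (card ?D)" by linarith
  then show ?thesis
  proof cases
    case 1
    then obtain i where "?D = {i}" by (auto simp: card_1_singleton_iff)
    then have "sym_diff K {i} = L" by blast
    moreover have "unit_vec i \<in> roots_B" unfolding roots_B_def by force
    ultimately show ?thesis
      unfolding exchangeable_def by (metis reflection_unit_vec_spin_vec)
  next
    case 2
    then show ?thesis using exchangeable_spin_adjacent[OF D] by blast
  next
    case 3
    obtain j where j: "j \<in> ?D" using \<open>?D \<noteq> {}\<close> by blast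
    have "sym_diff (sym_diff K {j}) (sym_diff L {j}) = ?D" by blast
    then have "spin_exchange (sym_diff K {j}) (sym_diff L {j}) \<in> eqs_B_spin"
      unfolding eqs_B_spin_def using 3
      by (intro CollectI exI[of _ "sym_diff K {j}"] exI[of _ "sym_diff L {j}"]) simp
    then show ?thesis using exchangeable_spin_even[OF D j] by blast
  next
    case 4
    \<comment> \<open>In the odd case the pair is the extra monomial of its own equation; the other
      terms toggle one index and come from the short roots.\<close>
    let ?f = "add_mset {#spin_vec K, spin_vec L#} (spin_exchange K L)"
    have "?f \<in> eqs_B_spin"
      unfolding eqs_B_spin_def using 4 by (intro CollectI exI[of _ K] exI[of _ L]) simp
    moreover have "\<exists>\<alpha>\<in>roots_B. (\<alpha> \<bullet> spin_vec K) * (\<alpha> \<bullet> spin_vec L) < 0 \<and>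
        m = {#reflection \<alpha> (spin_vec K), reflection \<alpha> (spin_vec L)#}"
      if m: "m \<in># ?f - {#{#spin_vec K, spin_vec L#}#}" for m
    proof -
      obtain i where i: "i \<in> ?D"
        "m = {#spin_vec (sym_diff K {i}), spin_vec (sym_diff L {i})#}"
        using m by (auto simp: spin_exchange_def)
      have "unit_vec i \<bullet> spin_vec K * (unit_vec i \<bullet> spin_vec L) < 0"
        using i(1) by (auto simp: inner_unit_vec spin_vec_nth)
      moreover have "unit_vec i \<in> roots_B" unfolding roots_B_def by force
      ultimately show ?thesis
        unfolding i(2) by (intro bexI[of _ "unit_vec i"]) (simp_all add: reflection_unit_vec_spin_vec)
    qed
    ultimately show ?thesis unfolding exchangeable_def
      by (intro disjI2 bexI[of _ ?f] conjI ballI) auto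
  qed
qed

text \<open>Sets of equal parity differ in an even number of elements, so in 2 or at least 4.
  Toggling one index changes the parity, whence \<open>I\<close> and \<open>J\<close> have the
  parity opposite to the vertices. Stating this relative to \<open>card K\<close> serves both spin
  orbits.\<close>

lemma exchangeable_D_spin:
  fixes K L :: "'n::finite set"
  assumes "K \<noteq> L" "even (card K) \<longleftrightarrow> even (card L)"
    and eqs: "\<And>I J. even (card I) \<longleftrightarrow> odd (card K) \<Longrightarrow> even (card J) \<longleftrightarrow> odd (card K) \<Longrightarrow>
      card (sym_diff I J) \<ge> 4 \<Longrightarrow> spin_exchange I J \<in> \<F>"
  shows "exchangeable roots_D \<F> (spin_vec K) (spin_vec L)"
proof -
  let ?D = "sym_diff K L"
  have "?D \<noteq> {}" using assms by blast
  then have "card ?D \<noteq> 0" by simp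
  moreover have "even (card ?D)" using assms(2) by (simp only: even_card_sym_diff)
  ultimately have "card ?D = 2 \<or> card ?D \<ge> 4" by presburger
  then consider "card ?D = 2" | "card ?D \<ge> 4" by blast
  then show ?thesis
  proof cases
    case 1
    then show ?thesis using exchangeable_spin_adjacent by blast
  next
    case 2
    obtain j where j: "j \<in> ?D" using \<open>?D \<noteq> {}\<close> by blast
    have "sym_diff (sym_diff K {j}) (sym_diff L {j}) = ?D" by blast
    then have "spin_exchange (sym_diff K {j}) (sym_diff L {j}) \<in> \<F>"
      using 2 assms(2) by (intro eqs) (simp_all only: even_card_sym_diff, simp_all)
    then show ?thesis using exchangeable_spin_even[OF order_refl j] by blast
  qed
qed

subsection \<open>Vector representations\<close>

lemma reflection_roots_D_unit_vec:
  assumes "i \<noteq> j" "s \<in> {1, -1}" "t \<in> {1, -1}" "c \<in> {1, -1 :: real}"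
  shows "\<exists>l d. d \<in> {1, -1} \<and>
    reflection (s *\<^sub>R unit_vec i + t *\<^sub>R unit_vec j) (c *\<^sub>R unit_vec k) = d *\<^sub>R unit_vec l"
proof -
  let ?r = "reflection (s *\<^sub>R unit_vec i + t *\<^sub>R unit_vec j) (c *\<^sub>R unit_vec k)"
  consider "k = i" | "k = j" | "k \<noteq> i" "k \<noteq> j" by blast
  then show ?thesis
  proof cases
    case 1
    have "?r = (- s * t * c) *\<^sub>R unit_vec j"
      unfolding reflection_roots_D[OF assms(1-3)] using assms 1
      by (auto simp: vec_eq_iff unit_vec_nth)
    then show ?thesis using assms by (intro exI[of _ j] exI[of _ "- s * t * c"]) auto
  next
    case 2
    have "?r = (- s * t * c) *\<^sub>R unit_vec i"
      unfolding reflection_roots_D[OF assms(1-3)] using assms 2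
      by (auto simp: vec_eq_iff unit_vec_nth)
    then show ?thesis using assms by (intro exI[of _ i] exI[of _ "- s * t * c"]) auto
  next
    case 3
    have "?r = c *\<^sub>R unit_vec k"
      unfolding reflection_roots_D[OF assms(1-3)] using 3 by (simp add: unit_vec_nth)
    then show ?thesis using assms by blast
  qed
qed

lemma reflection_unit_vec_unit_vec:
  assumes "b \<noteq> 0"
  shows "reflection (b *\<^sub>R unit_vec i) (c *\<^sub>R unit_vec k) = (if k = i then - c else c) *\<^sub>R unit_vec k"
  unfolding reflection_unit_vec[OF assms] by (auto simp: vec_eq_iff unit_vec_nth)

lemma orbit_C_vector:
  assumes "x \<in> weyl_orbit roots_C (unit_vec k)"
  obtains i s where "x = s *\<^sub>R unit_vec i" "s \<in> {1, -1}"
proof -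
  have "\<exists>i s. x = s *\<^sub>R unit_vec i \<and> s \<in> {1, -1}"
    using assms
  proof (induction rule: weyl_orbit_induct)
    case base
    show ?case by (intro exI[of _ k] exI[of _ 1]) simp
  next
    case (step x \<alpha>)
    then obtain k c where x: "x = c *\<^sub>R unit_vec k" "c \<in> {1, -1}" by blast
    consider "\<alpha> \<in> roots_D" | i s where "\<alpha> = s *\<^sub>R unit_vec i" "s \<in> {2, -2}"
      using step.hyps step.prems unfolding roots_C_def by blast
    then show ?case
    proof cases
      case 1
      then show ?thesis
        unfolding x(1) by (elim roots_D_E) (use reflection_roots_D_unit_vec x(2) in blast)
    next
      case 2
      then have "s \<noteq> 0" by auto
      have "(if k = i then - c else c) \<in> {1, -1}" using x(2) by auto
      then show ?thesis
        unfolding x(1) 2(1) reflection_unit_vec_unit_vec[OF \<open>s \<noteq> 0\<close>] by blast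
    qed
  qed
  then show thesis using that by blast
qed

lemma weyl_orbit_mono:
  assumes "\<Phi> \<subseteq> \<Psi>"
  shows "weyl_orbit \<Phi> v \<subseteq> weyl_orbit \<Psi> v"
proof
  fix x assume "x \<in> weyl_orbit \<Phi> v"
  then show "x \<in> weyl_orbit \<Psi> v"
    by (induction rule: weyl_orbit_induct) (use assms weyl_orbit_self weyl_orbit_reflection in blast)+
qed

lemma orbit_D_vector:
  assumes "x \<in> weyl_orbit roots_D (unit_vec k)"
  obtains i s where "x = s *\<^sub>R unit_vec i" "s \<in> {1, -1}"
proof -
  have "x \<in> weyl_orbit roots_C (unit_vec k)"
    using assms weyl_orbit_mono[of roots_D roots_C "unit_vec k"] by (auto simp: roots_C_def)
  then show thesis using orbit_C_vector that by blast
qed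

text \<open>The root is the difference \<open>s e_i - t e_j\<close> of the two vertices, and its
  reflection interchanges them.\<close>

lemma vector_separating_root:
  assumes "i \<noteq> j" "s \<in> {1, -1}" "t \<in> {1, -1 :: real}"
  shows "\<exists>\<alpha>\<in>roots_D. \<alpha> \<bullet> (s *\<^sub>R unit_vec i) = 1 \<and>
    reflection \<alpha> (s *\<^sub>R unit_vec i) = t *\<^sub>R unit_vec j"
proof -
  have t: "- t \<in> {1, -1}" using assms(3) by auto
  have "s * s = 1" using assms by auto
  then have "(s *\<^sub>R unit_vec i + (- t) *\<^sub>R unit_vec j) \<bullet> (s *\<^sub>R unit_vec i) = 1"
    using assms(1) unfolding inner_unit_vec_sum by (simp add: unit_vec_nth)
  moreover have "reflection (s *\<^sub>R unit_vec i + (- t) *\<^sub>R unit_vec j) (s *\<^sub>R unit_vec i) =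
    t *\<^sub>R unit_vec j"
    unfolding reflection_roots_D[OF assms(1,2) t] using assms \<open>s * s = 1\<close>
    by (simp add: unit_vec_nth)
  ultimately show ?thesis using roots_D_I[OF assms(1,2) t] by blast
qed

lemma exchangeable_vector_adjacent:
  assumes "roots_D \<subseteq> \<Phi>" "i \<noteq> j" "s \<in> {1, -1}" "t \<in> {1, -1 :: real}"
  shows "exchangeable \<Phi> \<F> (s *\<^sub>R unit_vec i) (t *\<^sub>R unit_vec j)"
  using vector_separating_root[OF assms(2-4)] assms(1) unfolding exchangeable_def by blast

lemma vector_cases:
  assumes "s \<in> {1, -1}" "t \<in> {1, -1 :: real}" "s *\<^sub>R unit_vec i \<noteq> t *\<^sub>R unit_vec j"
  obtains "i \<noteq> j" | "i = j" "t = - s"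
  using assms by (cases "i = j") auto

lemma exchangeable_C_vector:
  assumes "s \<in> {1, -1}" "t \<in> {1, -1 :: real}" "s *\<^sub>R unit_vec i \<noteq> t *\<^sub>R unit_vec j"
  shows "exchangeable roots_C \<F> (s *\<^sub>R unit_vec i) (t *\<^sub>R unit_vec j)"
  using assms
proof (cases rule: vector_cases)
  case 1
  then show ?thesis using assms by (intro exchangeable_vector_adjacent) (auto simp: roots_C_def)
next
  case 2
  \<comment> \<open>The long root at \<open>i\<close> interchanges the two opposite vertices, which
    is why type C has no equations.\<close>
  have "2 *\<^sub>R unit_vec i \<in> roots_C" unfolding roots_C_def by blast
  moreover have "reflection (2 *\<^sub>R unit_vec i) (s *\<^sub>R unit_vec i) = t *\<^sub>R unit_vec j"
    using 2 reflection_unit_vec_unit_vec[of 2 i s i] by simp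
  ultimately show ?thesis unfolding exchangeable_def by blast
qed

lemma balanced_eqs_D_vector: "f \<in> eqs_D_vector \<Longrightarrow> balanced f"
  unfolding eqs_D_vector_def balanced_def by (intro exI[of _ 0]) force

text \<open>No root of type D interchanges opposite vertices. A reflection taking one of them to
  \<open>e_k\<close> takes the other to \<open>- e_k\<close> by linearity, so every other term of
  the equation is a valid exchange.\<close>

lemma exchangeable_D_vector:
  fixes i j :: "'n::finite"
  assumes "s \<in> {1, -1}" "t \<in> {1, -1 :: real}" "s *\<^sub>R unit_vec i \<noteq> t *\<^sub>R unit_vec j"
  shows "exchangeable roots_D eqs_D_vector (s *\<^sub>R unit_vec i) (t *\<^sub>R unit_vec j)"
  using assms
proof (cases rule: vector_cases)
  case 1
  then show ?thesis using assms by (intro exchangeable_vector_adjacent) auto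
next
  case 2
  define m where "m = (\<lambda>i :: 'n. {#unit_vec i, - unit_vec i :: real^'n#})"
  define f where "f = image_mset m (mset_set UNIV)"
  have f: "f = add_mset (m i) (image_mset m (mset_set (UNIV - {i})))"
    unfolding f_def using mset_set.remove[of UNIV i] by simp
  have mi: "{#s *\<^sub>R unit_vec i, t *\<^sub>R unit_vec j#} = m i"
    using assms(1) 2 by (auto simp: m_def add_mset_commute)
  have "\<exists>\<alpha>\<in>roots_D. (\<alpha> \<bullet> s *\<^sub>R unit_vec i) * (\<alpha> \<bullet> t *\<^sub>R unit_vec j) < 0 \<and>
      z = {#reflection \<alpha> (s *\<^sub>R unit_vec i), reflection \<alpha> (t *\<^sub>R unit_vec j)#}"
    if z: "z \<in># f - {#{#s *\<^sub>R unit_vec i, t *\<^sub>R unit_vec j#}#}" for z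
  proof -
    obtain k where k: "k \<noteq> i" "z = m k" using z unfolding mi f by auto
    obtain \<alpha> where \<alpha>: "\<alpha> \<in> roots_D" "\<alpha> \<bullet> (s *\<^sub>R unit_vec i) = 1"
      "reflection \<alpha> (s *\<^sub>R unit_vec i) = unit_vec k"
      using vector_separating_root[of i k s 1] k(1) assms(1) by auto
    have neg: "t *\<^sub>R unit_vec j = - (s *\<^sub>R unit_vec i)" using 2 by simp
    have "reflection \<alpha> (t *\<^sub>R unit_vec j) = - unit_vec k"
      unfolding neg linear_neg[OF linear_reflection] \<alpha>(3) ..
    moreover have "\<alpha> \<bullet> (t *\<^sub>R unit_vec j) = - 1"
      unfolding neg inner_minus_right \<alpha>(2) ..
    ultimately show ?thesis using \<alpha> k(2) by (intro bexI[of _ \<alpha>]) (simp_all only: m_def, simp_all)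
  qed
  moreover have "f \<in> eqs_D_vector" by (simp add: f_def m_def eqs_D_vector_def)
  moreover have "{#s *\<^sub>R unit_vec i, t *\<^sub>R unit_vec j#} \<in># f" unfolding mi f by simp
  ultimately show ?thesis unfolding exchangeable_def by blast
qed

section \<open>Orbits with cross-polytope faces\<close>

text \<open>\<open>\<theta>\<close> represents the sums \<open>x + y\<close> of vertices with
  product \<open>N - 2\<close>; such a sum has product \<open>N + (N - 2) = 2 * N - 2\<close> with
  \<open>x\<close>, which is the level of the face. The face has centre \<open>\<theta> / 2\<close>
  and half-diagonals \<open>U0\<close>. The second part of \<open>opposite\<close> supplies a
  further opposite pair near \<open>x\<close>: it shows that the segment from \<open>x\<close> to
  \<open>- x\<close> is not an edge, and it starts a path of length 3.\<close>

locale minuscule_orbit =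
  fixes \<Phi> :: "'a::euclidean_space set" and v :: 'a and N :: real
    and \<theta> :: 'a and U0 :: "'a set" and d :: nat
  assumes root_norm: "\<And>\<alpha>. \<alpha> \<in> \<Phi> \<Longrightarrow> \<alpha> \<bullet> \<alpha> = 2"
    and v_norm: "v \<bullet> v = N"
    and N_pos: "N > 1"
    and inner_cases: "\<And>x y. x \<in> weyl_orbit \<Phi> v \<Longrightarrow> y \<in> weyl_orbit \<Phi> v \<Longrightarrow>
      x \<bullet> y \<in> {N, N - 1, N - 2, N - 3}"
    and opposite: "\<And>x y. x \<in> weyl_orbit \<Phi> v \<Longrightarrow> y \<in> weyl_orbit \<Phi> v \<Longrightarrow>
      x \<bullet> y = N - 3 \<Longrightarrow> y = - x \<and> (\<exists>z\<in>weyl_orbit \<Phi> v. - z \<in> weyl_orbit \<Phi> v \<and> x \<bullet> z = N - 1)"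
    and diff_root: "\<And>x y. x \<in> weyl_orbit \<Phi> v \<Longrightarrow> y \<in> weyl_orbit \<Phi> v \<Longrightarrow>
      x \<bullet> y = N - 1 \<Longrightarrow> x - y \<in> \<Phi>"
    and sum_conjugate: "\<And>x y. x \<in> weyl_orbit \<Phi> v \<Longrightarrow> y \<in> weyl_orbit \<Phi> v \<Longrightarrow>
      x \<bullet> y = N - 2 \<Longrightarrow> \<exists>w\<in>weyl_group \<Phi>. w (x + y) = \<theta>"
    and facet: "{x \<in> weyl_orbit \<Phi> v. \<theta> \<bullet> x = 2 * N - 2} =
      (\<lambda>u. (1/2) *\<^sub>R \<theta> + u) ` U0 \<union> (\<lambda>u. (1/2) *\<^sub>R \<theta> - u) ` U0"
    and U0_orthogonal: "pairwise orthogonal U0" and U0_nonzero: "0 \<notin> U0"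
    and U0_card: "card U0 = d" and d_ge: "d \<ge> 2"
begin

abbreviation "Orb \<equiv> weyl_orbit \<Phi> v"

lemma norm_Orb: "x \<in> Orb \<Longrightarrow> x \<bullet> x = N"
  using weyl_orbit_norm v_norm by metis

lemma inner_eq_N_iff:
  assumes "x \<in> Orb" "y \<in> Orb"
  shows "x \<bullet> y = N \<longleftrightarrow> x = y"
proof
  assume "x \<bullet> y = N"
  then have "(x - y) \<bullet> (x - y) = 0"
    using norm_Orb[OF assms(1)] norm_Orb[OF assms(2)]
    by (simp add: inner_diff_left inner_diff_right inner_commute)
  then show "x = y" by simp
qed (use norm_Orb[OF assms(1)] in simp)

lemma inner_le:
  "x \<in> Orb \<Longrightarrow> y \<in> Orb \<Longrightarrow> x \<noteq> y \<Longrightarrow> x \<bullet> y \<le> N - 1"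
  using inner_cases[of x y] inner_eq_N_iff[of x y] by auto

text \<open>The orbit lies on a sphere, and distinct points of it have squared distance at least 2.
  Finiteness matters because \<open>mset_set\<close> of an infinite set is empty.\<close>

lemma finite_Orb: "finite Orb"
proof -
  have "dist y x \<ge> 1" if "x \<in> Orb" "y \<in> Orb" "x \<noteq> y" for x y
  proof -
    have "dist y x ^ 2 = 2 * N - 2 * (x \<bullet> y)"
      using norm_Orb[OF that(1)] norm_Orb[OF that(2)]
      by (simp add: dist_norm power2_norm_eq_inner inner_diff_left inner_diff_right inner_commute)
    then have "1 ^ 2 \<le> dist y x ^ 2" using inner_le[OF that] by simp
    then show ?thesis by (rule power2_le_imp_le) simp
  qed
  then have "\<forall>x\<in>Orb. \<forall>y\<in>Orb. dist y x < 1 \<longrightarrow> y = x" by force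
  moreover have "bounded Orb"
    unfolding bounded_iff using norm_Orb by (metis norm_eq_sqrt_inner order_refl)
  moreover have "\<not> x islimpt Orb" for x
    using calculation(1) discrete_imp_not_islimpt[of 1 Orb x] by force
  ultimately show ?thesis using bounded_infinite_imp_islimpt[of Orb Orb] by blast
qed

lemma adjacent_reflection:
  assumes "x \<in> Orb" "y \<in> Orb" "x \<bullet> y = N - 1"
  shows "(x - y) \<bullet> x = 1" "(x - y) \<bullet> y = -1" "reflection (x - y) x = y"
    "reflection (x - y) z = z - ((x - y) \<bullet> z) *\<^sub>R (x - y)"
proof -
  show 1: "(x - y) \<bullet> x = 1" "(x - y) \<bullet> y = -1"
    using norm_Orb[OF assms(1)] norm_Orb[OF assms(2)] assms(3)
    by (simp_all add: inner_diff_left inner_diff_right inner_commute)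
  show 2: "reflection (x - y) z = z - ((x - y) \<bullet> z) *\<^sub>R (x - y)" for z
    by (rule reflection_norm2) (rule root_norm[OF diff_root[OF assms]])
  show "reflection (x - y) x = y" by (simp add: 1 2)
qed

lemma sum_inner_le:
  assumes "x \<in> Orb" "y \<in> Orb" "x \<bullet> y = N - 2" "z \<in> Orb"
  shows "(x + y) \<bullet> z \<le> 2 * N - 2"
proof (cases "z = x \<or> z = y")
  case True
  then show ?thesis
    using norm_Orb[OF assms(1)] norm_Orb[OF assms(2)] assms(3) by (auto simp: inner_add_left inner_add_right inner_commute)
next
  case False
  then have "x \<bullet> z \<le> N - 1" "y \<bullet> z \<le> N - 1" using inner_le assms by auto
  then show ?thesis by (simp add: inner_add_left)
qed

text \<open>A Weyl group element taking \<open>\<theta>\<close> to \<open>x + y\<close> preserves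
  the orbit and inner products, so it carries the face of \<open>\<theta>\<close> described by
  \<open>facet\<close> to the face of \<open>x + y\<close>.\<close>

lemma cross_polytope:
  assumes x: "x \<in> Orb" and y: "y \<in> Orb" and xy: "x \<bullet> y = N - 2"
  obtains U where "{z \<in> Orb. (x + y) \<bullet> z = 2 * N - 2} =
      (\<lambda>u. (1/2) *\<^sub>R (x + y) + u) ` U \<union> (\<lambda>u. (1/2) *\<^sub>R (x + y) - u) ` U"
    and "pairwise orthogonal U" "0 \<notin> U" "card U = d"
proof -
  obtain w0 where w0: "w0 \<in> weyl_group \<Phi>" "w0 (x + y) = \<theta>"
    using sum_conjugate[OF assms] by blast
  obtain w where w: "w \<in> weyl_group \<Phi>" "\<forall>x. w (w0 x) = x" "\<forall>x. w0 (w x) = x"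
    using weyl_group_inv[OF w0(1)] by blast
  have lin: "linear w" and inn: "\<And>a b. w a \<bullet> w b = a \<bullet> b"
    using orthogonal_transformation_weyl[OF w(1)] by (auto simp: orthogonal_transformation_def)
  have w\<theta>: "w \<theta> = x + y" using w(2) w0(2) by metis
  have "inj w" by (metis injI w(3))
  have "{z \<in> Orb. (x + y) \<bullet> z = 2 * N - 2} = w ` {z \<in> Orb. \<theta> \<bullet> z = 2 * N - 2}"
  proof (intro set_eqI iffI)
    fix z assume z: "z \<in> {z \<in> Orb. (x + y) \<bullet> z = 2 * N - 2}"
    then have "w0 z \<in> Orb" using weyl_orbit_closed[OF _ w0(1)] by blast
    moreover have "\<theta> \<bullet> w0 z = 2 * N - 2"
      using z inn[of \<theta> "w0 z"] w(2) by (simp add: w\<theta>)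
    ultimately show "z \<in> w ` {z \<in> Orb. \<theta> \<bullet> z = 2 * N - 2}"
      using w(2) by (intro image_eqI[of _ _ "w0 z"]) auto
  next
    fix z assume "z \<in> w ` {z \<in> Orb. \<theta> \<bullet> z = 2 * N - 2}"
    then show "z \<in> {z \<in> Orb. (x + y) \<bullet> z = 2 * N - 2}"
      using weyl_orbit_closed[OF _ w(1)] inn[of \<theta>] by (auto simp: w\<theta>)
  qed
  also have "\<dots> = (\<lambda>u. w ((1/2) *\<^sub>R \<theta> + u)) ` U0 \<union> (\<lambda>u. w ((1/2) *\<^sub>R \<theta> - u)) ` U0"
    unfolding facet by (simp add: image_Un image_image)
  also have "\<dots> = (\<lambda>u. (1/2) *\<^sub>R (x + y) + u) ` w ` U0 \<union> (\<lambda>u. (1/2) *\<^sub>R (x + y) - u) ` w ` U0"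
    by (simp add: image_image linear_add[OF lin] linear_diff[OF lin] linear_scale[OF lin] w\<theta>
        del: scaleR_add_right)
  finally have "{z \<in> Orb. (x + y) \<bullet> z = 2 * N - 2} =
      (\<lambda>u. (1/2) *\<^sub>R (x + y) + u) ` w ` U0 \<union> (\<lambda>u. (1/2) *\<^sub>R (x + y) - u) ` w ` U0" .
  moreover have "pairwise orthogonal (w ` U0)"
    using U0_orthogonal by (auto simp: pairwise_def orthogonal_def inn)
  moreover have "0 \<notin> w ` U0"
    using U0_nonzero by (metis \<open>inj w\<close> inj_image_mem_iff linear_0[OF lin])
  moreover have "card (w ` U0) = d"
    using U0_card \<open>inj w\<close> by (metis card_image inj_on_subset subset_UNIV)
  ultimately show thesis using that by blast
qed

text \<open>Both products are at most \<open>N - 1\<close>, and their sum is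
  \<open>2 * N - 2\<close>.\<close>

lemma facet_neighbour:
  assumes x: "x \<in> Orb" and y: "y \<in> Orb" and xy: "x \<bullet> y = N - 2"
    and z: "z \<in> Orb" "(x + y) \<bullet> z = 2 * N - 2" "z \<noteq> x" "z \<noteq> y"
  shows "x \<bullet> z = N - 1" "y \<bullet> z = N - 1"
proof -
  have "x \<bullet> z \<le> N - 1" "y \<bullet> z \<le> N - 1" using inner_le x y z by auto
  then show "x \<bullet> z = N - 1" "y \<bullet> z = N - 1" using z(2) by (simp_all add: inner_add_left)
qed

text \<open>Since \<open>d \<ge> 2\<close>, the cross-polytope has a diagonal other than the one
  from \<open>x\<close> to \<open>y\<close>; its ends are \<open>z\<close> and
  \<open>x + y - z\<close>.\<close>

lemma common_neighbour:
  assumes x: "x \<in> Orb" and y: "y \<in> Orb" and xy: "x \<bullet> y = N - 2"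
  obtains z where "z \<in> Orb" "x + y - z \<in> Orb" "x \<bullet> z = N - 1" "y \<bullet> z = N - 1"
proof -
  obtain U where U: "{z \<in> Orb. (x + y) \<bullet> z = 2 * N - 2} =
      (\<lambda>u. (1/2) *\<^sub>R (x + y) + u) ` U \<union> (\<lambda>u. (1/2) *\<^sub>R (x + y) - u) ` U"
    and ort: "pairwise orthogonal U" "0 \<notin> U" and card: "card U = d"
    using cross_polytope[OF assms] .
  define c where "c = (1/2) *\<^sub>R (x + y)"
  note U = U[folded c_def]
  have y_eq: "y = c + c - x" unfolding c_def by (simp flip: scaleR_add_left)
  have "x \<in> {z \<in> Orb. (x + y) \<bullet> z = 2 * N - 2}"
    using x xy norm_Orb[OF x] by (simp add: inner_add_left inner_add_right inner_commute)
  then obtain u1 where u1: "u1 \<in> U" "x = c + u1 \<or> x = c - u1" unfolding U by blast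
  have "finite U" "U \<noteq> {u1}" using card d_ge card.infinite by fastforce+
  then obtain u2 where u2: "u2 \<in> U" "u2 \<noteq> u1" using u1(1) by blast
  have mem: "c + u2 \<in> Orb" "(x + y) \<bullet> (c + u2) = 2 * N - 2" "c - u2 \<in> Orb" using U u2(1) by blast+
  have "u2 \<bullet> u2 \<noteq> 0" using ort(2) u2(1) by auto
  moreover have "u1 \<bullet> u2 = 0"
    using ort(1) u1(1) u2 by (auto simp: pairwise_def orthogonal_def)
  \<comment> \<open>Orthogonality excludes that the second diagonal is the first one with its ends
    exchanged.\<close>
  ultimately have "u2 \<noteq> - u1" by auto
  then have "c + u2 \<noteq> x" "c + u2 \<noteq> y" using u1(2) u2(2) by (auto simp: y_eq)
  moreover have "x + y - (c + u2) = c - u2" by (simp add: y_eq)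
  ultimately show thesis using that[of "c + u2"] mem facet_neighbour[OF assms mem(1,2)] by metis
qed

section \<open>Edges and edge-distances in terms of inner products\<close>

abbreviation "edges \<equiv> {(x, y). closed_segment x y edge_of convex hull Orb}"

text \<open>The functional \<open>x + y\<close> has the value \<open>2 * N - 1\<close> at
  \<open>x\<close> and \<open>y\<close> and at most \<open>2 * N - 2\<close> at all other
  vertices.\<close>

lemma adjacent_edge:
  assumes "x \<in> Orb" "y \<in> Orb" "x \<bullet> y = N - 1"
  shows "(x, y) \<in> edges"
proof -
  have xy: "(x + y) \<bullet> x = 2 * N - 1" "(x + y) \<bullet> y = 2 * N - 1"
    using norm_Orb[OF assms(1)] norm_Orb[OF assms(2)] assms(3) by (simp_all add: inner_add_left inner_add_right inner_commute)
  have other: "(x + y) \<bullet> z \<le> 2 * N - 2" if "z \<in> Orb" "z \<noteq> x" "z \<noteq> y" for z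
    using inner_le[of x z] inner_le[of y z] that assms by (auto simp: inner_add_left)
  have le: "(x + y) \<bullet> z \<le> 2 * N - 1" if "z \<in> Orb" for z
    using other[OF that] xy by (cases "z = x \<or> z = y") auto
  have "{z \<in> Orb. (x + y) \<bullet> z = 2 * N - 1} = {x, y}"
    using other xy assms by force
  then have "closed_segment x y face_of convex hull Orb"
    using convex_hull_face_of[of Orb "x + y" "2 * N - 1"] le by (simp add: segment_convex_hull)
  moreover have "x \<noteq> y" using assms norm_Orb by auto
  then have "aff_dim (closed_segment x y) = 1"
    by (simp add: segment_convex_hull aff_dim_convex_hull)
  ultimately show ?thesis by (simp add: edge_of_def)
qed

text \<open>A face that contains the midpoint of a segment in the polytope contains the ends of that
  segment.\<close>

lemma not_edge:
  assumes "a \<in> Orb" "b \<in> Orb" "a + b = x + y" "a \<notin> closed_segment x y" "a \<noteq> b"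
  shows "(x, y) \<notin> edges"
proof
  assume "(x, y) \<in> edges"
  then have face: "closed_segment x y face_of convex hull Orb" by (simp add: edge_of_def)
  have "midpoint x y = midpoint a b" using assms(3) by (simp add: midpoint_def)
  then have "midpoint a b \<in> closed_segment x y" by (metis midpoint_in_closed_segment)
  moreover have "midpoint a b \<in> open_segment a b" using assms(5) by simp
  moreover have "a \<in> convex hull Orb" "b \<in> convex hull Orb" using assms by (simp_all add: hull_inc)
  ultimately have "a \<in> closed_segment x y" using face unfolding face_of_def by blast
  then show False using assms(4) by simp
qed

lemma edge_iff:
  assumes "x \<in> Orb" "y \<in> Orb"
  shows "(x, y) \<in> edges \<longleftrightarrow> x \<bullet> y = N - 1"
proof
  assume edge: "(x, y) \<in> edges"
  have "x \<noteq> y" using edge by (auto simp: edge_of_def)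
  then have "x \<bullet> y \<noteq> N" using inner_eq_N_iff[OF assms] by simp
  moreover have "x \<bullet> y \<noteq> N - 2"
  proof
    assume "x \<bullet> y = N - 2"
    then obtain z where z: "z \<in> Orb" "x + y - z \<in> Orb" "x \<bullet> z = N - 1" "y \<bullet> z = N - 1"
      using common_neighbour assms by metis
    \<comment> \<open>Every point of the segment has product \<open>N - 1\<close> with
      \<open>z\<close>, as both ends do, but \<open>z \<bullet> z = N\<close>.\<close>
    have "z \<notin> closed_segment x y"
    proof
      assume "z \<in> closed_segment x y"
      then obtain u where "z = (1 - u) *\<^sub>R x + u *\<^sub>R y" by (auto simp: closed_segment_def)
      then have "z \<bullet> z = (1 - u) * (x \<bullet> z) + u * (y \<bullet> z)"
        by (metis inner_add_left inner_scaleR_left)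
      then have "z \<bullet> z = N - 1" unfolding z(3,4) by (simp add: algebra_simps)
      then show False using norm_Orb[OF z(1)] by simp
    qed
    moreover have "z \<noteq> x + y - z"
    proof
      assume "z = x + y - z"
      then have "2 *\<^sub>R z = x + y" by (metis diff_add_cancel scaleR_2)
      then have "2 * (z \<bullet> z) = x \<bullet> z + y \<bullet> z" by (metis inner_add_left inner_scaleR_left)
      then show False using z norm_Orb[OF z(1)] by simp
    qed
    ultimately show False using not_edge[of z "x + y - z" x y] z edge by simp
  qed
  moreover have "x \<bullet> y \<noteq> N - 3"
  proof
    assume "x \<bullet> y = N - 3"
    then obtain z where y: "y = - x" and z: "z \<in> Orb" "- z \<in> Orb" "x \<bullet> z = N - 1"
      using opposite assms by blast
    \<comment> \<open>With \<open>y = - x\<close>, points of the segment are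
      \<open>(1 - 2 * u) x\<close> with \<open>u \<ge> 0\<close>, so their product with
      \<open>z\<close> is at most \<open>N - 1\<close>.\<close>
    have "z \<notin> closed_segment x y"
    proof
      assume "z \<in> closed_segment x y"
      then obtain u where u: "z = (1 - u) *\<^sub>R x + u *\<^sub>R y" "0 \<le> u" by (auto simp: closed_segment_def)
      then have "z \<bullet> z = (1 - u) * (x \<bullet> z) + u * (y \<bullet> z)"
        by (metis inner_add_left inner_scaleR_left)
      then have "z \<bullet> z = (N - 1) - 2 * (u * (N - 1))" unfolding y inner_minus_left z(3)
        by (simp add: algebra_simps)
      moreover have "0 \<le> u * (N - 1)" using u(2) N_pos by simp
      ultimately show False using norm_Orb[OF z(1)] by simp
    qed
    moreover have "z \<noteq> - z"
    proof
      assume "z = - z"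
      then have "x \<bullet> z = - (x \<bullet> z)" by (metis inner_minus_right)
      then show False using z(3) N_pos by simp
    qed
    ultimately show False using not_edge[of z "- z" x y] edge y z by simp
  qed
  ultimately show "x \<bullet> y = N - 1" using inner_cases[OF assms] by auto
qed (use adjacent_edge assms in blast)

text \<open>The relation \<open>edges\<close> ranges over all points of the space. Its paths stay in
  the orbit because the ends of an edge are extreme points of the hull.\<close>

lemma edge_endpoints:
  assumes "(x, y) \<in> edges"
  shows "x \<in> Orb" "y \<in> Orb"
proof -
  have face: "closed_segment x y face_of convex hull Orb" using assms by (simp add: edge_of_def)
  have "z \<in> Orb" if "z \<in> {x, y}" for z
  proof -
    have "z extreme_point_of closed_segment x y" using that by (simp add: extreme_point_of_segment)
    then have "z extreme_point_of convex hull Orb" using extreme_point_of_face[OF face] by blast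
    then show ?thesis by (rule extreme_point_of_convex_hull)
  qed
  then show "x \<in> Orb" "y \<in> Orb" by auto
qed

lemma edges_iff: "(x, y) \<in> edges \<longleftrightarrow> x \<in> Orb \<and> y \<in> Orb \<and> x \<bullet> y = N - 1"
  using edge_iff edge_endpoints by blast

lemma edge_dist_eq_Suc2:
  assumes path: "(x, y) \<in> edges ^^ Suc (Suc k)"
    and least: "\<And>j. j \<le> Suc k \<Longrightarrow> (x, y) \<notin> edges ^^ j"
  shows "edge_dist Orb x y = Suc (Suc k)"
  unfolding edge_dist_def
proof (rule Least_equality)
  show "(x, y) \<in> edges ^^ Suc (Suc k)" by (rule path)
  show "Suc (Suc k) \<le> j" if "(x, y) \<in> edges ^^ j" for j
    using least that not_less_eq_eq by blast
qed

lemma edge_dist_2: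
  assumes x: "x \<in> Orb" and y: "y \<in> Orb" and xy: "x \<bullet> y = N - 2"
  shows "edge_dist Orb x y = 2"
proof -
  obtain z where z: "z \<in> Orb" "x \<bullet> z = N - 1" "y \<bullet> z = N - 1"
    using common_neighbour[OF assms] by blast
  then have "(x, z) \<in> edges" "(z, y) \<in> edges" using x y by (simp_all only: edges_iff inner_commute simp_thms)
  then have "(x, y) \<in> edges ^^ Suc (Suc 0)" by (auto simp only: relpow.simps Id_O_R)
  moreover have "(x, y) \<notin> edges ^^ j" if "j \<le> Suc 0" for j
  proof -
    have "x \<noteq> y" using norm_Orb[OF x] xy by auto
    moreover have "(x, y) \<notin> edges" using xy by (simp only: edges_iff) simp
    ultimately show ?thesis using that by (cases j) auto
  qed
  ultimately show ?thesis using edge_dist_eq_Suc2[of x y 0] by simp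
qed

text \<open>The other products \<open>N\<close>, \<open>N - 1\<close> and \<open>N - 2\<close> give
  edge-distance at most 0, at most 1 and exactly 2. This identifies the terms of the antipodal
  equation.\<close>

lemma edge_dist_3_opposite:
  assumes x: "x \<in> Orb" and y: "y \<in> Orb" and dist: "edge_dist Orb x y = 3"
  shows "x \<bullet> y = N - 3"
proof -
  have "edge_dist Orb x y \<le> 0" if "x \<bullet> y = N"
    unfolding edge_dist_def using that inner_eq_N_iff[OF x y] by (intro Least_le) simp
  moreover have "edge_dist Orb x y \<le> 1" if "x \<bullet> y = N - 1"
    unfolding edge_dist_def using that edge_iff[OF x y] by (intro Least_le) simp
  moreover have "edge_dist Orb x y = 2" if "x \<bullet> y = N - 2" using edge_dist_2[OF x y that] .
  ultimately show ?thesis using inner_cases[OF x y] dist by auto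
qed

lemma edge_dist_opposite:
  assumes x: "x \<in> Orb" and y: "y \<in> Orb" and xy: "x \<bullet> y = N - 3"
  shows "edge_dist Orb x y = 3"
proof -
  obtain z where y_eq: "y = - x" and z: "z \<in> Orb" "- z \<in> Orb" "x \<bullet> z = N - 1"
    using opposite assms by blast
  \<comment> \<open>An opposite pair forces \<open>2 * N = 3\<close>, so product
    \<open>N - 1\<close> with \<open>x\<close> means product \<open>N - 2\<close> with
    \<open>- x\<close>.\<close>
  have N: "- N = N - 3" using xy norm_Orb[OF x] by (simp add: y_eq)
  have "y \<bullet> z = N - 2" using z(3) N by (simp add: y_eq)
  then obtain u where u: "u \<in> Orb" "y \<bullet> u = N - 1" "z \<bullet> u = N - 1"
    using common_neighbour[OF y z(1)] by blast
  have "(x, z) \<in> edges" "(z, u) \<in> edges" "(u, y) \<in> edges"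
    using x y z u by (simp_all only: edges_iff inner_commute simp_thms)
  then have "(x, y) \<in> edges ^^ Suc (Suc (Suc 0))" by (auto simp only: relpow.simps Id_O_R)
  moreover have "(x, y) \<notin> edges ^^ j" if "j \<le> Suc (Suc 0)" for j
  proof -
    have "x \<noteq> y" using norm_Orb[OF x] xy by auto
    moreover have "(x, y) \<notin> edges" using xy by (simp only: edges_iff) simp
    \<comment> \<open>The middle vertex of such a path would have product \<open>N - 1\<close> with
      both \<open>x\<close> and \<open>- x\<close>.\<close>
    moreover have "(x, y) \<notin> edges O edges"
    proof
      assume "(x, y) \<in> edges O edges"
      then obtain a where a: "(x, a) \<in> edges" "(a, y) \<in> edges" by blast
      then have "x \<bullet> a = N - 1" "a \<bullet> y = N - 1" by (simp_all only: edges_iff)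
      then have "N = 1" by (simp add: y_eq inner_commute)
      then show False using N_pos by simp
    qed
    moreover have "j = 0 \<or> j = Suc 0 \<or> j = Suc (Suc 0)" using that by auto
    ultimately show ?thesis by auto
  qed
  ultimately show ?thesis using edge_dist_eq_Suc2[of x y "Suc 0"] by simp
qed

section \<open>Exchange along edges, in cross-polytope faces and between opposite vertices\<close>

lemma exchangeable_adjacent:
  assumes "x \<in> Orb" "y \<in> Orb" "x \<bullet> y = N - 1"
  shows "exchangeable \<Phi> \<F> x y"
  using adjacent_reflection(3)[OF assms] diff_root[OF assms] unfolding exchangeable_def by blast

text \<open>In the face on which \<open>x + y\<close> is maximal, \<open>x\<close> and
  \<open>y\<close> are opposite. If \<open>z\<close> is an end of another diagonal, the root
  \<open>x - z\<close> reflects \<open>x\<close> to \<open>z\<close>. Its product with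
  \<open>y\<close> is \<open>(N - 2) - (N - 1) = - 1\<close>, so it reflects \<open>y\<close> to
  \<open>x + y - z\<close>, the other end.\<close>

lemma exchangeable_cross_polytope:
  assumes x: "x \<in> Orb" and y: "y \<in> Orb" and xy: "x \<bullet> y = N - 2"
    and eqs: "eqs_cross_polytope d Orb \<subseteq> \<F>"
  shows "exchangeable \<Phi> \<F> x y"
proof -
  obtain U where U: "{z \<in> Orb. (x + y) \<bullet> z = 2 * N - 2} =
      (\<lambda>u. (1/2) *\<^sub>R (x + y) + u) ` U \<union> (\<lambda>u. (1/2) *\<^sub>R (x + y) - u) ` U"
    and ort: "pairwise orthogonal U" "0 \<notin> U" and card: "card U = d"
    using cross_polytope[OF x y xy] .
  define c where "c = (1/2) *\<^sub>R (x + y)"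
  note U = U[folded c_def]
  have c2: "c + c = x + y" unfolding c_def by (simp flip: scaleR_add_left)
  define m where "m = (\<lambda>u. {#c + u, c - u#})"
  have "finite U" using card d_ge card.infinite by fastforce
  have "x \<in> {z \<in> Orb. (x + y) \<bullet> z = 2 * N - 2}"
    using x xy norm_Orb[OF x] by (simp add: inner_add_left inner_add_right inner_commute)
  then obtain u where u: "u \<in> U" "x = c + u \<or> x = c - u" unfolding U by blast
  have y_eq: "y = c + c - x" using c2 by simp
  \<comment> \<open>\<open>y\<close> is \<open>x\<close> reflected in the centre, so the
    half-diagonal \<open>u\<close> gives the pair up to order.\<close>
  have xy_u: "x = c + u \<and> y = c - u \<or> x = c - u \<and> y = c + u"
    using u(2) by (auto simp: y_eq)
  then have mu: "m u = {#x, y#}" by (auto simp: m_def add_mset_commute)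
  have "edge_dist Orb (c + u) (c - u) = 2"
    using xy_u edge_dist_2[OF x y xy] edge_dist_2[OF y x] xy by (auto simp: inner_commute)
  moreover have "convex hull ((\<lambda>u. c + u) ` U \<union> (\<lambda>u. c - u) ` U) face_of convex hull Orb"
    using convex_hull_face_of[of Orb "x + y" "2 * N - 2"] sum_inner_le[OF x y xy] by (simp only: U)
  moreover have "(\<lambda>u. c + u) ` U \<union> (\<lambda>u. c - u) ` U \<subseteq> Orb" unfolding U[symmetric] by blast
  moreover have "independent U" using ort by (rule pairwise_orthogonal_independent)
  ultimately have "mset_set (m ` U) \<in> eqs_cross_polytope d Orb"
    unfolding eqs_cross_polytope_def m_def using card u(1) by blast
  then have f: "mset_set (m ` U) \<in> \<F>" using eqs by blast
  have f_split: "mset_set (m ` U) = add_mset {#x, y#} (mset_set (m ` U - {{#x, y#}}))"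
    using \<open>finite U\<close> u(1) by (intro mset_set.remove) (auto simp flip: mu)
  have "\<exists>\<alpha>\<in>\<Phi>. (\<alpha> \<bullet> x) * (\<alpha> \<bullet> y) < 0 \<and> n = {#reflection \<alpha> x, reflection \<alpha> y#}"
    if n: "n \<in># mset_set (m ` U) - {#{#x, y#}#}" for n
  proof -
    have "n \<in># mset_set (m ` U - {{#x, y#}})" using n by (simp add: f_split)
    then have "n \<in> m ` U - {{#x, y#}}" using \<open>finite U\<close> by simp
    then obtain u' where u': "u' \<in> U" "n = m u'" "n \<noteq> {#x, y#}" by blast
    let ?z = "c + u'"
    have z: "?z \<in> Orb" "(x + y) \<bullet> ?z = 2 * N - 2" using U u'(1) by blast+
    have z': "c - u' = y - (?z - x)" using c2 by (simp add: y_eq)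
    have "?z \<noteq> x" using u'(2,3) z' by (auto simp: m_def)
    moreover have "?z \<noteq> y" using u'(2,3) z' by (auto simp: m_def add_mset_commute)
    ultimately have adj: "x \<bullet> ?z = N - 1" "y \<bullet> ?z = N - 1"
      using facet_neighbour[OF x y xy z] by auto
    let ?\<alpha> = "x - ?z"
    note r = adjacent_reflection[OF x z(1) adj(1)]
    have "?\<alpha> \<bullet> y = x \<bullet> y - y \<bullet> ?z" by (simp only: inner_diff_left inner_commute[of y])
    then have \<alpha>y: "?\<alpha> \<bullet> y = - 1" using xy adj(2) by simp
    have "reflection ?\<alpha> y = c - u'" unfolding r(4) \<alpha>y z' by simp
    then have "n = {#reflection ?\<alpha> x, reflection ?\<alpha> y#}" using r(3) by (simp add: u'(2) m_def)
    moreover have "(?\<alpha> \<bullet> x) * (?\<alpha> \<bullet> y) < 0" unfolding r(1) \<alpha>y by simp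
    ultimately show ?thesis using diff_root[OF x z(1) adj(1)] by blast
  qed
  moreover have "{#x, y#} \<in># mset_set (m ` U)" by (subst f_split) simp
  ultimately show ?thesis using f unfolding exchangeable_def by blast
qed

text \<open>Since \<open>2 * N = 3\<close>, negation interchanges the products \<open>N - 1\<close>
  and \<open>N - 2\<close> with \<open>x\<close>. So one member \<open>C\<close> of any other
  opposite pair is adjacent to \<open>x\<close>, and the reflection in \<open>x - C\<close> takes
  \<open>x\<close> to \<open>C\<close> and \<open>- x\<close> to \<open>- C\<close>.\<close>

lemma exchangeable_antipodal:
  assumes x: "x \<in> Orb" and y: "y \<in> Orb" and xy: "x \<bullet> y = N - 3"
    and eqs: "eq_antipodal Orb \<in> \<F>"
  shows "exchangeable \<Phi> \<F> x y"
proof -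
  let ?M = "{{#A, B#} | A B. A \<in> Orb \<and> B \<in> Orb \<and> edge_dist Orb A B = 3}"
  have y_eq: "y = - x" using opposite x y xy by blast
  have N: "- N = N - 3" using xy norm_Orb[OF x] by (simp add: y_eq)
  have "?M \<subseteq> (\<lambda>(A, B). {#A, B#}) ` (Orb \<times> Orb)" by auto
  then have "finite ?M" using finite_Orb by (meson finite_SigmaI finite_imageI finite_subset)
  have "{#x, y#} \<in> ?M" using x y edge_dist_opposite[OF x y xy] by blast
  then have f_split: "eq_antipodal Orb = add_mset {#x, y#} (mset_set (?M - {{#x, y#}}))"
    unfolding eq_antipodal_def using \<open>finite ?M\<close> by (intro mset_set.remove)
  have "\<exists>\<alpha>\<in>\<Phi>. (\<alpha> \<bullet> x) * (\<alpha> \<bullet> y) < 0 \<and> n = {#reflection \<alpha> x, reflection \<alpha> y#}"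
    if n: "n \<in># eq_antipodal Orb - {#{#x, y#}#}" for n
  proof -
    have "n \<in># mset_set (?M - {{#x, y#}})" using n by (simp add: f_split)
    then have "n \<in> ?M - {{#x, y#}}" using \<open>finite ?M\<close> by simp
    then obtain A B where AB: "A \<in> Orb" "B \<in> Orb" "edge_dist Orb A B = 3" "n = {#A, B#}"
      "n \<noteq> {#x, y#}" by blast
    then have B: "B = - A" using opposite edge_dist_3_opposite by blast
    have ne: "A \<noteq> x" "A \<noteq> y" "B \<noteq> x" "B \<noteq> y"
      using AB(4,5) by (auto simp: B y_eq add_mset_commute)
    have sep: ?thesis if C: "C \<in> Orb" "x \<bullet> C = N - 1" "n = {#C, - C#}" for C
    proof -
      note r = adjacent_reflection[OF x C(1,2)]
      have "reflection (x - C) y = - C"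
        unfolding y_eq linear_neg[OF linear_reflection] r(3) ..
      moreover have "(x - C) \<bullet> y = - 1" unfolding y_eq inner_minus_right r(1) ..
      ultimately show ?thesis using r(1,3) C diff_root[OF x C(1,2)]
        by (intro bexI[of _ "x - C"]) simp_all
    qed
    have "x \<bullet> A \<noteq> N" using inner_eq_N_iff[OF x AB(1)] ne by simp
    moreover have "x \<bullet> A \<noteq> N - 3" using opposite[OF x AB(1)] ne y_eq by auto
    ultimately consider "x \<bullet> A = N - 1" | "x \<bullet> A = N - 2" using inner_cases[OF x AB(1)] by auto
    then show ?thesis
    proof cases
      case 1
      then show ?thesis using sep[OF AB(1)] AB(4) B by simp
    next
      case 2
      then have "x \<bullet> B = N - 1" using N by (simp add: B)
      then show ?thesis using sep[OF AB(2)] AB(4) by (simp add: B add_mset_commute)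
    qed
  qed
  moreover have "{#x, y#} \<in># eq_antipodal Orb" by (simp add: f_split)
  ultimately show ?thesis using eqs unfolding exchangeable_def by blast
qed

lemma balanced_eq_antipodal: "balanced (eq_antipodal Orb)"
  unfolding balanced_def
proof (rule exI[of _ 0], rule ballI)
  fix m assume "m \<in># eq_antipodal Orb"
  then have "m \<in> {{#A, B#} | A B. A \<in> Orb \<and> B \<in> Orb \<and> edge_dist Orb A B = 3}"
    unfolding eq_antipodal_def by (metis (no_types, lifting) elem_mset_set infinite_set_mset_mset_set empty_iff)
  then obtain A B where "m = {#A, B#}" "A \<in> Orb" "B \<in> Orb" "edge_dist Orb A B = 3" by blast
  moreover from this have "A + B = 0" using opposite edge_dist_3_opposite by fastforce
  ultimately show "\<exists>A B. m = {#A, B#} \<and> A + B = 0" by blast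
qed

end

lemma balanced_eqs_cross_polytope:
  assumes "f \<in> eqs_cross_polytope d V"
  shows "balanced f"
proof -
  obtain c U where f: "f = mset_set ((\<lambda>u. {#c + u, c - u#}) ` U)"
    using assms unfolding eqs_cross_polytope_def by blast
  have "set_mset f \<subseteq> (\<lambda>u. {#c + u, c - u#}) ` U"
    unfolding f by (cases "finite ((\<lambda>u. {#c + u, c - u#}) ` U)") auto
  then show ?thesis unfolding balanced_def by (intro exI[of _ "c + c"]) force
qed

section \<open>The lattice $E_8$\<close>

lemma reflection_self: "reflection \<alpha> \<alpha> = - \<alpha>"
  by (cases "\<alpha> = 0") (simp_all add: reflection_def scaleR_2)

lemma Ints_square_eq_1:
  fixes x :: real
  assumes "x \<in> \<int>" "x \<noteq> 0" "x\<^sup>2 < 4"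
  shows "x \<in> {1, -1}"
proof -
  obtain k :: int where k: "x = of_int k" using assms(1) by (auto elim: Ints_cases)
  have "\<bar>x\<bar> < 2" using assms(3) by (intro power2_less_imp_less[of "\<bar>x\<bar>" 2]) simp_all
  then have "k \<noteq> 0" "\<bar>k\<bar> < 2" using assms(2) k by auto
  then have "k = 1 \<or> k = -1" by linarith
  then show ?thesis using k by auto
qed

text \<open>Read for coordinates: an integral vector of length 1 is a signed unit vector.\<close>

lemma Ints_sum_squares_1:
  fixes f :: "'a \<Rightarrow> real"
  assumes "finite S" "\<And>i. i \<in> S \<Longrightarrow> f i \<in> \<int>" "(\<Sum>i\<in>S. (f i)\<^sup>2) = 1"
  obtains j where "j \<in> S" "f j \<in> {1, -1}" "\<And>i. i \<in> S \<Longrightarrow> i \<noteq> j \<Longrightarrow> f i = 0"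
proof -
  have "\<exists>j\<in>S. f j \<noteq> 0" using assms(3) by (intro ccontr[of "\<exists>j\<in>S. f j \<noteq> 0"]) simp
  then obtain j where j: "j \<in> S" "f j \<noteq> 0" by blast
  have split: "(f j)\<^sup>2 + (\<Sum>i\<in>S - {j}. (f i)\<^sup>2) = 1" using assms(3) sum.remove[OF assms(1) j(1), of "\<lambda>i. (f i)\<^sup>2"] by simp
  have nonneg: "0 \<le> (\<Sum>i\<in>S - {j}. (f i)\<^sup>2)" by (simp add: sum_nonneg)
  have fj: "f j \<in> {1, -1}" using split nonneg by (intro Ints_square_eq_1 assms(2) j) linarith
  then have "(\<Sum>i\<in>S - {j}. (f i)\<^sup>2) = 0" using split by auto
  then have "f i = 0" if "i \<in> S" "i \<noteq> j" for i
    using that assms(1) by (simp add: sum_nonneg_eq_0_iff)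
  with fj j(1) that show thesis by blast
qed

text \<open>The \<open>E\<^sub>8\<close> root lattice is self-dual, hence it is the set of vectors with integral pairings.\<close>

definition E8_lattice :: "(real^'n) set" where
  "E8_lattice = {x. \<forall>\<alpha>\<in>roots_E8. \<alpha> \<bullet> x \<in> \<int>}"

lemma E8_lattice_add: "x \<in> E8_lattice \<Longrightarrow> y \<in> E8_lattice \<Longrightarrow> x + y \<in> E8_lattice"
  by (simp add: E8_lattice_def inner_add_right)

lemma E8_lattice_diff: "x \<in> E8_lattice \<Longrightarrow> y \<in> E8_lattice \<Longrightarrow> x - y \<in> E8_lattice"
  by (simp add: E8_lattice_def inner_diff_right)

lemma roots_D_subset_E8: "roots_D \<subseteq> roots_E8"
  by (simp add: roots_E8_def)

lemma E8_lattice_coords: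
  assumes "x \<in> E8_lattice" "i \<noteq> j"
  shows "x $ i + x $ j \<in> \<int>" "x $ i - x $ j \<in> \<int>"
proof -
  have D: "\<alpha> \<bullet> x \<in> \<int>" if "\<alpha> \<in> roots_D" for \<alpha>
    using assms(1) that roots_D_subset_E8 by (auto simp: E8_lattice_def)
  have "(1 *\<^sub>R unit_vec i + 1 *\<^sub>R unit_vec j) \<bullet> x \<in> \<int>" "(1 *\<^sub>R unit_vec i + (-1) *\<^sub>R unit_vec j) \<bullet> x \<in> \<int>"
    using assms(2) by (intro D roots_D_I; simp)+
  then show "x $ i + x $ j \<in> \<int>" "x $ i - x $ j \<in> \<int>" unfolding inner_unit_vec_sum by simp_all
qed

lemma E8_lattice_twice:
  assumes "x \<in> E8_lattice" "i \<noteq> j"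
  shows "2 * x $ i \<in> \<int>"
  using Ints_add[OF E8_lattice_coords[OF assms]] by simp

lemma E8_lattice_integral:
  assumes "x \<in> E8_lattice" "x $ k \<in> \<int>"
  shows "x $ i \<in> \<int>"
proof (cases "i = k")
  case False
  then show ?thesis using Ints_add[OF E8_lattice_coords(2)[OF assms(1) False] assms(2)] by simp
qed (use assms in simp)

text \<open>Agreeing coordinates contribute 1/4 and differing ones - 1/4.\<close>

lemma spin_vec_inner:
  fixes S T :: "'n::finite set"
  shows "spin_vec S \<bullet> spin_vec T = real CARD('n) / 4 - real (card (sym_diff S T)) / 2"
proof -
  have "spin_vec S \<bullet> spin_vec T = (\<Sum>i\<in>UNIV. 1/4 - (if i \<in> sym_diff S T then 1/2 else 0))"
    unfolding inner_vec_def by (rule sum.cong) (auto simp: spin_vec_nth)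
  also have "\<dots> = real CARD('n) / 4 - (\<Sum>i\<in>UNIV. if i \<in> sym_diff S T then 1/2 else 0)"
    by (simp add: sum_subtractf)
  also have "(\<Sum>i\<in>UNIV. if i \<in> sym_diff S T then 1/2 else 0) = real (card (sym_diff S T)) / 2"
    using sum.inter_restrict[of UNIV "\<lambda>_. 1/2 :: real" "sym_diff S T"] by simp
  finally show ?thesis .
qed

context
  assumes card8: "CARD('n::finite) = 8"
begin

lemma spin_vec_root: "even (card S) \<Longrightarrow> spin_vec (S :: 'n set) \<in> roots_E8"
proof -
  assume even: "even (card S)"
  have "{i. spin_vec S $ i < 0} = UNIV - S" by (auto simp: spin_vec_nth)
  then have "card {i. spin_vec S $ i < 0} = 8 - card S" by (simp add: card_Diff_subset card8)
  then have "even (card {i. spin_vec S $ i < 0})" using even by simp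
  then show ?thesis unfolding roots_E8_def by (auto simp: spin_vec_nth)
qed

lemma roots_E8_cases:
  assumes "\<alpha> \<in> (roots_E8 :: (real^'n) set)"
  obtains "\<alpha> \<in> roots_D" | S where "\<alpha> = spin_vec S" "even (card S)"
proof (cases "\<alpha> \<in> roots_D")
  case False
  then have \<alpha>: "\<forall>i. \<alpha> $ i \<in> {1/2, -1/2}" "even (card {i. \<alpha> $ i < 0})"
    using assms unfolding roots_E8_def by blast+
  define S where "S = UNIV - {i. \<alpha> $ i < 0}"
  have "\<alpha> $ i = spin_vec S $ i" for i
    using \<alpha>(1)[rule_format, of i] by (auto simp: spin_vec_nth S_def)
  then have "\<alpha> = spin_vec S" by (simp add: vec_eq_iff)
  moreover have "card S = 8 - card {i. \<alpha> $ i < 0}"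
    unfolding S_def by (simp add: card_Diff_subset card8)
  then have "even (card S)" using \<alpha>(2) by simp
  ultimately show thesis using that by blast
qed (use that in blast)

lemma roots_D_norm: "\<alpha> \<in> roots_D \<Longrightarrow> \<alpha> \<bullet> \<alpha> = 2"
  using unit_vec_sum_norm2 by (elim roots_D_E) blast

lemma roots_E8_norm: "\<alpha> \<in> (roots_E8 :: (real^'n) set) \<Longrightarrow> \<alpha> \<bullet> \<alpha> = 2"
  by (elim roots_E8_cases) (simp_all add: roots_D_norm spin_vec_inner card8)

text \<open>The one case in which parity matters is that of two half-integral roots: both sets are
  even, so their symmetric difference is, and its size halved is subtracted from 2.\<close>

lemma roots_E8_subset_lattice: "(roots_E8 :: (real^'n) set) \<subseteq> E8_lattice"
proof -
  have D: "\<alpha> \<bullet> \<beta> \<in> \<int>" if \<alpha>: "\<alpha> \<in> roots_D" and \<beta>: "\<beta> \<in> roots_E8" for \<alpha> \<beta> :: "real^'n"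
  proof -
    obtain i j s t where ij: "i \<noteq> j" "s \<in> {1, -1}" "t \<in> {1, -1}"
      "\<alpha> = s *\<^sub>R unit_vec i + t *\<^sub>R unit_vec j" using \<alpha> by (elim roots_D_E)
    show ?thesis
      using \<beta>
    proof (cases rule: roots_E8_cases)
      case 1
      then have "\<beta> $ k \<in> \<int>" for k
        by (elim roots_D_E) (auto simp: unit_vec_nth)
      then show ?thesis unfolding ij(4) inner_unit_vec_sum using ij(2,3) by auto
    next
      case (2 S)
      then show ?thesis unfolding ij(4) inner_unit_vec_sum using ij(2,3) by (auto simp: spin_vec_nth)
    qed
  qed
  have "\<alpha> \<bullet> \<beta> \<in> \<int>" if \<alpha>: "\<alpha> \<in> roots_E8" and \<beta>: "\<beta> \<in> roots_E8" for \<alpha> \<beta> :: "real^'n"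
    using \<alpha>
  proof (cases rule: roots_E8_cases)
    case 1
    then show ?thesis using D \<beta> by blast
  next
    case (2 S)
    note S = this
    show ?thesis
      using \<beta>
    proof (cases rule: roots_E8_cases)
      case 1
      then show ?thesis using D[OF 1 \<alpha>] by (simp add: inner_commute)
    next
      case (2 T)
      have "even (card (sym_diff S T))" using S 2 by (simp only: even_card_sym_diff)
      then obtain k where "card (sym_diff S T) = 2 * k" by (elim evenE)
      then have "\<alpha> \<bullet> \<beta> = 2 - real k" unfolding S(1) 2(1) spin_vec_inner card8 by simp
      then show ?thesis by simp
    qed
  qed
  then show ?thesis by (auto simp: E8_lattice_def)
qed

text \<open>Coordinates of a lattice vector differ by integers, so all or none are integral.
  Integers with square sum 2 are two signs and zeros. Otherwise each of the eight squares is at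
  least 1/4, and the sum 2 forces equality.\<close>

lemma E8_lattice_norm2_root:
  assumes x: "x \<in> (E8_lattice :: (real^'n) set)" "x \<bullet> x = 2"
  shows "x \<in> roots_E8"
proof -
  have sum2: "(\<Sum>i\<in>UNIV. (x $ i)\<^sup>2) = 2"
    using x(2) by (simp add: inner_vec_def power2_eq_square)
  have "\<exists>k l :: 'n. k \<noteq> l" using card8 card_le_Suc0_iff_eq[of "UNIV :: 'n set"] by auto
  then obtain k l :: 'n where kl: "k \<noteq> l" by blast
  show ?thesis
  proof (cases "x $ k \<in> \<int>")
    case True
    then have int: "x $ i \<in> \<int>" for i using E8_lattice_integral[OF x(1)] by blast
    have "\<exists>i. x $ i \<noteq> 0" using x(2) by (intro ccontr[of "\<exists>i. x $ i \<noteq> 0"]) (simp add: inner_vec_def)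
    then obtain i where i: "x $ i \<noteq> 0" by blast
    have split: "(x $ i)\<^sup>2 + (\<Sum>j\<in>UNIV - {i}. (x $ j)\<^sup>2) = 2"
      using sum2 sum.remove[of UNIV i "\<lambda>i. (x $ i)\<^sup>2"] by simp
    have "0 \<le> (\<Sum>j\<in>UNIV - {i}. (x $ j)\<^sup>2)" by (simp add: sum_nonneg)
    then have xi: "x $ i \<in> {1, -1}" using split by (intro Ints_square_eq_1 int i) linarith
    then have "(\<Sum>j\<in>UNIV - {i}. (x $ j)\<^sup>2) = 1" using split by auto
    then obtain j where j: "j \<noteq> i" "x $ j \<in> {1, -1}" "\<And>m. m \<noteq> i \<Longrightarrow> m \<noteq> j \<Longrightarrow> x $ m = 0"
      using Ints_sum_squares_1[of "UNIV - {i}" "\<lambda>j. x $ j"] int by auto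
    have "x = (x $ i) *\<^sub>R unit_vec i + (x $ j) *\<^sub>R unit_vec j"
      using j(1,3) by (auto simp: vec_eq_iff unit_vec_nth)
    then have "x \<in> roots_D" using roots_D_I[OF j(1)[symmetric] xi j(2)] by simp
    then show ?thesis using roots_D_subset_E8 by blast
  next
    case False
    have half: "(x $ i)\<^sup>2 \<ge> 1/4" for i
    proof -
      have "x $ i \<noteq> 0" using E8_lattice_integral[OF x(1), of i k] False by auto
      moreover have "2 * x $ i \<in> \<int>"
        using E8_lattice_twice[OF x(1), of i k] E8_lattice_twice[OF x(1) kl] by (cases "i = k") auto
      ultimately have "1 \<le> \<bar>2 * x $ i\<bar>" using Ints_nonzero_abs_ge1 by force
      then have "1 ^ 2 \<le> \<bar>2 * x $ i\<bar> ^ 2" by (intro power_mono) auto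
      then show ?thesis by (simp add: power_mult_distrib)
    qed
    have "(\<Sum>i\<in>UNIV. (x $ i)\<^sup>2 - 1/4) = 0" using sum2 by (simp add: sum_subtractf card8)
    then have "(x $ i)\<^sup>2 - 1/4 = 0" for i
      using half by (subst (asm) sum_nonneg_eq_0_iff) auto
    then have sq: "(x $ i)\<^sup>2 = (1/2)\<^sup>2" for i by (simp add: power2_eq_square)
    define S where "S = {i. x $ i = 1/2}"
    have xS: "x = spin_vec S"
      using sq[unfolded power2_eq_iff] by (auto simp: vec_eq_iff spin_vec_nth S_def)
    \<comment> \<open>Pairing with the root whose coordinates are all 1/2 yields the parity of
      \<open>S\<close>.\<close>
    have "spin_vec UNIV \<bullet> x \<in> \<int>"
      using x(1) spin_vec_root[of UNIV] card8 by (simp add: E8_lattice_def)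
    then have "2 - real (card (sym_diff UNIV S)) / 2 \<in> \<int>"
      unfolding xS spin_vec_inner card8 by simp
    then obtain z where "2 - real (card (sym_diff UNIV S)) / 2 = of_int z" by (elim Ints_cases)
    then have "real_of_int (int (card (sym_diff UNIV S))) = real_of_int (2 * (2 - z))" by simp
    then have "int (card (sym_diff UNIV S)) = 2 * (2 - z)" by (simp only: of_int_eq_iff)
    then have "even (card (sym_diff UNIV S))" by presburger
    then have "even (card S)" unfolding even_card_sym_diff by (simp add: card8)
    then show ?thesis unfolding xS by (rule spin_vec_root)
  qed
qed

end

text \<open>Common frame of both types E: the roots are those of \<open>roots_E8\<close> in a
  subspace. The base point \<open>v\<close> is a weight of the subsystem, with integral products
  required for the roots in \<open>H\<close>; in both instances it lies outside the E8
  lattice.\<close>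

locale E8_subsystem =
  fixes H :: "(real^'n) set" and v :: "real^'n"
  assumes card8: "CARD('n::finite) = 8" and H: "subspace H"
    and integral: "\<And>\<alpha>. \<alpha> \<in> roots_E8 \<inter> H \<Longrightarrow> \<alpha> \<bullet> v \<in> \<int>"
begin

abbreviation "\<Phi> \<equiv> roots_E8 \<inter> H"
abbreviation "Orb \<equiv> weyl_orbit \<Phi> v"

text \<open>The three claims share one induction: a reflection subtracts
  \<open>\<alpha> \<bullet> x\<close> times \<open>\<alpha>\<close>, and the lattice coset is kept
  because this coefficient is an integer.\<close>

lemma orbit_coset:
  assumes "x \<in> Orb"
  shows "x - v \<in> E8_lattice \<inter> H" "(x - v) \<bullet> v \<in> \<int>" "\<And>\<alpha>. \<alpha> \<in> \<Phi> \<Longrightarrow> \<alpha> \<bullet> x \<in> \<int>"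
proof -
  have "x - v \<in> E8_lattice \<inter> H \<and> (x - v) \<bullet> v \<in> \<int> \<and> (\<forall>\<alpha>\<in>\<Phi>. \<alpha> \<bullet> x \<in> \<int>)"
    using assms
  proof (induction rule: weyl_orbit_induct)
    case base
    then show ?case using integral subspace_0[OF H] by (simp add: E8_lattice_def)
  next
    case (step x \<alpha>)
    then have \<alpha>: "\<alpha> \<in> roots_E8" "\<alpha> \<in> H" and k: "\<alpha> \<bullet> x \<in> \<int>" by auto
    have r: "reflection \<alpha> x = x - (\<alpha> \<bullet> x) *\<^sub>R \<alpha>"
      by (rule reflection_norm2) (rule roots_E8_norm[OF card8 \<alpha>(1)])
    have r': "reflection \<alpha> x - v = (x - v) - (\<alpha> \<bullet> x) *\<^sub>R \<alpha>" by (simp add: r)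
    have \<beta>: "\<beta> \<bullet> \<alpha> \<in> \<int>" if "\<beta> \<in> roots_E8" for \<beta>
      using roots_E8_subset_lattice[OF card8] \<alpha>(1) that by (auto simp: E8_lattice_def)
    have "reflection \<alpha> x - v \<in> E8_lattice"
      unfolding r' using step k \<beta> by (simp add: E8_lattice_def inner_diff_right)
    moreover have "reflection \<alpha> x - v \<in> H"
      unfolding r'
      by (rule subspace_diff[OF H _ subspace_scale[OF H \<alpha>(2)]]) (use step in blast)
    moreover have "(reflection \<alpha> x - v) \<bullet> v \<in> \<int>"
      unfolding r' inner_diff_left[of "x - v"] inner_scaleR_left using step k integral \<alpha> by simp
    moreover have "\<gamma> \<bullet> reflection \<alpha> x \<in> \<int>" if "\<gamma> \<in> \<Phi>" for \<gamma>
      unfolding r using step k \<beta> that by (simp add: inner_diff_right)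
    ultimately show ?case by blast
  qed
  then show "x - v \<in> E8_lattice \<inter> H" "(x - v) \<bullet> v \<in> \<int>" "\<And>\<alpha>. \<alpha> \<in> \<Phi> \<Longrightarrow> \<alpha> \<bullet> x \<in> \<int>" by blast+
qed

text \<open>Moving \<open>x\<close> to \<open>v\<close> turns the difference into
  \<open>(w y - v) \<bullet> v\<close>, an integer by \<open>orbit_coset\<close>. With the
  Cauchy-Schwarz bound this leaves only the products listed in \<open>inner_cases\<close>.\<close>

lemma orbit_inner:
  assumes x: "x \<in> Orb" and y: "y \<in> Orb"
  shows "x \<bullet> y - v \<bullet> v \<in> \<int>" "\<bar>x \<bullet> y\<bar> \<le> v \<bullet> v"
proof -
  obtain w where w: "w \<in> weyl_group \<Phi>" "w x = v" using weyl_orbit_transitive[OF x] .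
  have "x \<bullet> y = v \<bullet> w y"
    using orthogonal_transformation_weyl[OF w(1)] w(2) by (metis orthogonal_transformation_def)
  then have "x \<bullet> y - v \<bullet> v = (w y - v) \<bullet> v" by (simp add: inner_diff_left inner_diff_right inner_commute)
  then show "x \<bullet> y - v \<bullet> v \<in> \<int>"
    using orbit_coset(2)[OF weyl_orbit_closed[OF y w(1)]] by simp
  have "\<bar>x \<bullet> y\<bar> \<le> norm x * norm y" by (rule Cauchy_Schwarz_ineq2)
  also have "\<dots> = v \<bullet> v"
    using weyl_orbit_norm[OF x] weyl_orbit_norm[OF y] by (simp add: norm_eq_sqrt_inner)
  finally show "\<bar>x \<bullet> y\<bar> \<le> v \<bullet> v" .
qed

text \<open>The difference lies in the lattice and in \<open>H\<close>, and its squared length is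
  \<open>2 * (v \<bullet> v) - 2 * (v \<bullet> v - 1) = 2\<close>.\<close>

lemma orbit_diff_root:
  assumes x: "x \<in> Orb" and y: "y \<in> Orb" and xy: "x \<bullet> y = v \<bullet> v - 1"
  shows "x - y \<in> \<Phi>"
proof -
  have eq: "x - y = (x - v) - (y - v)" by simp
  have "x - y \<in> E8_lattice"
    unfolding eq by (rule E8_lattice_diff) (use orbit_coset x y in blast)+
  moreover have "x - y \<in> H"
    unfolding eq by (rule subspace_diff[OF H]) (use orbit_coset x y in blast)+
  moreover have "(x - y) \<bullet> (x - y) = 2"
    using weyl_orbit_norm[OF x] weyl_orbit_norm[OF y] xy
    by (simp add: inner_diff_left inner_diff_right inner_commute)
  ultimately show ?thesis using E8_lattice_norm2_root[OF card8] by blast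
qed

lemma orbit_step:
  assumes "x \<in> Orb" "\<alpha> \<in> \<Phi>" "\<alpha> \<bullet> x = k"
  shows "x - k *\<^sub>R \<alpha> \<in> Orb"
  using weyl_orbit_reflection[OF assms(1,2)] reflection_norm2[OF roots_E8_norm[OF card8]] assms
  by fastforce

end

lemma roots_E6_eq: "roots_E6 p q r = roots_E8 \<inter> {x. x $ p = x $ q \<and> x $ q = - x $ r}"
  by (auto simp: roots_E6_def)

lemma roots_E7_eq: "roots_E7 q r = roots_E8 \<inter> {x. x $ q = - x $ r}"
  by (auto simp: roots_E7_def)

lemma Ints_sum_D:
  fixes x N :: real
  assumes "x - N \<in> \<int>" "x \<le> N" "N - 4 < x"
  shows "x \<in> {N, N - 1, N - 2, N - 3}"
proof -
  obtain k where k: "x - N = of_int k" using assms(1) by (auto elim: Ints_cases)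
  then have "k \<le> 0" "-4 < k" using assms(2,3) by linarith+
  then have "k = 0 \<or> k = -1 \<or> k = -2 \<or> k = -3" by linarith
  then show ?thesis using k by auto
qed

lemma card_Compl_8: "CARD('n::finite) = 8 \<Longrightarrow> card (- A :: 'n set) = 8 - card A"
  by (simp add: Compl_eq_Diff_UNIV card_Diff_subset)

lemma unit_vec_orthogonal: "pairwise orthogonal (unit_vec ` S)" "0 \<notin> unit_vec ` S"
  "card (unit_vec ` S) = card S"
proof -
  show "pairwise orthogonal (unit_vec ` S)"
    by (auto simp: pairwise_def orthogonal_def inner_unit_vec unit_vec_nth)
  show "0 \<notin> unit_vec ` S" by (auto simp: axis_eq_0_iff eq_commute[of 0])
  have "inj_on unit_vec S" by (auto simp: inj_on_def axis_eq_axis)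
  then show "card (unit_vec ` S) = card S" by (rule card_image)
qed

section \<open>Type $E_6$\<close>

text \<open>The sign \<open>\<sigma>\<close> treats both orbits at once: for
  \<open>\<sigma> = 1\<close> the base point is the weight of \<open>E6_1\<close>, for
  \<open>\<sigma> = - 1\<close> its negative, whose orbit contains the weight of
  \<open>E6_6\<close>.\<close>

locale E6_orbit =
  fixes p q r :: "'n::finite" and \<sigma> :: real
  assumes card8: "CARD('n) = 8" and distinct: "distinct [p, q, r]" and \<sigma>: "\<sigma> \<in> {1, -1}"
begin

lemma neq: "p \<noteq> q" "p \<noteq> r" "q \<noteq> r" "q \<noteq> p" "r \<noteq> p" "r \<noteq> q"
  using distinct by auto

text \<open>\<open>H\<close> is the orthogonal sum of the line through \<open>h\<close> and the span
  of the five unit vectors with index other than \<open>p\<close>, \<open>q\<close>,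
  \<open>r\<close>.\<close>

definition h :: "real^'n" where "h = unit_vec r - unit_vec q - unit_vec p"
definition v :: "real^'n" where "v = (\<sigma> * 2/3) *\<^sub>R h"
definition H :: "(real^'n) set" where "H = {x. x $ p = x $ q \<and> x $ q = - x $ r}"

lemma h_nth: "h $ k = (if k = r then 1 else if k = p \<or> k = q then - 1 else 0)"
  using neq by (auto simp: h_def unit_vec_nth)

lemma h_inner: "h \<bullet> x = x $ r - x $ q - x $ p"
  by (simp add: h_def inner_diff_left inner_unit_vec)

lemma h_inner_H: "x \<in> H \<Longrightarrow> h \<bullet> x = 3 * x $ r"
  by (simp add: h_inner H_def)

lemma h_norm: "h \<bullet> h = 3"
  using neq by (simp add: h_inner h_nth)

lemma \<sigma>_square: "\<sigma> * \<sigma> = 1" using \<sigma> by auto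

lemma v_norm: "v \<bullet> v = 4/3"
  using \<sigma>_square by (simp add: v_def h_norm)

lemma subspace_H: "subspace H"
  by (auto simp: H_def subspace_def)

lemma v_H: "v \<in> H"
  using neq by (simp add: H_def v_def h_nth)

sublocale E8_subsystem H v
proof
  fix \<alpha> assume \<alpha>: "\<alpha> \<in> roots_E8 \<inter> H"
  then have "\<alpha> \<bullet> v = \<sigma> * (2 * \<alpha> $ r)"
    by (simp add: v_def inner_commute[of \<alpha>] h_inner_H)
  moreover have "2 * \<alpha> $ r \<in> \<int>"
    using E8_lattice_twice[of \<alpha> r p] roots_E8_subset_lattice[OF card8] \<alpha> neq by auto
  ultimately show "\<alpha> \<bullet> v \<in> \<int>" using \<sigma> by auto
qed (use card8 subspace_H in auto)

lemma scale_root: "\<alpha> \<in> \<Phi> \<Longrightarrow> \<sigma> *\<^sub>R \<alpha> \<in> \<Phi>"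
proof -
  assume \<alpha>: "\<alpha> \<in> \<Phi>"
  have "\<sigma> *\<^sub>R \<alpha> \<in> E8_lattice"
    using \<alpha> roots_E8_subset_lattice[OF card8] \<sigma> by (auto simp: E8_lattice_def)
  moreover have "(\<sigma> *\<^sub>R \<alpha>) \<bullet> (\<sigma> *\<^sub>R \<alpha>) = 2"
    using \<alpha> roots_E8_norm[OF card8] \<sigma>_square by simp
  ultimately show ?thesis
    using E8_lattice_norm2_root[OF card8] subspace_scale[OF subspace_H] \<alpha> by blast
qed

definition I :: "'n set" where "I = - {p, q, r}"

lemma card_I: "card I = 5"
  using neq by (simp add: I_def card_Compl_8 card8)

lemma facet_mem_neg:
  assumes i: "i \<in> I"
  shows "- (\<sigma>/3) *\<^sub>R h - \<sigma> *\<^sub>R unit_vec i \<in> Orb"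
proof -
  \<comment> \<open>Two orthogonal roots with sum \<open>h + e_i\<close>. Scaled by
    \<open>\<sigma>\<close>, each has product 1 with \<open>v\<close>, so the two reflections
    together subtract \<open>\<sigma> (h + e_i)\<close> from \<open>v\<close>.\<close>
  define b g :: "real^'n" where "b = spin_vec {r, i}" and "g = spin_vec (- {p, q})"
  have "card {r, i} = 2" "card (- {p, q}) = 6"
    using i neq by (auto simp: I_def card_Compl_8 card8)
  then have "b \<in> roots_E8" "g \<in> roots_E8"
    unfolding b_def g_def by (simp_all add: spin_vec_root[OF card8])
  moreover have "b \<in> H" "g \<in> H"
    using i neq by (auto simp: H_def b_def g_def spin_vec_nth I_def)
  ultimately have bg: "b \<in> \<Phi>" "g \<in> \<Phi>" by auto
  have vb: "(\<sigma> *\<^sub>R b) \<bullet> v = 1" and vg: "(\<sigma> *\<^sub>R g) \<bullet> v = 1"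
    using \<sigma>_square bg neq i
    by (simp_all add: v_def inner_commute[of _ h] h_inner_H, simp_all add: b_def g_def spin_vec_nth)
  have "sym_diff (- {p, q}) {r, i} = - {p, q, r, i}" using i neq by (auto simp: I_def)
  moreover have "card {p, q, r, i} = 4" using i neq by (auto simp: I_def card_insert_if)
  then have "card (- {p, q, r, i}) = 4" by (simp add: card_Compl_8 card8)
  ultimately have gb: "g \<bullet> b = 0" by (simp add: b_def g_def spin_vec_inner card8)
  have "v - 1 *\<^sub>R (\<sigma> *\<^sub>R b) \<in> Orb"
    by (rule orbit_step[OF weyl_orbit_self scale_root[OF bg(1)] vb])
  moreover have "(\<sigma> *\<^sub>R g) \<bullet> (v - 1 *\<^sub>R (\<sigma> *\<^sub>R b)) = 1"
    using vg gb by (simp add: inner_diff_right)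
  ultimately have "v - 1 *\<^sub>R (\<sigma> *\<^sub>R b) - 1 *\<^sub>R (\<sigma> *\<^sub>R g) \<in> Orb"
    by (rule orbit_step[OF _ scale_root[OF bg(2)]])
  also have "v - 1 *\<^sub>R (\<sigma> *\<^sub>R b) - 1 *\<^sub>R (\<sigma> *\<^sub>R g) = - (\<sigma>/3) *\<^sub>R h - \<sigma> *\<^sub>R unit_vec i"
    using i neq by (auto simp: vec_eq_iff v_def h_nth b_def g_def spin_vec_nth unit_vec_nth I_def)
  finally show ?thesis .
qed

text \<open>The reflection in \<open>\<sigma> (e_i + e_j)\<close> replaces
  \<open>- \<sigma> e_j\<close> by \<open>\<sigma> e_i\<close>, for any second index
  \<open>j\<close> in \<open>I\<close>.\<close>

lemma facet_mem_pos:
  assumes i: "i \<in> I"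
  shows "- (\<sigma>/3) *\<^sub>R h + \<sigma> *\<^sub>R unit_vec i \<in> Orb"
proof -
  have "I \<noteq> {i}" using card_I by auto
  then obtain j where j: "j \<in> I" "j \<noteq> i" using i by blast
  let ?\<alpha> = "\<sigma> *\<^sub>R unit_vec i + \<sigma> *\<^sub>R unit_vec j"
  have "?\<alpha> \<in> roots_D" using \<sigma> j(2) by (intro roots_D_I) auto
  moreover have "?\<alpha> \<in> H" using i j by (auto simp: H_def I_def unit_vec_nth)
  ultimately have \<alpha>: "?\<alpha> \<in> \<Phi>" using roots_D_subset_E8 by blast
  have "?\<alpha> \<bullet> (- (\<sigma>/3) *\<^sub>R h - \<sigma> *\<^sub>R unit_vec j) = - 1"
    unfolding inner_unit_vec_sum using i j \<sigma>_square by (simp add: h_nth unit_vec_nth I_def)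
  from orbit_step[OF facet_mem_neg[OF j(1)] \<alpha> this] show ?thesis by (simp add: algebra_simps)
qed

lemma facet_mem:
  assumes "i \<in> I"
  shows "- (\<sigma>/3) *\<^sub>R h + unit_vec i \<in> Orb" "- (\<sigma>/3) *\<^sub>R h - unit_vec i \<in> Orb"
  using facet_mem_pos[OF assms] facet_mem_neg[OF assms] \<sigma> by (auto simp: add.commute)

text \<open>The level 2/3 is \<open>2 * N - 2\<close> for \<open>N = 4/3\<close>. It fixes the
  coordinates at \<open>p\<close>, \<open>q\<close>, \<open>r\<close> to 1/3 up to sign and makes
  \<open>x - v\<close> integral at \<open>r\<close>, hence everywhere. The coordinates in
  \<open>I\<close> are then integers with square sum \<open>4/3 - 3 * (1/9) = 1\<close>.\<close>

lemma facet:
  "{x \<in> Orb. - v \<bullet> x = 2/3} = (\<lambda>u. (1/2) *\<^sub>R (- v) + u) ` unit_vec ` I \<union>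
    (\<lambda>u. (1/2) *\<^sub>R (- v) - u) ` unit_vec ` I" (is "?F = ?G")
proof
  have c: "(1/2) *\<^sub>R (- v) = - (\<sigma>/3) *\<^sub>R h" by (simp add: v_def)
  show "?G \<subseteq> ?F"
  proof
    fix x assume "x \<in> ?G"
    then obtain i where i: "i \<in> I" "x = - (\<sigma>/3) *\<^sub>R h + unit_vec i \<or> x = - (\<sigma>/3) *\<^sub>R h - unit_vec i"
      unfolding c by blast
    have "h \<bullet> unit_vec i = 0" using i(1) by (simp add: inner_unit_vec h_nth I_def)
    then have "h \<bullet> x = - \<sigma>"
      using i(2) by (elim disjE) (simp_all add: inner_add_right inner_diff_right h_norm)
    then have "- v \<bullet> x = 2/3" using \<sigma>_square by (simp add: v_def)
    moreover have "x \<in> Orb" using facet_mem[OF i(1)] i(2) by metis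
    ultimately show "x \<in> ?F" by simp
  qed
  show "?F \<subseteq> ?G"
  proof
    fix x assume x: "x \<in> ?F"
    then have "x - v \<in> H" "x - v \<in> E8_lattice" using orbit_coset by blast+
    then have "x \<in> H" using subspace_add[OF subspace_H \<open>x - v \<in> H\<close> v_H] by simp
    then have "\<sigma> * x $ r = - (1/3)" using x h_inner_H[of x] by (simp add: v_def)
    then have xr: "x $ r = - (\<sigma>/3)" using \<sigma> by auto
    then have xpq: "x $ p = \<sigma>/3" "x $ q = \<sigma>/3" using \<open>x \<in> H\<close> by (simp_all add: H_def)
    have "(x - v) $ r = - \<sigma>" using xr by (simp add: v_def h_nth)
    then have "(x - v) $ r \<in> \<int>" using \<sigma> by auto
    then have int': "(x - v) $ i \<in> \<int>" for i
      using E8_lattice_integral[OF \<open>x - v \<in> E8_lattice\<close>] by blast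
    have int: "x $ i \<in> \<int>" if "i \<in> I" for i
    proof -
      have "v $ i = 0" using that by (simp add: I_def v_def h_nth)
      then show ?thesis using int'[of i] by simp
    qed
    have "(4/3 :: real) = (\<Sum>i\<in>UNIV. (x $ i)\<^sup>2)"
      using x weyl_orbit_norm[of x \<Phi> v] v_norm by (simp add: inner_vec_def power2_eq_square)
    also have "\<dots> = (\<Sum>i\<in>{p, q, r}. (x $ i)\<^sup>2) + (\<Sum>i\<in>I. (x $ i)\<^sup>2)"
      unfolding I_def Compl_eq_Diff_UNIV by (rule sum.subset_diff[THEN trans[OF _ add.commute]]) auto
    also have "(\<Sum>i\<in>{p, q, r}. (x $ i)\<^sup>2) = 1/3"
      unfolding power2_eq_square using neq \<sigma>_square by (simp add: xr xpq del: times_divide_eq_left)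
    finally have "(\<Sum>i\<in>I. (x $ i)\<^sup>2) = 1" by simp
    then obtain j where j: "j \<in> I" "x $ j \<in> {1, -1}" "\<And>i. i \<in> I \<Longrightarrow> i \<noteq> j \<Longrightarrow> x $ i = 0"
      using Ints_sum_squares_1[of I "\<lambda>i. x $ i"] int by auto
    have "x $ k = (- (\<sigma>/3) *\<^sub>R h + (x $ j) *\<^sub>R unit_vec j) $ k" for k
    proof (cases "k \<in> I")
      case True
      then show ?thesis using j(3)[of k] by (auto simp: I_def h_nth unit_vec_nth)
    next
      case False
      then have "k = p \<or> k = q \<or> k = r" "k \<noteq> j" using j(1) by (auto simp: I_def)
      then show ?thesis using xr xpq neq by (auto simp: h_nth unit_vec_nth)
    qed
    then have "x = - (\<sigma>/3) *\<^sub>R h + (x $ j) *\<^sub>R unit_vec j" unfolding vec_eq_iff by blast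
    then have "x = - (\<sigma>/3) *\<^sub>R h + unit_vec j \<or> x = - (\<sigma>/3) *\<^sub>R h - unit_vec j"
      using j(2) by auto
    then show "x \<in> ?G" unfolding c using j(1) by blast
  qed
qed

text \<open>Once \<open>x\<close> is moved to \<open>v\<close>, \<open>y\<close> becomes a vertex
  \<open>w y\<close> of the face in \<open>facet\<close>, whose centre is \<open>- v / 2\<close>.
  The opposite vertex of that face is \<open>- (v + w y)\<close>. So \<open>x + y\<close> is
  conjugate to the negative of a vertex, and all vertices are conjugate to \<open>v\<close>.\<close>

lemma sum_conjugate:
  assumes x: "x \<in> Orb" and y: "y \<in> Orb" and xy: "x \<bullet> y = - (2/3)"
  shows "\<exists>w\<in>weyl_group \<Phi>. w (x + y) = - v"
proof -
  obtain w where w: "w \<in> weyl_group \<Phi>" "w x = v" using weyl_orbit_transitive[OF x] .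
  have ow: "orthogonal_transformation w" by (rule orthogonal_transformation_weyl[OF w(1)])
  have wy: "w y \<in> Orb" by (rule weyl_orbit_closed[OF y w(1)])
  have "v \<bullet> w y = - (2/3)" using ow w(2) xy by (metis orthogonal_transformation_def)
  then have "w y \<in> {x \<in> Orb. - v \<bullet> x = 2/3}" using wy by simp
  then obtain u where u: "u \<in> unit_vec ` I"
    "w y = (1/2) *\<^sub>R (- v) + u \<or> w y = (1/2) *\<^sub>R (- v) - u" unfolding facet by blast
  have "(1/2) *\<^sub>R (- v) + u \<in> Orb" "(1/2) *\<^sub>R (- v) - u \<in> Orb" using facet u(1) by blast+
  moreover have "- (v + ((1/2) *\<^sub>R (- v) + u)) = (1/2) *\<^sub>R (- v) - u"
    "- (v + ((1/2) *\<^sub>R (- v) - u)) = (1/2) *\<^sub>R (- v) + u"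
    by (simp_all add: vec_eq_iff)
  ultimately have z: "- (v + w y) \<in> Orb" using u(2) by metis
  obtain w' where w': "w' \<in> weyl_group \<Phi>" "w' (- (v + w y)) = v" using weyl_orbit_transitive[OF z] .
  have "linear w" "linear w'"
    using ow orthogonal_transformation_weyl[OF w'(1)] by (simp_all add: orthogonal_transformation_linear)
  then have "w' (w (x + y)) = w' (v + w y)" by (simp only: linear_add w(2))
  then have "(w' \<circ> w) (x + y) = - v"
    using w'(2) linear_neg[OF \<open>linear w'\<close>, of "v + w y"] by (metis comp_apply minus_minus)
  then show ?thesis using weyl_group_comp[OF w'(1) w(1)] by blast
qed

sublocale minuscule: minuscule_orbit \<Phi> v "4/3" "- v" "unit_vec ` I" 5
proof
  show "\<alpha> \<bullet> \<alpha> = 2" if "\<alpha> \<in> \<Phi>" for \<alpha> using that roots_E8_norm[OF card8] by blast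
  show "x \<bullet> y \<in> {4/3, 4/3 - 1, 4/3 - 2, 4/3 - 3}" if "x \<in> Orb" "y \<in> Orb" for x y
    using orbit_inner[OF that] unfolding v_norm by (intro Ints_sum_D) auto
  \<comment> \<open>Vacuous: \<open>4/3 - 3\<close> is smaller than the least possible product
    \<open>- 4/3\<close>.\<close>
  show "y = - x \<and> (\<exists>z\<in>Orb. - z \<in> Orb \<and> x \<bullet> z = 4/3 - 1)"
    if "x \<in> Orb" "y \<in> Orb" "x \<bullet> y = 4/3 - 3" for x y
    using orbit_inner(2)[OF that(1,2)] that(3) unfolding v_norm by simp
  show "x - y \<in> \<Phi>" if "x \<in> Orb" "y \<in> Orb" "x \<bullet> y = 4/3 - 1" for x y
    using orbit_diff_root that v_norm by simp
  show "\<exists>w\<in>weyl_group \<Phi>. w (x + y) = - v" if "x \<in> Orb" "y \<in> Orb" "x \<bullet> y = 4/3 - 2" for x y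
    using sum_conjugate that by simp
  show "{x \<in> Orb. - v \<bullet> x = 2 * (4/3) - 2} = (\<lambda>u. (1/2) *\<^sub>R (- v) + u) ` unit_vec ` I \<union>
    (\<lambda>u. (1/2) *\<^sub>R (- v) - u) ` unit_vec ` I" using facet by simp
qed (simp_all add: v_norm card_I unit_vec_orthogonal)

lemma exchangeable_E6:
  assumes "x \<in> Orb" "y \<in> Orb" "x \<noteq> y"
  shows "exchangeable \<Phi> (eqs_cross_polytope 5 Orb) x y"
proof -
  have "x \<bullet> y \<noteq> 4/3" using minuscule.inner_eq_N_iff assms by blast
  moreover have "x \<bullet> y \<noteq> 4/3 - 3" using orbit_inner(2)[OF assms(1,2)] unfolding v_norm by auto
  ultimately consider "x \<bullet> y = 4/3 - 1" | "x \<bullet> y = 4/3 - 2"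
    using minuscule.inner_cases[OF assms(1,2)] by auto
  then show ?thesis
    by cases (use assms minuscule.exchangeable_adjacent minuscule.exchangeable_cross_polytope in blast)+
qed

end

section \<open>Type $E_7$\<close>

text \<open>A sum of two vertices with product - 1/2 has squared length
  \<open>3/2 + 3/2 - 1 = 2\<close> and is a root; \<open>k\<close> is the root chosen to represent
  these sums. \<open>H\<close> is the orthogonal sum of the line through \<open>k\<close> and the
  span of the unit vectors with index in \<open>I\<close>.\<close>

locale E7_orbit =
  fixes p q r :: "'n::finite"
  assumes card8: "CARD('n) = 8" and distinct: "distinct [p, q, r]"
begin

lemma neq: "p \<noteq> q" "p \<noteq> r" "q \<noteq> r" "q \<noteq> p" "r \<noteq> p" "r \<noteq> q"
  using distinct by auto

definition k :: "real^'n" where "k = unit_vec r - unit_vec q"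
definition v :: "real^'n" where "v = unit_vec p + (1/2) *\<^sub>R k"
definition H :: "(real^'n) set" where "H = {x. x $ q = - x $ r}"
definition I :: "'n set" where "I = - {q, r}"

lemma k_nth: "k $ i = (if i = r then 1 else if i = q then - 1 else 0)"
  using neq by (auto simp: k_def unit_vec_nth)

lemma k_inner: "k \<bullet> x = x $ r - x $ q"
  by (simp add: k_def inner_diff_left inner_unit_vec)

lemma k_inner_H: "x \<in> H \<Longrightarrow> k \<bullet> x = 2 * x $ r"
  by (simp add: k_inner H_def)

lemma k_norm: "k \<bullet> k = 2"
  using neq by (simp add: k_inner k_nth)

lemma v_norm: "v \<bullet> v = 3/2"
  using neq
  by (simp add: v_def inner_add_left inner_add_right k_norm inner_unit_vec k_nth unit_vec_nth)

lemma subspace_H: "subspace H"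
  by (auto simp: H_def subspace_def)

lemma v_H: "v \<in> H"
  using neq by (simp add: H_def v_def k_nth unit_vec_nth)

lemma v_inner_H: "x \<in> H \<Longrightarrow> x \<bullet> v = x $ p + x $ r"
  by (simp add: v_def inner_add_right inner_unit_vec inner_commute[of x k] k_inner_H)

sublocale E8_subsystem H v
proof
  fix \<alpha> assume \<alpha>: "\<alpha> \<in> roots_E8 \<inter> H"
  then have "\<alpha> $ p + \<alpha> $ r \<in> \<int>"
    using E8_lattice_coords(1)[of \<alpha> p r] roots_E8_subset_lattice[OF card8] neq by auto
  then show "\<alpha> \<bullet> v \<in> \<int>" using v_inner_H \<alpha> by simp
qed (use card8 subspace_H in auto)

lemma card_I: "card I = 6" and p_I: "p \<in> I"
  using neq by (simp_all add: I_def card_Compl_8 card8)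

lemma k_root: "k \<in> \<Phi>"
proof -
  have "1 *\<^sub>R unit_vec r + (- 1) *\<^sub>R unit_vec q \<in> roots_D"
    using neq by (intro roots_D_I) auto
  then have "k \<in> roots_D" by (simp add: k_def)
  moreover have "k \<in> H" using neq by (simp add: H_def k_nth)
  ultimately show ?thesis using roots_D_subset_E8 by blast
qed

lemma roots_I:
  assumes "i \<in> I" "j \<in> I" "i \<noteq> j" "s \<in> {1, -1}" "t \<in> {1, -1}"
  shows "s *\<^sub>R unit_vec i + t *\<^sub>R unit_vec j \<in> \<Phi>"
proof -
  have "s *\<^sub>R unit_vec i + t *\<^sub>R unit_vec j \<in> H" using assms by (auto simp: H_def I_def unit_vec_nth)
  then show ?thesis using roots_D_I[OF assms(3-5)] roots_D_subset_E8 by blast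
qed

text \<open>The root \<open>s e_i - t e_j\<close> is orthogonal to \<open>k\<close> and reflects
  \<open>s e_i\<close> to \<open>t e_j\<close>.\<close>

lemma facet_move:
  assumes i: "i \<in> I" "j \<in> I" "i \<noteq> j" "s \<in> {1, -1}" "t \<in> {1, -1}"
    and mem: "(1/2) *\<^sub>R k + s *\<^sub>R unit_vec i \<in> Orb"
  shows "(1/2) *\<^sub>R k + t *\<^sub>R unit_vec j \<in> Orb"
proof -
  have t: "- t \<in> {1, -1}" using assms by auto
  have "s * s = 1" using i by auto
  then have "(s *\<^sub>R unit_vec i + (- t) *\<^sub>R unit_vec j) \<bullet> ((1/2) *\<^sub>R k + s *\<^sub>R unit_vec i) = 1"
    using i unfolding inner_unit_vec_sum by (simp add: k_nth unit_vec_nth I_def)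
  from orbit_step[OF mem roots_I[OF i(1-4) t] this] show ?thesis by (simp add: algebra_simps)
qed

lemma facet_mem:
  assumes j: "j \<in> I" and t: "t \<in> {1, -1}"
  shows "(1/2) *\<^sub>R k + t *\<^sub>R unit_vec j \<in> Orb"
proof -
  have pos: "(1/2) *\<^sub>R k + 1 *\<^sub>R unit_vec p \<in> Orb"
    using weyl_orbit_self[of v] by (simp add: v_def add.commute)
  show ?thesis
  proof (cases "j = p")
    case False
    then show ?thesis using facet_move[OF p_I j _ _ t pos] by simp
  next
    case True
    \<comment> \<open>Vertices at the index \<open>p\<close> are reached through a second index, as
      \<open>facet_move\<close> needs distinct indices.\<close>
    have "I \<noteq> {p}" using card_I by auto
    then obtain i where i: "i \<in> I" "i \<noteq> p" using p_I by blast
    have "(1/2) *\<^sub>R k + 1 *\<^sub>R unit_vec i \<in> Orb"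
      using facet_move[OF p_I i(1) _ _ _ pos, of 1] i(2) by simp
    from facet_move[OF i(1) p_I i(2) _ t this] show ?thesis using True by simp
  qed
qed

text \<open>The level 1 is \<open>2 * N - 2\<close> for \<open>N = 3/2\<close>. It fixes the
  coordinates at \<open>q\<close> and \<open>r\<close> to - 1/2 and 1/2; the others are integers
  with square sum \<open>3/2 - 1/2 = 1\<close>.\<close>

lemma facet:
  "{x \<in> Orb. k \<bullet> x = 1} = (\<lambda>u. (1/2) *\<^sub>R k + u) ` unit_vec ` I \<union>
    (\<lambda>u. (1/2) *\<^sub>R k - u) ` unit_vec ` I" (is "?F = ?G")
proof
  show "?G \<subseteq> ?F"
  proof
    fix x assume "x \<in> ?G"
    then obtain i where i: "i \<in> I" "x = (1/2) *\<^sub>R k + unit_vec i \<or> x = (1/2) *\<^sub>R k - unit_vec i"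
      by blast
    have "k \<bullet> unit_vec i = 0" using i(1) by (simp add: inner_unit_vec k_nth I_def)
    then have "k \<bullet> x = 1"
      using i(2) by (elim disjE) (simp_all add: inner_add_right inner_diff_right k_norm)
    moreover have "x \<in> Orb"
      using facet_mem[OF i(1), of 1] facet_mem[OF i(1), of "-1"] i(2) by (elim disjE) simp_all
    ultimately show "x \<in> ?F" by simp
  qed
  show "?F \<subseteq> ?G"
  proof
    fix x assume x: "x \<in> ?F"
    then have "x - v \<in> H" "x - v \<in> E8_lattice" using orbit_coset by blast+
    then have "x \<in> H" using subspace_add[OF subspace_H \<open>x - v \<in> H\<close> v_H] by simp
    then have xr: "x $ r = 1/2" "x $ q = - (1/2)" using x k_inner_H[of x] by (simp_all add: H_def)
    have "(x - v) $ r = 0" using xr neq by (simp add: v_def k_nth unit_vec_nth)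
    then have "(x - v) $ r \<in> \<int>" by simp
    then have int': "(x - v) $ i \<in> \<int>" for i using E8_lattice_integral[OF \<open>x - v \<in> E8_lattice\<close>] by blast
    have int: "x $ i \<in> \<int>" if "i \<in> I" for i
    proof -
      have "v $ i \<in> \<int>" using that by (simp add: I_def v_def k_nth unit_vec_nth)
      then show ?thesis using Ints_add[OF int'[of i]] by simp
    qed
    have "(3/2 :: real) = (\<Sum>i\<in>UNIV. (x $ i)\<^sup>2)"
      using x weyl_orbit_norm[of x \<Phi> v] v_norm by (simp add: inner_vec_def power2_eq_square)
    also have "\<dots> = (\<Sum>i\<in>{q, r}. (x $ i)\<^sup>2) + (\<Sum>i\<in>I. (x $ i)\<^sup>2)"
      unfolding I_def Compl_eq_Diff_UNIV by (rule sum.subset_diff[THEN trans[OF _ add.commute]]) auto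
    also have "(\<Sum>i\<in>{q, r}. (x $ i)\<^sup>2) = 1/2"
      unfolding power2_eq_square using neq by (simp add: xr)
    finally have "(\<Sum>i\<in>I. (x $ i)\<^sup>2) = 1" by simp
    then obtain j where j: "j \<in> I" "x $ j \<in> {1, -1}" "\<And>i. i \<in> I \<Longrightarrow> i \<noteq> j \<Longrightarrow> x $ i = 0"
      using Ints_sum_squares_1[of I "\<lambda>i. x $ i"] int by auto
    have "x $ l = ((1/2) *\<^sub>R k + (x $ j) *\<^sub>R unit_vec j) $ l" for l
    proof (cases "l \<in> I")
      case True
      then show ?thesis using j(3)[of l] by (auto simp: I_def k_nth unit_vec_nth)
    next
      case False
      then have "l = q \<or> l = r" "l \<noteq> j" using j(1) by (auto simp: I_def)
      then show ?thesis using xr neq by (auto simp: k_nth unit_vec_nth)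
    qed
    then have "x = (1/2) *\<^sub>R k + (x $ j) *\<^sub>R unit_vec j" unfolding vec_eq_iff by blast
    then have "x = (1/2) *\<^sub>R k + unit_vec j \<or> x = (1/2) *\<^sub>R k - unit_vec j"
      using j(2) by auto
    then show "x \<in> ?G" using j(1) by blast
  qed
qed

section \<open>Transitivity of the Weyl group on the roots of type E7\<close>

lemma root_norm: "\<alpha> \<in> \<Phi> \<Longrightarrow> \<alpha> \<bullet> \<alpha> = 2"
  using roots_E8_norm[OF card8] by blast

lemma root_inner_int: "\<alpha> \<in> \<Phi> \<Longrightarrow> \<beta> \<in> \<Phi> \<Longrightarrow> \<alpha> \<bullet> \<beta> \<in> \<int>"
  using roots_E8_subset_lattice[OF card8] by (auto simp: E8_lattice_def)

lemma norm2_root: "x \<in> E8_lattice \<Longrightarrow> x \<in> H \<Longrightarrow> x \<bullet> x = 2 \<Longrightarrow> x \<in> \<Phi>"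
  using E8_lattice_norm2_root[OF card8] by blast

lemma reflection_root: "\<alpha> \<in> \<Phi> \<Longrightarrow> reflection \<alpha> x = x - (\<alpha> \<bullet> x) *\<^sub>R \<alpha>"
  by (intro reflection_norm2 root_norm)

lemma root_diff:
  assumes "\<alpha> \<in> \<Phi>" "\<beta> \<in> \<Phi>" "\<alpha> \<bullet> \<beta> = 1"
  shows "\<alpha> - \<beta> \<in> \<Phi>"
proof (rule norm2_root)
  show "\<alpha> - \<beta> \<in> E8_lattice"
    using assms roots_E8_subset_lattice[OF card8] by (blast intro: E8_lattice_diff)
  show "\<alpha> - \<beta> \<in> H" using assms by (blast intro: subspace_diff[OF subspace_H])
  show "(\<alpha> - \<beta>) \<bullet> (\<alpha> - \<beta>) = 2"
    using assms by (simp add: inner_diff_left inner_diff_right inner_commute root_norm)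
qed

text \<open>The difference \<open>k - \<rho>\<close> is a root, and its reflection interchanges
  \<open>k\<close> and \<open>\<rho>\<close>.\<close>

lemma root_conjugate_1:
  assumes "\<rho> \<in> \<Phi>" "k \<bullet> \<rho> = 1"
  shows "k \<in> weyl_orbit \<Phi> \<rho>"
proof -
  have \<alpha>: "k - \<rho> \<in> \<Phi>" by (rule root_diff[OF k_root assms])
  have "(k - \<rho>) \<bullet> \<rho> = - 1" using assms by (simp add: inner_diff_left root_norm)
  then have "reflection (k - \<rho>) \<rho> = k" by (simp add: reflection_root[OF \<alpha>])
  then show ?thesis using weyl_orbit_reflection[OF weyl_orbit_self \<alpha>, of \<rho>] by simp
qed

lemma root_conjugate_minus_1:
  assumes "\<rho> \<in> \<Phi>" "k \<bullet> \<rho> = - 1"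
  shows "k \<in> weyl_orbit \<Phi> \<rho>"
proof -
  have "- \<rho> \<in> \<Phi>"
    using assms(1) subspace_neg[OF subspace_H]
    by (intro norm2_root)
      (use roots_E8_subset_lattice[OF card8] in \<open>auto simp: E8_lattice_def root_norm\<close>)
  then have "k \<in> weyl_orbit \<Phi> (- \<rho>)" using root_conjugate_1[of "- \<rho>"] assms by simp
  moreover have "- \<rho> \<in> weyl_orbit \<Phi> \<rho>"
    using weyl_orbit_reflection[OF weyl_orbit_self assms(1), of \<rho>] by (simp add: reflection_self)
  ultimately show ?thesis using weyl_orbit_eq by blast
qed

text \<open>A root with product 1 with both \<open>k\<close> and \<open>\<rho>\<close> reflects
  \<open>\<rho>\<close> to a root whose product with \<open>k\<close> is - 1, the case already
  settled. Such a root is half-integral: \<open>\<rho>\<close> vanishes at \<open>q\<close> and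
  \<open>r\<close>, so the signs at \<open>q\<close>, \<open>r\<close> can be taken from
  \<open>k\<close> and those at \<open>i\<close>, \<open>j\<close> from
  \<open>\<rho>\<close>.\<close>

lemma root_conjugate_0:
  assumes "\<rho> \<in> \<Phi>" "k \<bullet> \<rho> = 0"
  shows "k \<in> weyl_orbit \<Phi> \<rho>"
proof -
  have "\<rho> $ r = 0" "\<rho> $ q = 0" using assms k_inner_H[of \<rho>] by (simp_all add: H_def)
  have "\<rho> \<in> roots_E8" using assms by blast
  then have "\<rho> \<in> roots_D"
    by (rule roots_E8_cases[OF card8])
      (use \<open>\<rho> $ r = 0\<close> in \<open>auto simp: spin_vec_nth split: if_splits\<close>)
  then obtain i j s t where ij: "i \<noteq> j" "s \<in> {1, -1}" "t \<in> {1, -1}"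
    "\<rho> = s *\<^sub>R unit_vec i + t *\<^sub>R unit_vec j" by (elim roots_D_E)
  have I: "i \<in> I" "j \<in> I"
    using \<open>\<rho> $ r = 0\<close> \<open>\<rho> $ q = 0\<close> ij by (auto simp: I_def unit_vec_nth split: if_splits)
  \<comment> \<open>The spare index \<open>l\<close> repairs the parity of \<open>S\<close> without
    disturbing the four prescribed signs.\<close>
  have "card {i, j, q, r} \<le> 4" by (simp add: card_insert_if)
  then have "{i, j, q, r} \<noteq> UNIV" using card8 by auto
  then obtain l where l: "l \<notin> {i, j, q, r}" by blast
  define S0 where "S0 = {r} \<union> {m. m = i \<and> s = 1} \<union> {m. m = j \<and> t = 1}"
  define S where "S = (if even (card S0) then S0 else insert l S0)"
  have "l \<notin> S0" using l by (auto simp: S0_def)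
  then have "even (card S)" by (simp add: S_def)
  then have "spin_vec S \<in> roots_E8" by (rule spin_vec_root[OF card8])
  moreover have S: "r \<in> S" "q \<notin> S" "i \<in> S \<longleftrightarrow> s = 1" "j \<in> S \<longleftrightarrow> t = 1"
    using I l ij(1) neq by (auto simp: S_def S0_def I_def)
  then have "spin_vec S \<in> H" by (simp add: H_def spin_vec_nth)
  ultimately have \<gamma>: "spin_vec S \<in> \<Phi>" by blast
  have \<gamma>\<rho>: "spin_vec S \<bullet> \<rho> = 1"
    unfolding inner_commute[of "spin_vec S"] ij(4) inner_unit_vec_sum
    using ij(2,3) S(3,4) by (auto simp: spin_vec_nth)
  have k\<gamma>: "k \<bullet> spin_vec S = 1" using S(1,2) by (simp add: k_inner spin_vec_nth)
  have refl: "reflection (spin_vec S) \<rho> = \<rho> - spin_vec S"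
    using \<gamma>\<rho> by (simp add: reflection_root[OF \<gamma>])
  have "\<rho> - spin_vec S \<in> \<Phi>" using root_diff[OF assms(1) \<gamma>] \<gamma>\<rho> by (simp add: inner_commute)
  moreover have "k \<bullet> (\<rho> - spin_vec S) = - 1" using assms(2) k\<gamma> by (simp add: inner_diff_right)
  ultimately have "k \<in> weyl_orbit \<Phi> (\<rho> - spin_vec S)" by (rule root_conjugate_minus_1)
  moreover have "\<rho> - spin_vec S \<in> weyl_orbit \<Phi> \<rho>"
    using weyl_orbit_reflection[OF weyl_orbit_self \<gamma>, of \<rho>] by (simp only: refl)
  ultimately show ?thesis using weyl_orbit_eq by blast
qed

lemma root_conjugate:
  assumes \<rho>: "\<rho> \<in> \<Phi>"
  shows "k \<in> weyl_orbit \<Phi> \<rho>"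
proof -
  have norms: "k \<bullet> k = 2" "\<rho> \<bullet> \<rho> = 2" using k_norm root_norm[OF \<rho>] by auto
  have "\<bar>k \<bullet> \<rho>\<bar> \<le> norm k * norm \<rho>" by (rule Cauchy_Schwarz_ineq2)
  then have le: "\<bar>k \<bullet> \<rho>\<bar> \<le> 2" by (simp add: norm_eq_sqrt_inner norms)
  have "k \<bullet> \<rho> \<in> \<int>" by (rule root_inner_int[OF k_root \<rho>])
  then obtain z where z: "k \<bullet> \<rho> = of_int z" by (elim Ints_cases)
  then have "\<bar>z\<bar> \<le> 2" using le by linarith
  then have "z = 2 \<or> z = 1 \<or> z = 0 \<or> z = - 1 \<or> z = - 2" by linarith
  then consider "k \<bullet> \<rho> = 2" | "k \<bullet> \<rho> = 1" | "k \<bullet> \<rho> = 0" | "k \<bullet> \<rho> = - 1" | "k \<bullet> \<rho> = - 2"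
    using z by auto
  then show ?thesis
  proof cases
    case 1
    then have "(k - \<rho>) \<bullet> (k - \<rho>) = 0"
      using norms by (simp add: inner_diff_left inner_diff_right inner_commute)
    then have "k = \<rho>" by simp
    then show ?thesis by (simp add: weyl_orbit_self)
  next
    case 5
    then have "(k + \<rho>) \<bullet> (k + \<rho>) = 0"
      using norms by (simp add: inner_add_left inner_add_right inner_commute)
    then have "k = - \<rho>" by (simp add: eq_neg_iff_add_eq_0)
    then show ?thesis
      using weyl_orbit_reflection[OF weyl_orbit_self \<rho>, of \<rho>] by (simp add: reflection_self)
  qed (use root_conjugate_1 root_conjugate_0 root_conjugate_minus_1 \<rho> in blast)+
qed

text \<open>\<open>v\<close> is not in the lattice but \<open>2 v\<close> is, so
  \<open>x + y = (x - v) + (y - v) + 2 v\<close> is a lattice vector. Its squared length is 2, hence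
  it is a root, and all roots are conjugate to \<open>k\<close>.\<close>

lemma sum_conjugate:
  assumes x: "x \<in> Orb" and y: "y \<in> Orb" and xy: "x \<bullet> y = - (1/2)"
  shows "\<exists>w\<in>weyl_group \<Phi>. w (x + y) = k"
proof -
  have vv: "v + v \<in> E8_lattice"
    unfolding E8_lattice_def
  proof (rule CollectI, rule ballI)
    fix \<alpha> :: "real^'n" assume "\<alpha> \<in> roots_E8"
    then have \<alpha>: "\<alpha> \<in> E8_lattice" using roots_E8_subset_lattice[OF card8] by blast
    have "\<alpha> \<bullet> (v + v) = 2 * \<alpha> $ p + (\<alpha> $ r - \<alpha> $ q)"
      by (simp only: v_def inner_add_right inner_scaleR_right inner_unit_vec inner_commute[of \<alpha> k] k_inner)
        simp
    then show "\<alpha> \<bullet> (v + v) \<in> \<int>"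
      using E8_lattice_twice[OF \<alpha>, of p q] E8_lattice_coords(2)[OF \<alpha>, of r q] neq by simp
  qed
  have xy_v: "x - v \<in> E8_lattice" "x - v \<in> H" "y - v \<in> E8_lattice" "y - v \<in> H"
    using orbit_coset(1)[OF x] orbit_coset(1)[OF y] by auto
  have "(x - v) + (y - v) + (v + v) \<in> E8_lattice"
    by (intro E8_lattice_add xy_v vv)
  moreover have "(x - v) + (y - v) + (v + v) \<in> H"
    by (intro subspace_add[OF subspace_H] xy_v v_H)
  moreover have "(x - v) + (y - v) + (v + v) = x + y" by simp
  moreover have "(x + y) \<bullet> (x + y) = 2"
    using weyl_orbit_norm[OF x] weyl_orbit_norm[OF y] xy v_norm
    by (simp add: inner_add_left inner_add_right inner_commute)
  ultimately have "x + y \<in> \<Phi>" using norm2_root by metis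
  then have "k \<in> weyl_orbit \<Phi> (x + y)" by (rule root_conjugate)
  then obtain w where "k = w (x + y)" "w \<in> weyl_group \<Phi>" unfolding weyl_orbit_def by (rule imageE)
  then show ?thesis by (intro bexI[of _ w]) simp
qed

lemma orbit_opposite:
  assumes x: "x \<in> Orb" and y: "y \<in> Orb" and xy: "x \<bullet> y = - (3/2)"
  shows "y = - x"
proof -
  have "(x + y) \<bullet> (x + y) = 0"
    using weyl_orbit_norm[OF x] weyl_orbit_norm[OF y] xy v_norm
    by (simp add: inner_add_left inner_add_right inner_commute)
  then show ?thesis by (simp add: eq_neg_iff_add_eq_0 add.commute)
qed

text \<open>The reflection in \<open>k\<close> takes the vertex \<open>k / 2 - e_p\<close> to
  \<open>- v\<close>. Negation commutes with the Weyl group, so this spreads to the whole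
  orbit.\<close>

lemma uminus_orbit:
  assumes x: "x \<in> Orb"
  shows "- x \<in> Orb"
proof -
  obtain w where w: "w \<in> weyl_group \<Phi>" "w x = v" using weyl_orbit_transitive[OF x] .
  obtain w' where w': "w' \<in> weyl_group \<Phi>" "\<forall>x. w' (w x) = x" using weyl_group_inv[OF w(1)] by blast
  have a: "(1/2) *\<^sub>R k + (- 1) *\<^sub>R unit_vec p \<in> Orb" using facet_mem[OF p_I, of "- 1"] by simp
  have "k \<bullet> ((1/2) *\<^sub>R k + (- 1) *\<^sub>R unit_vec p) = 1"
    using neq by (simp add: inner_diff_right k_norm inner_unit_vec k_nth)
  from orbit_step[OF a k_root this] have "- v \<in> Orb"
    by (rule back_subst[of "\<lambda>x. x \<in> Orb"]) (simp add: v_def vec_eq_iff)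
  then have "w' (- v) \<in> Orb" by (rule weyl_orbit_closed[OF _ w'(1)])
  moreover have "w' (- v) = - x"
    using w(2) w'(2) linear_neg[OF orthogonal_transformation_linear[OF
      orthogonal_transformation_weyl[OF w'(1)]]] by metis
  ultimately show ?thesis by simp
qed

text \<open>A neighbour of \<open>v\<close> is \<open>k / 2 + e_i\<close> with
  \<open>i \<noteq> p\<close>; the Weyl group transports it. It is the extra vertex demanded by
  \<open>opposite\<close>.\<close>

lemma orbit_neighbour:
  assumes x: "x \<in> Orb"
  shows "\<exists>z\<in>Orb. x \<bullet> z = 1/2"
proof -
  obtain w where w: "w \<in> weyl_group \<Phi>" "w x = v" using weyl_orbit_transitive[OF x] .
  obtain w' where w': "w' \<in> weyl_group \<Phi>" "\<forall>x. w' (w x) = x" using weyl_group_inv[OF w(1)] by blast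
  have "I \<noteq> {p}" using card_I by auto
  then obtain i where i: "i \<in> I" "i \<noteq> p" using p_I by blast
  let ?z = "(1/2) *\<^sub>R k + 1 *\<^sub>R unit_vec i"
  have z: "?z \<in> Orb" using facet_mem[OF i(1), of 1] by simp
  have "?z \<in> H" using i(1) neq by (auto simp: H_def k_nth unit_vec_nth I_def)
  then have "v \<bullet> ?z = 1/2"
    using i neq v_inner_H[of ?z] by (auto simp: inner_commute[of v] k_nth unit_vec_nth I_def)
  then have "x \<bullet> w' ?z = 1/2"
    using w(2) w'(2) orthogonal_transformation_weyl[OF w'(1)] by (metis orthogonal_transformation_def)
  then show ?thesis using weyl_orbit_closed[OF z w'(1)] by blast
qed

sublocale minuscule: minuscule_orbit \<Phi> v "3/2" k "unit_vec ` I" 6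
proof
  show "\<alpha> \<bullet> \<alpha> = 2" if "\<alpha> \<in> \<Phi>" for \<alpha> using that by (rule root_norm)
  show "x \<bullet> y \<in> {3/2, 3/2 - 1, 3/2 - 2, 3/2 - 3}" if "x \<in> Orb" "y \<in> Orb" for x y
    using orbit_inner[OF that] unfolding v_norm by (intro Ints_sum_D) auto
  show "y = - x \<and> (\<exists>z\<in>Orb. - z \<in> Orb \<and> x \<bullet> z = 3/2 - 1)"
    if "x \<in> Orb" "y \<in> Orb" "x \<bullet> y = 3/2 - 3" for x y
    using orbit_opposite[OF that(1,2)] that(3) orbit_neighbour[OF that(1)] uminus_orbit by auto
  show "x - y \<in> \<Phi>" if "x \<in> Orb" "y \<in> Orb" "x \<bullet> y = 3/2 - 1" for x y
    using orbit_diff_root that v_norm by simp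
  show "\<exists>w\<in>weyl_group \<Phi>. w (x + y) = k" if "x \<in> Orb" "y \<in> Orb" "x \<bullet> y = 3/2 - 2" for x y
    using sum_conjugate that by simp
  show "{x \<in> Orb. k \<bullet> x = 2 * (3/2) - 2} = (\<lambda>u. (1/2) *\<^sub>R k + u) ` unit_vec ` I \<union>
    (\<lambda>u. (1/2) *\<^sub>R k - u) ` unit_vec ` I" using facet by simp
qed (simp_all add: v_norm card_I unit_vec_orthogonal)

lemma exchangeable_E7:
  assumes "x \<in> Orb" "y \<in> Orb" "x \<noteq> y"
  shows "exchangeable \<Phi> (insert (eq_antipodal Orb) (eqs_cross_polytope 6 Orb)) x y"
proof -
  have "x \<bullet> y \<noteq> 3/2" using minuscule.inner_eq_N_iff assms by blast
  then consider "x \<bullet> y = 3/2 - 1" | "x \<bullet> y = 3/2 - 2" | "x \<bullet> y = 3/2 - 3"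
    using minuscule.inner_cases[OF assms(1,2)] by auto
  then show ?thesis
    by cases (use assms minuscule.exchangeable_adjacent minuscule.exchangeable_cross_polytope
      minuscule.exchangeable_antipodal in blast)+
qed

end

section \<open>The minuscule pairs\<close>

theorem theorem3p4:
  fixes \<Phi> :: "(real^'n) set" and v :: "real^'n" and \<F> :: "(real^'n) trop_poly set"
  assumes "minuscule_pair \<Phi> v \<F>"
  shows "affinely_invariant (weyl_orbit \<Phi> v) \<F> \<and>
         (\<forall>\<mu> \<in> trop_variety (weyl_orbit \<Phi> v) \<F>. strong_matroidal_subdivision \<Phi> v \<mu>)"
  using assms
proof cases
  case (A K)
  show ?thesis
    unfolding A
  proof (rule strong_exchange_criterion)
    show "exchangeable roots_A (eqs_A (card K)) x y"
      if xy: "x \<in> weyl_orbit roots_A (e_vec K)" "y \<in> weyl_orbit roots_A (e_vec K)" "x \<noteq> y" for x y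
    proof -
      obtain S where "x = e_vec S" "card S = card K" using orbit_A[OF xy(1)] .
      moreover obtain T where "y = e_vec T" "card T = card K" using orbit_A[OF xy(2)] .
      ultimately show ?thesis using xy(3) exchangeable_A[of S T] by auto
    qed
  qed (rule balanced_eqs_A)
next
  case (B_spin K)
  show ?thesis
    unfolding B_spin
  proof (rule strong_exchange_criterion)
    show "exchangeable roots_B eqs_B_spin x y"
      if xy: "x \<in> weyl_orbit roots_B (spin_vec K)" "y \<in> weyl_orbit roots_B (spin_vec K)" "x \<noteq> y" for x y
    proof -
      obtain S where "x = spin_vec S" using orbit_B_spin[OF xy(1)] .
      moreover obtain T where "y = spin_vec T" using orbit_B_spin[OF xy(2)] .
      ultimately show ?thesis using xy(3) exchangeable_B_spin[of S T] by auto
    qed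
    show "balanced f" if "f \<in> eqs_B_spin" for f :: "(real^'n) trop_poly"
      using that balanced_spin_exchange unfolding eqs_B_spin_def by (auto split: if_splits)
  qed
next
  case (C_vector i)
  show ?thesis
    unfolding C_vector
  proof (rule strong_exchange_criterion)
    show "exchangeable roots_C {} x y"
      if xy: "x \<in> weyl_orbit roots_C (unit_vec i)" "y \<in> weyl_orbit roots_C (unit_vec i)" "x \<noteq> y" for x y
    proof -
      obtain j s where "x = s *\<^sub>R unit_vec j" "s \<in> {1, -1}" using orbit_C_vector[OF xy(1)] .
      moreover obtain k t where "y = t *\<^sub>R unit_vec k" "t \<in> {1, -1}" using orbit_C_vector[OF xy(2)] .
      ultimately show ?thesis using xy(3) exchangeable_C_vector[of s t j k] by blast
    qed
  qed simp
next
  case (D_vector i)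
  show ?thesis
    unfolding D_vector
  proof (rule strong_exchange_criterion)
    show "exchangeable roots_D eqs_D_vector x y"
      if xy: "x \<in> weyl_orbit roots_D (unit_vec i)" "y \<in> weyl_orbit roots_D (unit_vec i)" "x \<noteq> y" for x y
    proof -
      obtain j s where "x = s *\<^sub>R unit_vec j" "s \<in> {1, -1}" using orbit_D_vector[OF xy(1)] .
      moreover obtain k t where "y = t *\<^sub>R unit_vec k" "t \<in> {1, -1}" using orbit_D_vector[OF xy(2)] .
      ultimately show ?thesis using xy(3) exchangeable_D_vector[of s t j k] by blast
    qed
  qed (rule balanced_eqs_D_vector)
next
  case (D_spin_even K)
  show ?thesis
    unfolding D_spin_even
  proof (rule strong_exchange_criterion)
    show "exchangeable roots_D eqs_D_spin_even x y"
      if xy: "x \<in> weyl_orbit roots_D (spin_vec K)" "y \<in> weyl_orbit roots_D (spin_vec K)" "x \<noteq> y" for x y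
    proof -
      obtain S where S: "x = spin_vec S" "even (card S) \<longleftrightarrow> even (card K)"
        using orbit_D_spin[OF xy(1)] .
      obtain T where T: "y = spin_vec T" "even (card T) \<longleftrightarrow> even (card K)"
        using orbit_D_spin[OF xy(2)] .
      show ?thesis
        unfolding S(1) T(1)
        by (rule exchangeable_D_spin)
          (use S T xy(3) D_spin_even in \<open>auto simp: eqs_D_spin_even_def\<close>)
    qed
    show "balanced f" if "f \<in> eqs_D_spin_even" for f :: "(real^'n) trop_poly"
      using that balanced_spin_exchange unfolding eqs_D_spin_even_def by auto
  qed
next
  case (D_spin_odd K)
  show ?thesis
    unfolding D_spin_odd
  proof (rule strong_exchange_criterion)
    show "exchangeable roots_D eqs_D_spin_odd x y"
      if xy: "x \<in> weyl_orbit roots_D (spin_vec K)" "y \<in> weyl_orbit roots_D (spin_vec K)" "x \<noteq> y" for x y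
    proof -
      obtain S where S: "x = spin_vec S" "even (card S) \<longleftrightarrow> even (card K)"
        using orbit_D_spin[OF xy(1)] .
      obtain T where T: "y = spin_vec T" "even (card T) \<longleftrightarrow> even (card K)"
        using orbit_D_spin[OF xy(2)] .
      show ?thesis
        unfolding S(1) T(1)
        by (rule exchangeable_D_spin)
          (use S T xy(3) D_spin_odd in \<open>auto simp: eqs_D_spin_odd_def\<close>)
    qed
    show "balanced f" if "f \<in> eqs_D_spin_odd" for f :: "(real^'n) trop_poly"
      using that balanced_spin_exchange unfolding eqs_D_spin_odd_def by auto
  qed
next
  case (E6_1 p q r)
  interpret E6: E6_orbit p q r 1 using E6_1 by unfold_locales auto
  have \<Phi>: "\<Phi> = E6.\<Phi>" and v: "v = E6.v"
    by (simp_all add: E6_1(1,5) roots_E6_eq E6.H_def E6.v_def E6.h_def)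
  have \<F>: "\<F> = eqs_cross_polytope 5 E6.Orb" unfolding E6_1(2) \<Phi>[unfolded E6_1(1)] v ..
  show ?thesis
    unfolding \<Phi> v \<F>
    by (rule strong_exchange_criterion) (auto intro: balanced_eqs_cross_polytope E6.exchangeable_E6)
next
  case (E6_6 i p q r)
  interpret E6: E6_orbit p q r "-1" using E6_6 by unfold_locales auto
  have \<Phi>: "\<Phi> = E6.\<Phi>" by (simp add: E6_6(1) roots_E6_eq E6.H_def)
  \<comment> \<open>The given weight is the face vertex \<open>h / 3 + e_i\<close> in the orbit of
    \<open>- (2/3) h\<close>, so it generates the same orbit.\<close>
  have "i \<in> E6.I" using E6_6 by (simp add: E6.I_def)
  from E6.facet_mem(1)[OF this] have "v \<in> E6.Orb" by (simp add: E6_6 E6.h_def)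
  then have orb: "weyl_orbit E6.\<Phi> v = E6.Orb" by (rule weyl_orbit_eq)
  have \<F>: "\<F> = eqs_cross_polytope 5 E6.Orb" unfolding E6_6(2) \<Phi>[unfolded E6_6(1)] orb ..
  \<comment> \<open>The base point \<open>v\<close> stays in the matroid statement; only its orbit
    is rewritten.\<close>
  show ?thesis
    unfolding \<Phi> \<F>
    by (rule strong_exchange_criterion, unfold orb)
      (auto intro: balanced_eqs_cross_polytope E6.exchangeable_E6)
next
  case (E7_7 p q r)
  interpret E7: E7_orbit p q r using E7_7 by unfold_locales auto
  have \<Phi>: "\<Phi> = E7.\<Phi>" and v: "v = E7.v"
    by (simp_all add: E7_7(1,5) roots_E7_eq E7.H_def E7.v_def E7.k_def)
  have \<F>: "\<F> = insert (eq_antipodal E7.Orb) (eqs_cross_polytope 6 E7.Orb)"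
    unfolding E7_7(2) \<Phi>[unfolded E7_7(1)] v ..
  show ?thesis
    unfolding \<Phi> v \<F>
    by (rule strong_exchange_criterion)
      (auto intro: balanced_eqs_cross_polytope E7.minuscule.balanced_eq_antipodal E7.exchangeable_E7)
qed

end
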